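(* Let $H$ be a finite-dimensional Hopf algebra and let $(X,\alpha,\beta)$ be a left-right $(H,\widehat H)$-Yetter--Drinfeld algebra. Then $(X,\alpha,\beta)$ is braided commutative (in the sense of the Heisenberg-algebra condition given in the context) if and only if the (left-left) Yetter--Drinfeld algebra $(X,\rhd_\beta,\alpha)$ over $H$ is braided commutative, i.e. $xy=(x_{[-1]}\rhd_\beta y)\,x_{[0]}$ for all $x,y\in X$, where $\alpha(x)=x_{[-1]}\otimes x_{[0]}$ and $h\rhd_\beta x=(\mathrm{id}_X\otimes\mathbf p(h,\cdot))(\beta(x))$.
   Context: $\Bbbk$ is a field, algebras are unital $\Bbbk$-algebras. $H$ has structure maps $\Delta,\varepsilon,S$, with Sweedler notation; $\widehat H$ is the dual Hopf algebra and $\mathbf p:H\times\widehat H\to\Bbbk$, $\mathbf p(h,\theta)=\theta(h)$, so that $\mathbf p(h,\theta\theta')=\mathbf p(h_{(1)},\theta)\mathbf p(h_{(2)},\theta')$ and $\mathbf p(hh',\theta)=\mathbf p(h,\theta_{(1)})\mathbf p(h',\theta_{(2)})$. The canonical element is $U=\sum_i h_i\otimes\widehat h_i\in H\otimes\widehat H$ (dual bases), invertible with $U^{-1}=(S\otimes\mathrm{id})(U)$; $\mathrm{Ad}(W)(z)=WzW^{-1}$; $U_{13}$ is $U$ placed in legs 1 and 3 of a threefold tensor product. $\Sigma$ denotes the flip of tensor factors. A left coaction of a Hopf algebra $K$ on an algebra $X$ is an algebra homomorphism $\alpha:X\to K\otimes X$ with $(\mathrm{id}\otimes\alpha)\alpha=(\Delta_K\otimes\mathrm{id})\alpha$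 and $(\varepsilon_K\otimes\mathrm{id})\alpha=\mathrm{id}$; right coactions are defined similarly. A left-right $(H,\widehat H)$-Yetter--Drinfeld algebra is a triple $(X,\alpha,\beta)$ with $X$ an algebra, $\alpha:X\to H\otimes X$ a left coaction of $H$, $\beta:X\to X\otimes\widehat H$ a right coaction of $\widehat H$, such that $(\alpha\otimes\mathrm{id}_{\widehat H})\beta=\mathrm{Ad}(U_{13})(\mathrm{id}_H\otimes\beta)\alpha$. In that case $(X,\rhd_\beta,\alpha)$ is a (left-left) Yetter--Drinfeld algebra over $H$. The Heisenberg algebra $\mathcal H(H)=H\#\widehat H$ is the vector space $H\otimes\widehat H$ with product $(h\#\theta)(h'\#\theta')=h\,h'_{(1)}\,\mathbf p(h'_{(2)},\theta_{(1)})\#\theta_{(2)}\theta'$. $\mathcal H(H)\otimes X$ is the tensor product algebra, with multiplication map $\mathfrak m_{\mathcal H(H)\otimes X}$. Put $\iota_{1,X}:H\otimes X\to\mathcal H(H)\otimes X$, $h\otimes x\mapsto h\#1\otimes x$ and $\iota_{2,X}:\widehat H\otimes X\to\mathcal H(H)\otimes X$, $\theta\otimes x\mapsto1\#\theta\otimes x$. $(X,\alpha,\beta)$ is called braided commutative if for all $x,y\in X$ $$\mathfrak m_{\mathcal H(H)\otimes X}(\iota_{1,X}\otimes\iota_{2,X})(\alpha(x)\otimes\Sigma\beta(y))=\mathfrak m_{\mathcal H(H)\otimes X}(\iota_{2,X}\otimes\iota_{1,X})(\Sigma\beta(y)\otimes\alpha(x)).$$ *)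

theory Defs
  imports "HOL-Algebra.Module" "HOL-Algebra.AbelCoset"
begin

text \<open>
  Vector spaces are modules (in the sense of HOL-Algebra) over a ring structure that is assumed to
  be a field. A record of type \<open>module\<close> also has the slots \<open>mult\<close> and \<open>one\<close>, so it can carry an
  algebra; HOL-Algebra's locale \<open>algebra\<close> is not used because it is commutative. The zero algebra
  counts as an algebra.
\<close>

locale unital_algebra = field R + module R A + ring A for R (structure) and A (structure) +
  assumes smult_mult_left:
    "\<lbrakk>r \<in> carrier R; a \<in> carrier A; b \<in> carrier A\<rbrakk>
      \<Longrightarrow> (r \<odot>\<^bsub>A\<^esub> a) \<otimes>\<^bsub>A\<^esub> b = r \<odot>\<^bsub>A\<^esub> (a \<otimes>\<^bsub>A\<^esub> b)"
  and smult_mult_right: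
    "\<lbrakk>r \<in> carrier R; a \<in> carrier A; b \<in> carrier A\<rbrakk>
      \<Longrightarrow> a \<otimes>\<^bsub>A\<^esub> (r \<odot>\<^bsub>A\<^esub> b) = r \<odot>\<^bsub>A\<^esub> (a \<otimes>\<^bsub>A\<^esub> b)"

definition ground_algebra :: "('r, 'p) ring_scheme \<Rightarrow> ('r, 'r) module" where
  "ground_algebra R =
    \<lparr>carrier = carrier R, mult = mult R, one = one R, zero = zero R, add = add R, smult = mult R\<rparr>"

definition linear_maps ::
  "('r, 'p) ring_scheme \<Rightarrow> ('r, 'a, 'm) module_scheme \<Rightarrow> ('r, 'b, 'n) module_scheme \<Rightarrow> ('a \<Rightarrow> 'b) set"
  where
  "linear_maps R M N = {f \<in> carrier M \<rightarrow> carrier N.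
     (\<forall>x\<in>carrier M. \<forall>y\<in>carrier M. f (x \<oplus>\<^bsub>M\<^esub> y) = f x \<oplus>\<^bsub>N\<^esub> f y) \<and>
     (\<forall>r\<in>carrier R. \<forall>x\<in>carrier M. f (r \<odot>\<^bsub>M\<^esub> x) = r \<odot>\<^bsub>N\<^esub> f x)}"

definition algebra_homs ::
  "('r, 'p) ring_scheme \<Rightarrow> ('r, 'a, 'm) module_scheme \<Rightarrow> ('r, 'b, 'n) module_scheme \<Rightarrow> ('a \<Rightarrow> 'b) set"
  where
  "algebra_homs R A B = ring_hom A B \<inter> linear_maps R A B"


section \<open>Tensor products\<close>

definition free_space :: "('r, 'p) ring_scheme \<Rightarrow> 'i set \<Rightarrow> ('r, 'i \<Rightarrow> 'r) module" where
  "free_space R I =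
    \<lparr>carrier = {c. (\<forall>i\<in>I. c i \<in> carrier R) \<and> (\<forall>i. i \<notin> I \<longrightarrow> c i = \<zero>\<^bsub>R\<^esub>) \<and> finite {i. c i \<noteq> \<zero>\<^bsub>R\<^esub>}},
     mult = undefined, one = undefined,
     zero = (\<lambda>i. \<zero>\<^bsub>R\<^esub>), add = (\<lambda>c d i. c i \<oplus>\<^bsub>R\<^esub> d i), smult = (\<lambda>r c i. r \<otimes>\<^bsub>R\<^esub> c i)\<rparr>"

definition free_gen :: "('r, 'p) ring_scheme \<Rightarrow> 'i \<Rightarrow> 'i \<Rightarrow> 'r" where
  "free_gen R i = (\<lambda>j. if j = i then \<one>\<^bsub>R\<^esub> else \<zero>\<^bsub>R\<^esub>)"

definition bilinear_relations ::
  "('r, 'p) ring_scheme \<Rightarrow> ('r, 'a, 'm) module_scheme \<Rightarrow> ('r, 'b, 'n) module_scheme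
    \<Rightarrow> ('a \<times> 'b \<Rightarrow> 'r) set" where
  "bilinear_relations R M N =
    (let F = free_space R (carrier M \<times> carrier N); g = (\<lambda>m n. free_gen R (m, n)) in
      {g (m \<oplus>\<^bsub>M\<^esub> m') n \<ominus>\<^bsub>F\<^esub> (g m n \<oplus>\<^bsub>F\<^esub> g m' n) | m m' n.
         m \<in> carrier M \<and> m' \<in> carrier M \<and> n \<in> carrier N} \<union>
      {g m (n \<oplus>\<^bsub>N\<^esub> n') \<ominus>\<^bsub>F\<^esub> (g m n \<oplus>\<^bsub>F\<^esub> g m n') | m n n'.
         m \<in> carrier M \<and> n \<in> carrier N \<and> n' \<in> carrier N} \<union>
      {g (r \<odot>\<^bsub>M\<^esub> m) n \<ominus>\<^bsub>F\<^esub> (r \<odot>\<^bsub>F\<^esub> g m n) | r m n.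
         r \<in> carrier R \<and> m \<in> carrier M \<and> n \<in> carrier N} \<union>
      {g m (r \<odot>\<^bsub>N\<^esub> n) \<ominus>\<^bsub>F\<^esub> (r \<odot>\<^bsub>F\<^esub> g m n) | r m n.
         r \<in> carrier R \<and> m \<in> carrier M \<and> n \<in> carrier N})"

definition tensor_kernel ::
  "('r, 'p) ring_scheme \<Rightarrow> ('r, 'a, 'm) module_scheme \<Rightarrow> ('r, 'b, 'n) module_scheme
    \<Rightarrow> ('a \<times> 'b \<Rightarrow> 'r) set" where
  "tensor_kernel R M N = \<Inter> {K. submodule K R (free_space R (carrier M \<times> carrier N)) \<and>
                                bilinear_relations R M N \<subseteq> K}"

text \<open>
  The tensor product of vector spaces: the quotient of the free vector space on pairs by the
  subspace generated by the bilinearity relations. Its elements are cosets.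
\<close>

definition tensor_space ::
  "('r, 'p) ring_scheme \<Rightarrow> ('r, 'a, 'm) module_scheme \<Rightarrow> ('r, 'b, 'n) module_scheme
    \<Rightarrow> ('r, ('a \<times> 'b \<Rightarrow> 'r) set) module" where
  "tensor_space R M N =
    (let F = free_space R (carrier M \<times> carrier N); K = tensor_kernel R M N in
      \<lparr>carrier = a_rcosets\<^bsub>F\<^esub> K,
       mult = undefined, one = undefined,
       zero = K,
       add = set_add F,
       smult = (\<lambda>r C. \<Union>c\<in>C. K +>\<^bsub>F\<^esub> (r \<odot>\<^bsub>F\<^esub> c))\<rparr>)"

definition pure_tensor ::
  "('r, 'p) ring_scheme \<Rightarrow> ('r, 'a, 'm) module_scheme \<Rightarrow> ('r, 'b, 'n) module_scheme
    \<Rightarrow> 'a \<Rightarrow> 'b \<Rightarrow> ('a \<times> 'b \<Rightarrow> 'r) set" where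
  "pure_tensor R M N m n =
    tensor_kernel R M N +>\<^bsub>free_space R (carrier M \<times> carrier N)\<^esub> free_gen R (m, n)"

text \<open>
  The linear map \<open>M \<otimes> N \<rightarrow> P\<close> induced by a bilinear map \<open>f\<close>, i.e. \<open>m \<otimes> n \<mapsto> f m n\<close>. For bilinear
  \<open>f\<close> the value does not depend on the representative picked by \<open>SOME\<close>. In Sweedler notation,
  \<open>lift_bilinear R P f (\<Delta> h)\<close> is \<open>f h\<^sub>(\<^sub>1\<^sub>) h\<^sub>(\<^sub>2\<^sub>)\<close>.
\<close>

definition lift_bilinear ::
  "('r, 'p) ring_scheme \<Rightarrow> ('r, 'c, 'l) module_scheme \<Rightarrow> ('a \<Rightarrow> 'b \<Rightarrow> 'c)
    \<Rightarrow> ('a \<times> 'b \<Rightarrow> 'r) set \<Rightarrow> 'c" where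
  "lift_bilinear R P f t =
    (let c = (SOME c. c \<in> t) in
      finsum P (\<lambda>(a, b). c (a, b) \<odot>\<^bsub>P\<^esub> f a b) {p. c p \<noteq> \<zero>\<^bsub>R\<^esub>})"

definition tensor_algebra ::
  "('r, 'p) ring_scheme \<Rightarrow> ('r, 'a, 'm) module_scheme \<Rightarrow> ('r, 'b, 'n) module_scheme
    \<Rightarrow> ('r, ('a \<times> 'b \<Rightarrow> 'r) set) module" where
  "tensor_algebra R A B =
    (let T = tensor_space R A B in
      T\<lparr>mult := (\<lambda>s t. lift_bilinear R T (\<lambda>a b. lift_bilinear R T
                   (\<lambda>a' b'. pure_tensor R A B (a \<otimes>\<^bsub>A\<^esub> a') (b \<otimes>\<^bsub>B\<^esub> b')) t) s),
        one := pure_tensor R A B \<one>\<^bsub>A\<^esub> \<one>\<^bsub>B\<^esub>\<rparr>)"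

definition tensor_map ::
  "('r, 'p) ring_scheme \<Rightarrow> ('r, 'c, 'm) module_scheme \<Rightarrow> ('r, 'd, 'n) module_scheme
    \<Rightarrow> ('a \<Rightarrow> 'c) \<Rightarrow> ('b \<Rightarrow> 'd) \<Rightarrow> ('a \<times> 'b \<Rightarrow> 'r) set \<Rightarrow> ('c \<times> 'd \<Rightarrow> 'r) set" where
  "tensor_map R C D f g =
    lift_bilinear R (tensor_space R C D) (\<lambda>a b. pure_tensor R C D (f a) (g b))"

definition tensor_flip ::
  "('r, 'p) ring_scheme \<Rightarrow> ('r, 'a, 'm) module_scheme \<Rightarrow> ('r, 'b, 'n) module_scheme
    \<Rightarrow> ('a \<times> 'b \<Rightarrow> 'r) set \<Rightarrow> ('b \<times> 'a \<Rightarrow> 'r) set" where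
  "tensor_flip R A B =
    lift_bilinear R (tensor_space R B A) (\<lambda>a b. pure_tensor R B A b a)"

text \<open>The canonical isomorphism \<open>(A \<otimes> B) \<otimes> C \<rightarrow> A \<otimes> (B \<otimes> C)\<close>.\<close>

definition tensor_assoc ::
  "('r, 'p) ring_scheme \<Rightarrow> ('r, 'a, 'm) module_scheme \<Rightarrow> ('r, 'b, 'n) module_scheme
    \<Rightarrow> ('r, 'c, 'l) module_scheme
    \<Rightarrow> (('a \<times> 'b \<Rightarrow> 'r) set \<times> 'c \<Rightarrow> 'r) set \<Rightarrow> ('a \<times> ('b \<times> 'c \<Rightarrow> 'r) set \<Rightarrow> 'r) set" where
  "tensor_assoc R A B C =
    (let BC = tensor_space R B C; T = tensor_space R A BC in
      lift_bilinear R T (\<lambda>s c. lift_bilinear R T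
        (\<lambda>a b. pure_tensor R A BC a (pure_tensor R B C b c)) s))"

definition mult_map ::
  "('r, 'p) ring_scheme \<Rightarrow> ('r, 'a, 'm) module_scheme \<Rightarrow> ('a \<times> 'a \<Rightarrow> 'r) set \<Rightarrow> 'a" where
  "mult_map R A = lift_bilinear R A (mult A)"


section \<open>Hopf algebras and their duals\<close>

record ('r, 'h) hopf = "('r, 'h) module" +
  comult :: "'h \<Rightarrow> ('h \<times> 'h \<Rightarrow> 'r) set"
  counit :: "'h \<Rightarrow> 'r"
  antipode :: "'h \<Rightarrow> 'h"

locale hopf_algebra = unital_algebra R H
  for R :: "('r, 'p) ring_scheme" (structure) and H :: "('r, 'h, 'm) hopf_scheme" (structure) +
  assumes comult_hom: "comult H \<in> algebra_homs R H (tensor_algebra R H H)"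
  and counit_hom: "counit H \<in> algebra_homs R H (ground_algebra R)"
  and antipode_linear: "antipode H \<in> linear_maps R H H"
  and coassoc:
    "h \<in> carrier H \<Longrightarrow>
      tensor_assoc R H H H
        (tensor_map R (tensor_algebra R H H) H (comult H) (\<lambda>x. x) (comult H h)) =
      tensor_map R H (tensor_algebra R H H) (\<lambda>x. x) (comult H) (comult H h)"
  and counit_left:
    "h \<in> carrier H \<Longrightarrow> lift_bilinear R H (\<lambda>a b. counit H a \<odot>\<^bsub>H\<^esub> b) (comult H h) = h"
  and counit_right:
    "h \<in> carrier H \<Longrightarrow> lift_bilinear R H (\<lambda>a b. counit H b \<odot>\<^bsub>H\<^esub> a) (comult H h) = h"
  and antipode_left:
    "h \<in> carrier H \<Longrightarrow>
      mult_map R H (tensor_map R H H (antipode H) (\<lambda>x. x) (comult H h)) = counit H h \<odot>\<^bsub>H\<^esub> \<one>\<^bsub>H\<^esub>"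
  and antipode_right:
    "h \<in> carrier H \<Longrightarrow>
      mult_map R H (tensor_map R H H (\<lambda>x. x) (antipode H) (comult H h)) = counit H h \<odot>\<^bsub>H\<^esub> \<one>\<^bsub>H\<^esub>"

definition lin_coeffs ::
  "('r, 'p) ring_scheme \<Rightarrow> ('r, 'a, 'm) module_scheme \<Rightarrow> 'a set \<Rightarrow> 'a \<Rightarrow> ('a \<Rightarrow> 'r) \<Rightarrow> bool" where
  "lin_coeffs R M B v c \<longleftrightarrow> c \<in> B \<rightarrow>\<^sub>E carrier R \<and> v = (\<Oplus>\<^bsub>M\<^esub>b\<in>B. c b \<odot>\<^bsub>M\<^esub> b)"

definition finite_basis ::
  "('r, 'p) ring_scheme \<Rightarrow> ('r, 'a, 'm) module_scheme \<Rightarrow> 'a set \<Rightarrow> bool" where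
  "finite_basis R M B \<longleftrightarrow>
    finite B \<and> B \<subseteq> carrier M \<and> (\<forall>v\<in>carrier M. \<exists>!c. lin_coeffs R M B v c)"

definition finite_dimensional ::
  "('r, 'p) ring_scheme \<Rightarrow> ('r, 'a, 'm) module_scheme \<Rightarrow> bool" where
  "finite_dimensional R M \<longleftrightarrow> (\<exists>B. finite_basis R M B)"

definition dual_basis_vector ::
  "('r, 'p) ring_scheme \<Rightarrow> ('r, 'a, 'm) module_scheme \<Rightarrow> 'a set \<Rightarrow> 'a \<Rightarrow> 'a \<Rightarrow> 'r" where
  "dual_basis_vector R M B b = (\<lambda>v\<in>carrier M. (THE c. lin_coeffs R M B v c) b)"

text \<open>
  Linear functionals are made extensional (undefined off the carrier), so that equality of
  functionals is equality of functions.
\<close>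

definition dual_space ::
  "('r, 'p) ring_scheme \<Rightarrow> ('r, 'h, 'm) module_scheme \<Rightarrow> ('r, 'h \<Rightarrow> 'r) module" where
  "dual_space R M =
    \<lparr>carrier = linear_maps R M (ground_algebra R) \<inter> extensional (carrier M),
     mult = undefined, one = undefined,
     zero = (\<lambda>h\<in>carrier M. \<zero>\<^bsub>R\<^esub>),
     add = (\<lambda>\<theta> \<theta>'. \<lambda>h\<in>carrier M. \<theta> h \<oplus>\<^bsub>R\<^esub> \<theta>' h),
     smult = (\<lambda>r \<theta>. \<lambda>h\<in>carrier M. r \<otimes>\<^bsub>R\<^esub> \<theta> h)\<rparr>"

definition pairing :: "'h \<Rightarrow> ('h \<Rightarrow> 'r) \<Rightarrow> 'r" where
  "pairing h \<theta> = \<theta> h"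

text \<open>
  The dual Hopf algebra, with \<open>p(h, \<theta>\<theta>') = p(h\<^sub>(\<^sub>1\<^sub>), \<theta>) p(h\<^sub>(\<^sub>2\<^sub>), \<theta>')\<close> and
  \<open>p(hh', \<theta>) = p(h, \<theta>\<^sub>(\<^sub>1\<^sub>)) p(h', \<theta>\<^sub>(\<^sub>2\<^sub>))\<close>. The latter determines the comultiplication uniquely when
  \<open>H\<close> is finite-dimensional; otherwise the description need not denote.
\<close>

definition dual_hopf ::
  "('r, 'p) ring_scheme \<Rightarrow> ('r, 'h, 'm) hopf_scheme \<Rightarrow> ('r, 'h \<Rightarrow> 'r) hopf" where
  "dual_hopf R H =
    (let D = dual_space R H; k = ground_algebra R in
      \<lparr>carrier = carrier D,
       mult = (\<lambda>\<theta> \<theta>'. \<lambda>h\<in>carrier H.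
                lift_bilinear R k (\<lambda>a b. pairing a \<theta> \<otimes>\<^bsub>R\<^esub> pairing b \<theta>') (comult H h)),
       one = (\<lambda>h\<in>carrier H. counit H h),
       zero = zero D,
       add = add D,
       smult = smult D,
       comult = (\<lambda>\<theta>. THE t. t \<in> carrier (tensor_space R D D) \<and>
                  (\<forall>h\<in>carrier H. \<forall>h'\<in>carrier H.
                     lift_bilinear R k (\<lambda>\<phi> \<psi>. pairing h \<phi> \<otimes>\<^bsub>R\<^esub> pairing h' \<psi>) t =
                     pairing (h \<otimes>\<^bsub>H\<^esub> h') \<theta>)),
       counit = (\<lambda>\<theta>. pairing \<one>\<^bsub>H\<^esub> \<theta>),
       antipode = (\<lambda>\<theta>. \<lambda>h\<in>carrier H. pairing (antipode H h) \<theta>)\<rparr>)"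

text \<open>
  The canonical element \<open>\<Sum>\<^sub>i h\<^sub>i \<otimes> \<theta>\<^sub>i\<close> for a pair of dual bases; it does not depend on the basis.
\<close>

definition canonical_element ::
  "('r, 'p) ring_scheme \<Rightarrow> ('r, 'h, 'm) hopf_scheme \<Rightarrow> ('h \<times> ('h \<Rightarrow> 'r) \<Rightarrow> 'r) set" where
  "canonical_element R H =
    (let B = (SOME B. finite_basis R H B) in
      (\<Oplus>\<^bsub>tensor_algebra R H (dual_hopf R H)\<^esub>b\<in>B.
         pure_tensor R H (dual_hopf R H) b (dual_basis_vector R H B b)))"


section \<open>Coactions and Yetter--Drinfeld algebras\<close>

definition left_coaction ::
  "('r, 'p) ring_scheme \<Rightarrow> ('r, 'k, 'm) hopf_scheme \<Rightarrow> ('r, 'x, 'n) module_scheme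
    \<Rightarrow> ('x \<Rightarrow> ('k \<times> 'x \<Rightarrow> 'r) set) \<Rightarrow> bool" where
  "left_coaction R K X \<alpha> \<longleftrightarrow>
    \<alpha> \<in> algebra_homs R X (tensor_algebra R K X) \<and>
    (\<forall>x\<in>carrier X.
      tensor_map R K (tensor_algebra R K X) (\<lambda>y. y) \<alpha> (\<alpha> x) =
      tensor_assoc R K K X (tensor_map R (tensor_algebra R K K) X (comult K) (\<lambda>y. y) (\<alpha> x))) \<and>
    (\<forall>x\<in>carrier X. lift_bilinear R X (\<lambda>k y. counit K k \<odot>\<^bsub>X\<^esub> y) (\<alpha> x) = x)"

definition right_coaction ::
  "('r, 'p) ring_scheme \<Rightarrow> ('r, 'k, 'm) hopf_scheme \<Rightarrow> ('r, 'x, 'n) module_scheme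
    \<Rightarrow> ('x \<Rightarrow> ('x \<times> 'k \<Rightarrow> 'r) set) \<Rightarrow> bool" where
  "right_coaction R K X \<beta> \<longleftrightarrow>
    \<beta> \<in> algebra_homs R X (tensor_algebra R X K) \<and>
    (\<forall>x\<in>carrier X.
      tensor_assoc R X K K (tensor_map R (tensor_algebra R X K) K \<beta> (\<lambda>y. y) (\<beta> x)) =
      tensor_map R X (tensor_algebra R K K) (\<lambda>y. y) (comult K) (\<beta> x)) \<and>
    (\<forall>x\<in>carrier X. lift_bilinear R X (\<lambda>y k. counit K k \<odot>\<^bsub>X\<^esub> y) (\<beta> x) = x)"

definition Ad :: "('a, 'm) ring_scheme \<Rightarrow> 'a \<Rightarrow> 'a \<Rightarrow> 'a" where
  "Ad A w z = w \<otimes>\<^bsub>A\<^esub> z \<otimes>\<^bsub>A\<^esub> inv\<^bsub>A\<^esub> w"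

text \<open>Threefold tensor products are bracketed to the right.\<close>

definition canonical_element_13 ::
  "('r, 'p) ring_scheme \<Rightarrow> ('r, 'h, 'm) hopf_scheme \<Rightarrow> ('r, 'x, 'n) module_scheme
    \<Rightarrow> ('h \<times> ('x \<times> ('h \<Rightarrow> 'r) \<Rightarrow> 'r) set \<Rightarrow> 'r) set" where
  "canonical_element_13 R H X =
    (let D = dual_hopf R H; XD = tensor_algebra R X D in
      lift_bilinear R (tensor_algebra R H XD)
        (\<lambda>h \<theta>. pure_tensor R H XD h (pure_tensor R X D \<one>\<^bsub>X\<^esub> \<theta>)) (canonical_element R H))"

definition yetter_drinfeld_algebra ::
  "('r, 'p) ring_scheme \<Rightarrow> ('r, 'h, 'm) hopf_scheme \<Rightarrow> ('r, 'x, 'n) module_scheme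
    \<Rightarrow> ('x \<Rightarrow> ('h \<times> 'x \<Rightarrow> 'r) set) \<Rightarrow> ('x \<Rightarrow> ('x \<times> ('h \<Rightarrow> 'r) \<Rightarrow> 'r) set) \<Rightarrow> bool" where
  "yetter_drinfeld_algebra R H X \<alpha> \<beta> \<longleftrightarrow>
    (let D = dual_hopf R H; HX = tensor_algebra R H X; XD = tensor_algebra R X D in
      unital_algebra R X \<and> left_coaction R H X \<alpha> \<and> right_coaction R D X \<beta> \<and>
      (\<forall>x\<in>carrier X.
        tensor_assoc R H X D (tensor_map R HX D \<alpha> (\<lambda>\<theta>. \<theta>) (\<beta> x)) =
        Ad (tensor_algebra R H XD) (canonical_element_13 R H X)
          (tensor_map R H XD (\<lambda>h. h) \<beta> (\<alpha> x))))"

definition induced_action ::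
  "('r, 'p) ring_scheme \<Rightarrow> ('r, 'x, 'n) module_scheme
    \<Rightarrow> ('x \<Rightarrow> ('x \<times> ('h \<Rightarrow> 'r) \<Rightarrow> 'r) set) \<Rightarrow> 'h \<Rightarrow> 'x \<Rightarrow> 'x" where
  "induced_action R X \<beta> h x = lift_bilinear R X (\<lambda>y \<theta>. pairing h \<theta> \<odot>\<^bsub>X\<^esub> y) (\<beta> x)"

text \<open>
  Braided commutativity \<open>x y = (x\<^sub>[\<^sub>-\<^sub>1\<^sub>] \<rhd> y) x\<^sub>[\<^sub>0\<^sub>]\<close> of a left-left Yetter--Drinfeld algebra with action
  \<open>act\<close> and coaction \<open>\<alpha>\<close>.
\<close>

definition left_left_braided_commutative ::
  "('r, 'p) ring_scheme \<Rightarrow> ('r, 'x, 'n) module_scheme \<Rightarrow> ('h \<Rightarrow> 'x \<Rightarrow> 'x)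
    \<Rightarrow> ('x \<Rightarrow> ('h \<times> 'x \<Rightarrow> 'r) set) \<Rightarrow> bool" where
  "left_left_braided_commutative R X act \<alpha> \<longleftrightarrow>
    (\<forall>x\<in>carrier X. \<forall>y\<in>carrier X.
      x \<otimes>\<^bsub>X\<^esub> y = lift_bilinear R X (\<lambda>h z. act h y \<otimes>\<^bsub>X\<^esub> z) (\<alpha> x))"


section \<open>The Heisenberg algebra\<close>

text \<open>\<open>(h # \<theta>) (h' # \<theta>') = h h'\<^sub>(\<^sub>1\<^sub>) p(h'\<^sub>(\<^sub>2\<^sub>), \<theta>\<^sub>(\<^sub>1\<^sub>)) # \<theta>\<^sub>(\<^sub>2\<^sub>) \<theta>'\<close>\<close>

definition heisenberg ::
  "('r, 'p) ring_scheme \<Rightarrow> ('r, 'h, 'm) hopf_scheme \<Rightarrow> ('r, ('h \<times> ('h \<Rightarrow> 'r) \<Rightarrow> 'r) set) module"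
  where
  "heisenberg R H =
    (let D = dual_hopf R H; T = tensor_space R H D in
      T\<lparr>mult := (\<lambda>s t.
          lift_bilinear R T (\<lambda>h \<theta>.
            lift_bilinear R T (\<lambda>h' \<theta>'.
              lift_bilinear R T (\<lambda>a b.
                lift_bilinear R T (\<lambda>\<phi> \<psi>.
                  pairing b \<phi> \<odot>\<^bsub>T\<^esub> pure_tensor R H D (h \<otimes>\<^bsub>H\<^esub> a) (\<psi> \<otimes>\<^bsub>D\<^esub> \<theta>'))
                (comult D \<theta>))
              (comult H h'))
            t)
          s),
        one := pure_tensor R H D \<one>\<^bsub>H\<^esub> \<one>\<^bsub>D\<^esub>\<rparr>)"

definition heisenberg_iota1 ::
  "('r, 'p) ring_scheme \<Rightarrow> ('r, 'h, 'm) hopf_scheme \<Rightarrow> ('r, 'x, 'n) module_scheme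
    \<Rightarrow> ('h \<times> 'x \<Rightarrow> 'r) set \<Rightarrow> (('h \<times> ('h \<Rightarrow> 'r) \<Rightarrow> 'r) set \<times> 'x \<Rightarrow> 'r) set" where
  "heisenberg_iota1 R H X =
    (let D = dual_hopf R H; \<H> = heisenberg R H in
      lift_bilinear R (tensor_algebra R \<H> X)
        (\<lambda>h x. pure_tensor R \<H> X (pure_tensor R H D h \<one>\<^bsub>D\<^esub>) x))"

definition heisenberg_iota2 ::
  "('r, 'p) ring_scheme \<Rightarrow> ('r, 'h, 'm) hopf_scheme \<Rightarrow> ('r, 'x, 'n) module_scheme
    \<Rightarrow> (('h \<Rightarrow> 'r) \<times> 'x \<Rightarrow> 'r) set \<Rightarrow> (('h \<times> ('h \<Rightarrow> 'r) \<Rightarrow> 'r) set \<times> 'x \<Rightarrow> 'r) set" where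
  "heisenberg_iota2 R H X =
    (let D = dual_hopf R H; \<H> = heisenberg R H in
      lift_bilinear R (tensor_algebra R \<H> X)
        (\<lambda>\<theta> x. pure_tensor R \<H> X (pure_tensor R H D \<one>\<^bsub>H\<^esub> \<theta>) x))"

definition braided_commutative ::
  "('r, 'p) ring_scheme \<Rightarrow> ('r, 'h, 'm) hopf_scheme \<Rightarrow> ('r, 'x, 'n) module_scheme
    \<Rightarrow> ('x \<Rightarrow> ('h \<times> 'x \<Rightarrow> 'r) set) \<Rightarrow> ('x \<Rightarrow> ('x \<times> ('h \<Rightarrow> 'r) \<Rightarrow> 'r) set) \<Rightarrow> bool" where
  "braided_commutative R H X \<alpha> \<beta> \<longleftrightarrow>
    (let D = dual_hopf R H;
         HX = tensor_algebra R H X;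
         DX = tensor_algebra R D X;
         T = tensor_algebra R (heisenberg R H) X;
         \<iota>1 = heisenberg_iota1 R H X;
         \<iota>2 = heisenberg_iota2 R H X;
         \<Sigma>\<beta> = (\<lambda>y. tensor_flip R X D (\<beta> y))
     in \<forall>x\<in>carrier X. \<forall>y\<in>carrier X.
          mult_map R T (tensor_map R T T \<iota>1 \<iota>2 (pure_tensor R HX DX (\<alpha> x) (\<Sigma>\<beta> y))) =
          mult_map R T (tensor_map R T T \<iota>2 \<iota>1 (pure_tensor R DX HX (\<Sigma>\<beta> y) (\<alpha> x))))"

end

theory Submission
  imports Defs
begin

text \<open>
  Write \<open>\<alpha>(x) = x\<^sub>[\<^sub>-\<^sub>1\<^sub>] \<otimes> x\<^sub>[\<^sub>0\<^sub>]\<close> and \<open>\<beta>(y) = y\<^sub>[\<^sub>0\<^sub>] \<otimes> y\<^sub>[\<^sub>1\<^sub>]\<close>, and let \<open>h\<close>, \<open>\<theta>\<close> stand for \<open>x\<^sub>[\<^sub>-\<^sub>1\<^sub>]\<close>, \<open>y\<^sub>[\<^sub>1\<^sub>]\<close>. In the Heisenberg algebra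
  \<open>(h # 1) (1 # \<theta>) = h # \<theta>\<close>, while the opposite product is
  \<open>(1 # \<theta>) (h # 1) = h\<^sub>(\<^sub>1\<^sub>) p(h\<^sub>(\<^sub>2\<^sub>), \<theta>\<^sub>(\<^sub>1\<^sub>)) # \<theta>\<^sub>(\<^sub>2\<^sub>)\<close>. So the Heisenberg condition says
  \<open>h # \<theta> \<otimes> x\<^sub>[\<^sub>0\<^sub>] y\<^sub>[\<^sub>0\<^sub>] = h\<^sub>(\<^sub>1\<^sub>) p(h\<^sub>(\<^sub>2\<^sub>), \<theta>\<^sub>(\<^sub>1\<^sub>)) # \<theta>\<^sub>(\<^sub>2\<^sub>) \<otimes> y\<^sub>[\<^sub>0\<^sub>] x\<^sub>[\<^sub>0\<^sub>]\<close>
  (\<open>braided_commutative_iff\<close>), and the other condition says \<open>x y = p(h, \<theta>) y\<^sub>[\<^sub>0\<^sub>] x\<^sub>[\<^sub>0\<^sub>]\<close>.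
  
  The first implies the second on applying the counits \<open>\<epsilon> \<otimes> p(1, \<cdot>)\<close> to the Heisenberg leg: on the left
  the counit axioms of the coactions leave \<open>x y\<close>, and on the right those of \<open>H\<close> and of its dual leave
  \<open>p(h, \<theta>)\<close> (\<open>counits_straight\<close>, \<open>counits_crossed\<close>).
  
  Conversely, coassociativity moves the inner legs \<open>h\<^sub>(\<^sub>2\<^sub>)\<close> and \<open>\<theta>\<^sub>(\<^sub>1\<^sub>)\<close> into the coactions of \<open>x\<^sub>[\<^sub>0\<^sub>]\<close> and
  \<open>y\<^sub>[\<^sub>0\<^sub>]\<close>. The right-hand side of the Heisenberg condition thus becomes \<open>h # \<theta>\<close> tensored with the
  expression \<open>p(\<cdot>, \<cdot>) y\<^sub>[\<^sub>0\<^sub>] x\<^sub>[\<^sub>0\<^sub>]\<close> formed from \<open>x\<^sub>[\<^sub>0\<^sub>]\<close> and \<open>y\<^sub>[\<^sub>0\<^sub>]\<close> in place of \<open>x\<close> and \<open>y\<close>, and by the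
  second condition this is \<open>x\<^sub>[\<^sub>0\<^sub>] y\<^sub>[\<^sub>0\<^sub>]\<close> (\<open>crossed_eq_inner_mult_assoc\<close>, \<open>inner_mult_assoc_eq\<close>,
  \<open>inner_mult_coactions\<close>).
  
  Every expression in Sweedler notation is a nested \<open>lift_bilinear\<close>. Two such expressions are identified
  by observing that both are multilinear and agree on pure tensors (\<open>tensor_linear_ext\<close>,
  \<open>tensor_bilinear_ext\<close>), so most of the work goes into multilinearity. Finite-dimensionality provides
  the coproduct of the dual: the functionals \<open>p(h, \<cdot>) \<otimes> p(h', \<cdot>)\<close> separate the tensors of functionals, and
  every bilinear form \<open>(h, h') \<mapsto> p(h h', \<theta>)\<close> is represented by one (\<open>dual_comult_spec\<close>).
\<close>

section \<open>Linear and bilinear maps\<close>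

definition bilinear_maps ::
  "('r, 'p) ring_scheme \<Rightarrow> ('r, 'a, 'm) module_scheme \<Rightarrow> ('r, 'b, 'n) module_scheme
    \<Rightarrow> ('r, 'c, 'l) module_scheme \<Rightarrow> ('a \<Rightarrow> 'b \<Rightarrow> 'c) set" where
  "bilinear_maps R M N P =
    {f. (\<forall>m\<in>carrier M. f m \<in> linear_maps R N P) \<and>
        (\<forall>n\<in>carrier N. (\<lambda>m. f m n) \<in> linear_maps R M P)}"

lemma linear_mapsI:
  assumes "\<And>x. x \<in> carrier M \<Longrightarrow> f x \<in> carrier N"
    and "\<And>x y. x \<in> carrier M \<Longrightarrow> y \<in> carrier M \<Longrightarrow> f (x \<oplus>\<^bsub>M\<^esub> y) = f x \<oplus>\<^bsub>N\<^esub> f y"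
    and "\<And>r x. r \<in> carrier R \<Longrightarrow> x \<in> carrier M \<Longrightarrow> f (r \<odot>\<^bsub>M\<^esub> x) = r \<odot>\<^bsub>N\<^esub> f x"
  shows "f \<in> linear_maps R M N"
  using assms by (simp add: linear_maps_def)

lemma linear_closed: "f \<in> linear_maps R M N \<Longrightarrow> x \<in> carrier M \<Longrightarrow> f x \<in> carrier N"
  by (auto simp: linear_maps_def)

lemma linear_add:
  "f \<in> linear_maps R M N \<Longrightarrow> x \<in> carrier M \<Longrightarrow> y \<in> carrier M
    \<Longrightarrow> f (x \<oplus>\<^bsub>M\<^esub> y) = f x \<oplus>\<^bsub>N\<^esub> f y"
  by (auto simp: linear_maps_def)

lemma linear_smult:
  "f \<in> linear_maps R M N \<Longrightarrow> r \<in> carrier R \<Longrightarrow> x \<in> carrier M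
    \<Longrightarrow> f (r \<odot>\<^bsub>M\<^esub> x) = r \<odot>\<^bsub>N\<^esub> f x"
  by (auto simp: linear_maps_def)

lemma bilinearI:
  assumes "\<And>m. m \<in> carrier M \<Longrightarrow> (\<lambda>n. f m n) \<in> linear_maps R N P"
    and "\<And>n. n \<in> carrier N \<Longrightarrow> (\<lambda>m. f m n) \<in> linear_maps R M P"
  shows "(\<lambda>m n. f m n) \<in> bilinear_maps R M N P"
  using assms by (simp add: bilinear_maps_def)

lemma bilinear_right: "f \<in> bilinear_maps R M N P \<Longrightarrow> m \<in> carrier M \<Longrightarrow> f m \<in> linear_maps R N P"
  by (simp add: bilinear_maps_def)

lemma bilinear_left:
  "f \<in> bilinear_maps R M N P \<Longrightarrow> n \<in> carrier N \<Longrightarrow> (\<lambda>m. f m n) \<in> linear_maps R M P"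
  by (simp add: bilinear_maps_def)

lemma bilinear_closed:
  "f \<in> bilinear_maps R M N P \<Longrightarrow> m \<in> carrier M \<Longrightarrow> n \<in> carrier N \<Longrightarrow> f m n \<in> carrier P"
  using bilinear_right linear_closed by fastforce

lemma linear_id: "(\<lambda>x. x) \<in> linear_maps R M M"
  by (simp add: linear_maps_def)

lemma linear_comp:
  "g \<in> linear_maps R N P \<Longrightarrow> f \<in> linear_maps R M N \<Longrightarrow> (\<lambda>x. g (f x)) \<in> linear_maps R M P"
  by (auto simp: linear_maps_def Pi_iff)

lemma linear_bilinear_left:
  assumes "f \<in> bilinear_maps R M N P" "g \<in> linear_maps R L M" "n \<in> carrier N"
  shows "(\<lambda>x. f (g x) n) \<in> linear_maps R L P"
  using linear_comp[OF bilinear_left[OF assms(1,3)] assms(2)] .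

lemma linear_bilinear_right:
  assumes "f \<in> bilinear_maps R M N P" "m \<in> carrier M" "g \<in> linear_maps R L N"
  shows "(\<lambda>x. f m (g x)) \<in> linear_maps R L P"
  using linear_comp[OF bilinear_right[OF assms(1,2)] assms(3)] .

context cring
begin

lemma smult_bilinear:
  assumes "module R M"
  shows "smult M \<in> bilinear_maps R (ground_algebra R) M M"
proof -
  interpret M: module R M by fact
  show ?thesis
    by (auto simp: bilinear_maps_def linear_maps_def ground_algebra_def M.smult_l_distr
        M.smult_r_distr M.smult_assoc1 m_comm simp flip: M.smult_assoc1)
qed

lemma linear_cong:
  assumes "module R M" "g \<in> linear_maps R M N" "\<And>x. x \<in> carrier M \<Longrightarrow> f x = g x"
  shows "f \<in> linear_maps R M N"
proof -
  interpret M: module R M by fact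
  show ?thesis using assms(2,3) by (auto simp: linear_maps_def)
qed

lemma linear_zero:
  assumes "module R M" "module R N" "f \<in> linear_maps R M N"
  shows "f \<zero>\<^bsub>M\<^esub> = \<zero>\<^bsub>N\<^esub>"
proof -
  interpret M: module R M by fact
  interpret N: module R N by fact
  have "f (\<zero> \<odot>\<^bsub>M\<^esub> \<zero>\<^bsub>M\<^esub>) = \<zero> \<odot>\<^bsub>N\<^esub> f \<zero>\<^bsub>M\<^esub>"
    by (rule linear_smult[OF assms(3)]) auto
  then show ?thesis using linear_closed[OF assms(3)] by simp
qed

lemma linear_finsum:
  assumes "module R M" "module R N" "f \<in> linear_maps R M N"
    and "finite A" "\<And>i. i \<in> A \<Longrightarrow> g i \<in> carrier M"
  shows "f (\<Oplus>\<^bsub>M\<^esub>i\<in>A. g i) = (\<Oplus>\<^bsub>N\<^esub>i\<in>A. f (g i))"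
proof -
  interpret M: module R M by fact
  interpret N: module R N by fact
  show ?thesis using assms(4,5)
  proof (induction A)
    case empty
    then show ?case using linear_zero[OF assms(1-3)] by simp
  next
    case (insert i A)
    have "f (g i \<oplus>\<^bsub>M\<^esub> (\<Oplus>\<^bsub>M\<^esub>i\<in>A. g i)) = f (g i) \<oplus>\<^bsub>N\<^esub> f (\<Oplus>\<^bsub>M\<^esub>i\<in>A. g i)"
      using insert by (intro linear_add[OF assms(3)] M.finsum_closed) auto
    then show ?case
      using insert linear_closed[OF assms(3)] by (simp add: Pi_def)
  qed
qed

lemma linear_sum:
  assumes "module R N" "f \<in> linear_maps R M N" "g \<in> linear_maps R M N"
  shows "(\<lambda>x. f x \<oplus>\<^bsub>N\<^esub> g x) \<in> linear_maps R M N"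
proof -
  interpret N: module R N by fact
  note c = linear_closed[OF assms(2)] linear_closed[OF assms(3)]
  show ?thesis
    by (rule linear_mapsI)
      (auto simp: c linear_add[OF assms(2)] linear_add[OF assms(3)] linear_smult[OF assms(2)]
        linear_smult[OF assms(3)] N.smult_r_distr N.a_ac)
qed

lemma linear_scale:
  assumes "module R N" "f \<in> linear_maps R M N" "r \<in> carrier R"
  shows "(\<lambda>x. r \<odot>\<^bsub>N\<^esub> f x) \<in> linear_maps R M N"
  using linear_bilinear_right[OF smult_bilinear[OF assms(1)] _ assms(2)] assms(3)
  by (simp add: ground_algebra_def)

text \<open>
  Stated for maps depending on an index rather than for a sum in the space of linear maps, because
  \<open>linear_maps\<close> is a set without a module structure.
\<close>

lemma linear_finsum_maps:
  assumes "module R M" "module R N" "finite A" "\<And>i. i \<in> A \<Longrightarrow> (\<lambda>x. f x i) \<in> linear_maps R M N"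
  shows "(\<lambda>x. \<Oplus>\<^bsub>N\<^esub>i\<in>A. f x i) \<in> linear_maps R M N"
  using assms(3,4)
proof (induction A)
  interpret M: module R M by fact
  interpret N: module R N by fact
  {
    case empty
    show ?case by (rule linear_mapsI) auto
  next
    case (insert i A)
    then have *: "(\<lambda>x. f x i \<oplus>\<^bsub>N\<^esub> (\<Oplus>\<^bsub>N\<^esub>i\<in>A. f x i)) \<in> linear_maps R M N"
      by (intro linear_sum assms(2)) auto
    show ?case
    proof (rule linear_cong[OF assms(1) *])
      fix x assume "x \<in> carrier M"
      then show "(\<Oplus>\<^bsub>N\<^esub>i\<in>insert i A. f x i) = f x i \<oplus>\<^bsub>N\<^esub> (\<Oplus>\<^bsub>N\<^esub>i\<in>A. f x i)"
        using insert(1,2) linear_closed[OF insert(4)] by (intro N.finsum_insert) auto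
    qed
  }
qed

end


section \<open>The universal property of the tensor product\<close>

text \<open>The linear extension to the free space of a map on its generators.\<close>

definition free_lift ::
  "('r, 'p) ring_scheme \<Rightarrow> ('r, 'c, 'l) module_scheme \<Rightarrow> ('i \<Rightarrow> 'c) \<Rightarrow> ('i \<Rightarrow> 'r) \<Rightarrow> 'c" where
  "free_lift R P f c = (\<Oplus>\<^bsub>P\<^esub>i\<in>{i. c i \<noteq> \<zero>\<^bsub>R\<^esub>}. c i \<odot>\<^bsub>P\<^esub> f i)"

context cring
begin

lemma free_space_carrier_coeff: "c \<in> carrier (free_space R I) \<Longrightarrow> c i \<in> carrier R"
  by (cases "i \<in> I") (auto simp: free_space_def)

lemma free_space_supp:
  assumes "c \<in> carrier (free_space R I)"
  shows "finite {i. c i \<noteq> \<zero>}" "{i. c i \<noteq> \<zero>} \<subseteq> I"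
  using assms by (auto simp: free_space_def)

lemma free_space_module: "module R (free_space R I)"
proof (rule moduleI)
  note F = free_space_carrier_coeff[where I = I]
  have closed: "c \<in> carrier (free_space R I) \<Longrightarrow> d \<in> carrier (free_space R I)
      \<Longrightarrow> (\<lambda>i. c i \<oplus> d i) \<in> carrier (free_space R I)" for c d
    by (auto simp: free_space_def intro: finite_subset[of _ "{i. c i \<noteq> \<zero>} \<union> {i. d i \<noteq> \<zero>}"])
  have sclosed: "r \<in> carrier R \<Longrightarrow> c \<in> carrier (free_space R I)
      \<Longrightarrow> (\<lambda>i. r \<otimes> c i) \<in> carrier (free_space R I)" for r c
    by (auto simp: free_space_def intro: finite_subset[of _ "{i. c i \<noteq> \<zero>}"])
  have add: "add (free_space R I) = (\<lambda>c d i. c i \<oplus> d i)"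
    and zero: "zero (free_space R I) = (\<lambda>i. \<zero>)"
    and smult: "smult (free_space R I) = (\<lambda>r c i. r \<otimes> c i)"
    by (auto simp: free_space_def)
  show "cring R" by (rule cring_axioms)
  show "abelian_group (free_space R I)"
  proof (rule abelian_groupI)
    fix c d e
    assume c: "c \<in> carrier (free_space R I)" and d: "d \<in> carrier (free_space R I)"
      and e: "e \<in> carrier (free_space R I)"
    show "c \<oplus>\<^bsub>free_space R I\<^esub> d \<in> carrier (free_space R I)"
      using closed[OF c d] by (simp add: add)
    show "c \<oplus>\<^bsub>free_space R I\<^esub> d \<oplus>\<^bsub>free_space R I\<^esub> e =
        c \<oplus>\<^bsub>free_space R I\<^esub> (d \<oplus>\<^bsub>free_space R I\<^esub> e)"
      using F[OF c] F[OF d] F[OF e] by (simp add: add a_assoc)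
    show "c \<oplus>\<^bsub>free_space R I\<^esub> d = d \<oplus>\<^bsub>free_space R I\<^esub> c"
      using F[OF c] F[OF d] by (simp add: add a_comm)
    show "\<zero>\<^bsub>free_space R I\<^esub> \<oplus>\<^bsub>free_space R I\<^esub> c = c"
      using F[OF c] by (simp add: add zero)
    have "(\<lambda>i. \<ominus> \<one> \<otimes> c i) \<in> carrier (free_space R I)" by (rule sclosed) (auto simp: c)
    moreover have "(\<lambda>i. \<ominus> \<one> \<otimes> c i) \<oplus>\<^bsub>free_space R I\<^esub> c = \<zero>\<^bsub>free_space R I\<^esub>"
      by (auto simp: add zero F[OF c] l_minus l_neg)
    ultimately show "\<exists>y\<in>carrier (free_space R I). y \<oplus>\<^bsub>free_space R I\<^esub> c = \<zero>\<^bsub>free_space R I\<^esub>"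
      by blast
  qed (simp add: free_space_def)
next
  note F = free_space_carrier_coeff[where I = I]
  note S = free_space_def
  fix a b c d
  assume a: "a \<in> carrier R" and b: "b \<in> carrier R" and c: "c \<in> carrier (free_space R I)"
    and d: "d \<in> carrier (free_space R I)"
  show "a \<odot>\<^bsub>free_space R I\<^esub> c \<in> carrier (free_space R I)"
    using a c by (auto simp: free_space_def intro: finite_subset[of _ "{i. c i \<noteq> \<zero>}"])
  show "(a \<oplus> b) \<odot>\<^bsub>free_space R I\<^esub> c =
      a \<odot>\<^bsub>free_space R I\<^esub> c \<oplus>\<^bsub>free_space R I\<^esub> b \<odot>\<^bsub>free_space R I\<^esub> c"
    using a b F[OF c] by (simp add: S l_distr)
  show "a \<odot>\<^bsub>free_space R I\<^esub> (c \<oplus>\<^bsub>free_space R I\<^esub> d) =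
      a \<odot>\<^bsub>free_space R I\<^esub> c \<oplus>\<^bsub>free_space R I\<^esub> a \<odot>\<^bsub>free_space R I\<^esub> d"
    using a F[OF c] F[OF d] by (simp add: S r_distr)
  show "(a \<otimes> b) \<odot>\<^bsub>free_space R I\<^esub> c =
      a \<odot>\<^bsub>free_space R I\<^esub> (b \<odot>\<^bsub>free_space R I\<^esub> c)"
    using a b F[OF c] by (simp add: S m_assoc)
next
  fix c assume c: "c \<in> carrier (free_space R I)"
  have "smult (free_space R I) = (\<lambda>r c i. r \<otimes> c i)" by (simp add: free_space_def)
  then show "\<one> \<odot>\<^bsub>free_space R I\<^esub> c = c"
    using free_space_carrier_coeff[OF c] by simp
qed

lemma free_gen_closed: "i \<in> I \<Longrightarrow> free_gen R i \<in> carrier (free_space R I)"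
  by (auto simp: free_space_def free_gen_def)

lemma free_lift_eq_finsum:
  assumes "module R P" "\<And>i. i \<in> I \<Longrightarrow> f i \<in> carrier P" "c \<in> carrier (free_space R I)"
    and "finite A" "A \<subseteq> I" "{i. c i \<noteq> \<zero>} \<subseteq> A"
  shows "free_lift R P f c = (\<Oplus>\<^bsub>P\<^esub>i\<in>A. c i \<odot>\<^bsub>P\<^esub> f i)"
proof -
  interpret P: module R P by fact
  show ?thesis
    unfolding free_lift_def using assms free_space_carrier_coeff[OF assms(3)]
    by (intro P.add.finprod_mono_neutral_cong_left) (auto simp: subset_iff)
qed

lemma free_lift_linear:
  assumes P: "module R P" and f: "\<And>i. i \<in> I \<Longrightarrow> f i \<in> carrier P"
  shows "free_lift R P f \<in> linear_maps R (free_space R I) P"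
proof -
  interpret P: module R P by fact
  interpret F: module R "free_space R I" by (rule free_space_module)
  note C = free_space_carrier_coeff[where I = I]
  show ?thesis
  proof (rule linear_mapsI)
    fix c assume c: "c \<in> carrier (free_space R I)"
    show "free_lift R P f c \<in> carrier P"
      unfolding free_lift_def using c free_space_supp[OF c] f by (auto intro!: P.finsum_closed simp: C)
    fix d assume d: "d \<in> carrier (free_space R I)"
    define A where "A = {i. c i \<noteq> \<zero>} \<union> {i. d i \<noteq> \<zero>}"
    have A: "finite A" "A \<subseteq> I"
      using free_space_supp[OF c] free_space_supp[OF d] by (auto simp: A_def)
    have "free_lift R P f (c \<oplus>\<^bsub>free_space R I\<^esub> d)
        = (\<Oplus>\<^bsub>P\<^esub>i\<in>A. (c i \<oplus> d i) \<odot>\<^bsub>P\<^esub> f i)"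
      using A c d by (subst free_lift_eq_finsum[where A = A, OF P f]) (auto simp: A_def, auto simp: free_space_def)
    also have "\<dots> = (\<Oplus>\<^bsub>P\<^esub>i\<in>A. c i \<odot>\<^bsub>P\<^esub> f i \<oplus>\<^bsub>P\<^esub> d i \<odot>\<^bsub>P\<^esub> f i)"
      using A f C[OF c] C[OF d] by (intro P.finsum_cong') (auto simp: subset_iff P.smult_l_distr)
    also have "\<dots> = (\<Oplus>\<^bsub>P\<^esub>i\<in>A. c i \<odot>\<^bsub>P\<^esub> f i) \<oplus>\<^bsub>P\<^esub> (\<Oplus>\<^bsub>P\<^esub>i\<in>A. d i \<odot>\<^bsub>P\<^esub> f i)"
      using A f C[OF c] C[OF d] by (intro P.finsum_addf) (auto simp: subset_iff)
    also have "\<dots> = free_lift R P f c \<oplus>\<^bsub>P\<^esub> free_lift R P f d"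
      using A c d by (simp add: free_lift_eq_finsum[where A = A, OF P f] A_def)
    finally show "free_lift R P f (c \<oplus>\<^bsub>free_space R I\<^esub> d) = free_lift R P f c \<oplus>\<^bsub>P\<^esub> free_lift R P f d" .
  next
    fix r c assume r: "r \<in> carrier R" and c: "c \<in> carrier (free_space R I)"
    define A where "A = {i. c i \<noteq> \<zero>}"
    have A: "finite A" "A \<subseteq> I"
      using free_space_supp[OF c] by (auto simp: A_def)
    have "free_lift R P f (r \<odot>\<^bsub>free_space R I\<^esub> c)
        = (\<Oplus>\<^bsub>P\<^esub>i\<in>A. (r \<otimes> c i) \<odot>\<^bsub>P\<^esub> f i)"
      using A c r by (subst free_lift_eq_finsum[where A = A, OF P f]) (auto simp: A_def, auto simp: free_space_def)
    also have "\<dots> = (\<Oplus>\<^bsub>P\<^esub>i\<in>A. r \<odot>\<^bsub>P\<^esub> (c i \<odot>\<^bsub>P\<^esub> f i))"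
      using A f C[OF c] r by (intro P.finsum_cong') (auto simp: subset_iff P.smult_assoc1)
    also have "\<dots> = r \<odot>\<^bsub>P\<^esub> free_lift R P f c"
      unfolding free_lift_def A_def[symmetric]
      using A f C[OF c] r by (intro P.finsum_smult_ldistr[symmetric]) (auto simp: subset_iff)
    finally show "free_lift R P f (r \<odot>\<^bsub>free_space R I\<^esub> c) = r \<odot>\<^bsub>P\<^esub> free_lift R P f c" .
  qed
qed

lemma free_lift_gen:
  assumes P: "module R P" and f: "\<And>i. i \<in> I \<Longrightarrow> f i \<in> carrier P" and i: "i \<in> I"
  shows "free_lift R P f (free_gen R i) = f i"
proof -
  interpret P: module R P by fact
  have "free_lift R P f (free_gen R i) = (\<Oplus>\<^bsub>P\<^esub>j\<in>{i}. free_gen R i j \<odot>\<^bsub>P\<^esub> f j)"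
    using i by (intro free_lift_eq_finsum[OF P f free_gen_closed[OF i]]) (auto simp: free_gen_def)
  then show ?thesis using f[OF i] by (simp add: free_gen_def)
qed

text \<open>
  Generators span the free space; this is what makes linear maps on it determined by their values
  there.
\<close>

lemma free_space_expansion:
  assumes c: "c \<in> carrier (free_space R I)"
  shows "c = (\<Oplus>\<^bsub>free_space R I\<^esub>i\<in>{i. c i \<noteq> \<zero>}. c i \<odot>\<^bsub>free_space R I\<^esub> free_gen R i)"
proof -
  interpret F: module R "free_space R I" by (rule free_space_module)
  note C = free_space_carrier_coeff[OF c]
  have "(\<Oplus>\<^bsub>free_space R I\<^esub>i\<in>A. c i \<odot>\<^bsub>free_space R I\<^esub> free_gen R i) =
      (\<lambda>j. if j \<in> A then c j else \<zero>)" if "finite A" "A \<subseteq> I" for A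
    using that
  proof (induction A)
    case empty
    then show ?case by (simp, simp add: free_space_def)
  next
    case (insert i A)
    then have "(\<Oplus>\<^bsub>free_space R I\<^esub>i\<in>insert i A. c i \<odot>\<^bsub>free_space R I\<^esub> free_gen R i) =
        c i \<odot>\<^bsub>free_space R I\<^esub> free_gen R i \<oplus>\<^bsub>free_space R I\<^esub> (\<lambda>j. if j \<in> A then c j else \<zero>)"
      using C free_gen_closed[where I = I]
      by (subst F.finsum_insert) (auto intro!: F.smult_closed simp: subset_iff)
    also have "\<dots> = (\<lambda>j. if j \<in> insert i A then c j else \<zero>)"
      using C insert by (auto simp: free_space_def free_gen_def)
    finally show ?case .
  qed
  from this[OF free_space_supp[OF c]] show ?thesis by auto
qed

lemma free_space_linear_ext:
  assumes "module R P" "f \<in> linear_maps R (free_space R I) P" "g \<in> linear_maps R (free_space R I) P"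
    and "\<And>i. i \<in> I \<Longrightarrow> f (free_gen R i) = g (free_gen R i)" and c: "c \<in> carrier (free_space R I)"
  shows "f c = g c"
proof -
  interpret F: module R "free_space R I" by (rule free_space_module)
  interpret P: module R P by fact
  note C = free_space_carrier_coeff[OF c]
  have *: "h c = (\<Oplus>\<^bsub>P\<^esub>i\<in>{i. c i \<noteq> \<zero>}. c i \<odot>\<^bsub>P\<^esub> h (free_gen R i))"
    if h: "h \<in> linear_maps R (free_space R I) P" for h
  proof -
    have "h c = h (\<Oplus>\<^bsub>free_space R I\<^esub>i\<in>{i. c i \<noteq> \<zero>}. c i \<odot>\<^bsub>free_space R I\<^esub> free_gen R i)"
      using free_space_expansion[OF c] by simp
    also have "\<dots> = (\<Oplus>\<^bsub>P\<^esub>i\<in>{i. c i \<noteq> \<zero>}. h (c i \<odot>\<^bsub>free_space R I\<^esub> free_gen R i))"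
      using free_space_supp[OF c] C free_gen_closed[where I = I]
      by (intro linear_finsum[OF free_space_module assms(1) h])
        (auto intro!: F.smult_closed simp: subset_iff)
    also have "\<dots> = (\<Oplus>\<^bsub>P\<^esub>i\<in>{i. c i \<noteq> \<zero>}. c i \<odot>\<^bsub>P\<^esub> h (free_gen R i))"
      using free_space_supp[OF c] C free_gen_closed[where I = I] linear_closed[OF h]
      by (intro P.finsum_cong') (auto intro!: P.smult_closed linear_smult[OF h] simp: subset_iff)
    finally show ?thesis .
  qed
  show ?thesis
    unfolding *[OF assms(2)] *[OF assms(3)]
    using assms(4) free_space_supp[OF c] C free_gen_closed[where I = I] linear_closed[OF assms(3)]
    by (intro P.finsum_cong') (auto simp: subset_iff intro!: P.smult_closed)
qed


lemma linear_kernel_submodule: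
  assumes M: "module R M" and N: "module R N" and f: "f \<in> linear_maps R M N"
  shows "submodule {x \<in> carrier M. f x = \<zero>\<^bsub>N\<^esub>} R M"
proof -
  interpret M: module R M by fact
  interpret N: module R N by fact
  note lin = linear_add[OF f] linear_smult[OF f] linear_zero[OF M N f]
  show ?thesis
  proof (rule M.submoduleI)
    fix a assume a: "a \<in> {x \<in> carrier M. f x = \<zero>\<^bsub>N\<^esub>}"
    then have "f (a \<oplus>\<^bsub>M\<^esub> \<ominus>\<^bsub>M\<^esub> a) = f a \<oplus>\<^bsub>N\<^esub> f (\<ominus>\<^bsub>M\<^esub> a)" by (intro lin) auto
    with a show "\<ominus>\<^bsub>M\<^esub> a \<in> {x \<in> carrier M. f x = \<zero>\<^bsub>N\<^esub>}"
      using linear_closed[OF f] by (auto simp: M.r_neg lin)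
  qed (auto simp: lin)
qed

lemma bilinear_relations_subset:
  assumes M: "module R M" and N: "module R N"
  shows "bilinear_relations R M N \<subseteq> carrier (free_space R (carrier M \<times> carrier N))"
proof -
  interpret M: module R M by fact
  interpret N: module R N by fact
  interpret F: module R "free_space R (carrier M \<times> carrier N)" by (rule free_space_module)
  note g = free_gen_closed[where I = "carrier M \<times> carrier N"]
  show ?thesis
    unfolding bilinear_relations_def Let_def
    by (auto intro!: F.minus_closed F.a_closed F.smult_closed g)
qed

lemma tensor_kernel_submodule:
  assumes M: "module R M" and N: "module R N"
  shows "submodule (tensor_kernel R M N) R (free_space R (carrier M \<times> carrier N))"
proof -
  interpret F: module R "free_space R (carrier M \<times> carrier N)" by (rule free_space_module)
  show ?thesis
    unfolding tensor_kernel_def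
  proof (rule F.submoduleI)
    show "\<Inter> {K. submodule K R (free_space R (carrier M \<times> carrier N)) \<and>
        bilinear_relations R M N \<subseteq> K} \<subseteq> carrier (free_space R (carrier M \<times> carrier N))"
      using F.carrier_is_submodule bilinear_relations_subset[OF M N] by blast
    have "\<zero>\<^bsub>free_space R (carrier M \<times> carrier N)\<^esub> \<in> K"
      if "submodule K R (free_space R (carrier M \<times> carrier N))" for K
      using subgroup.one_closed[OF submodule.axioms(1)[OF that]] by simp
    then show "\<zero>\<^bsub>free_space R (carrier M \<times> carrier N)\<^esub> \<in>
        \<Inter> {K. submodule K R (free_space R (carrier M \<times> carrier N)) \<and>
          bilinear_relations R M N \<subseteq> K}"
      by blast
  qed (auto dest: F.submoduleE)
qed

lemma tensor_kernel_least:
  "submodule K R (free_space R (carrier M \<times> carrier N)) \<Longrightarrow> bilinear_relations R M N \<subseteq> K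
    \<Longrightarrow> tensor_kernel R M N \<subseteq> K"
  unfolding tensor_kernel_def by blast

lemma tensor_kernel_relations: "bilinear_relations R M N \<subseteq> tensor_kernel R M N"
  unfolding tensor_kernel_def by blast

text \<open>
  The scalar multiplication of \<open>tensor_space\<close> is a union over representatives; all of them give the
  same coset because \<open>K\<close> is closed under scalars.
\<close>

lemma quotient_linear:
  assumes F: "module R F" and K: "submodule K R F"
    and T: "carrier T = a_rcosets\<^bsub>F\<^esub> K" "zero T = K" "add T = set_add F"
      "smult T = (\<lambda>r C. \<Union>c\<in>C. K +>\<^bsub>F\<^esub> (r \<odot>\<^bsub>F\<^esub> c))"
  shows "(\<lambda>c. K +>\<^bsub>F\<^esub> c) \<in> linear_maps R F T"
proof -
  interpret F: module R F by fact
  interpret K: abelian_subgroup K F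
    using submodule.axioms(1)[OF K] F.abelian_group_axioms
    by (intro abelian_subgroupI3 additive_subgroupI)
  show ?thesis
  proof (rule linear_mapsI)
    fix c assume c: "c \<in> carrier F"
    show "K +>\<^bsub>F\<^esub> c \<in> carrier T"
      unfolding T using c K.a_subset by (rule F.a_rcosetsI[rotated])
    fix r assume r: "r \<in> carrier R"
    have "K +>\<^bsub>F\<^esub> (r \<odot>\<^bsub>F\<^esub> c') = K +>\<^bsub>F\<^esub> (r \<odot>\<^bsub>F\<^esub> c)" if c': "c' \<in> K +>\<^bsub>F\<^esub> c" for c'
    proof -
      obtain k where k: "k \<in> K" "c' = k \<oplus>\<^bsub>F\<^esub> c"
        using c' by (auto simp: a_r_coset_def')
      have "r \<odot>\<^bsub>F\<^esub> c' \<in> K +>\<^bsub>F\<^esub> (r \<odot>\<^bsub>F\<^esub> c)"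
        using k c r K.a_subset submodule.smult_closed[OF K r k(1)]
        by (auto simp: F.smult_r_distr intro!: F.a_rcosI)
      then show ?thesis
        using c r K.a_subgroup by (intro F.a_repr_independence[symmetric]) auto
    qed
    moreover have "c \<in> K +>\<^bsub>F\<^esub> c" by (rule K.a_rcos_self[OF c])
    ultimately show "K +>\<^bsub>F\<^esub> (r \<odot>\<^bsub>F\<^esub> c) = r \<odot>\<^bsub>T\<^esub> (K +>\<^bsub>F\<^esub> c)"
      unfolding T by blast
  qed (simp add: T K.a_rcos_sum)
qed

text \<open>
  A surjective image under a map respecting the operations inherits the module axioms, which are
  equations and the existence of negatives.
\<close>

lemma linear_image_module:
  assumes F: "module R F" and q: "q \<in> linear_maps R F T"
    and T: "carrier T = q ` carrier F" "zero T = q \<zero>\<^bsub>F\<^esub>"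
  shows "module R T"
proof -
  interpret F: module R F by fact
  note lin = linear_add[OF q, symmetric] linear_smult[OF q, symmetric]
  show ?thesis
  proof (rule moduleI)
    show "cring R" by (rule cring_axioms)
    show "abelian_group T"
    proof (rule abelian_groupI)
      fix x assume "x \<in> carrier T"
      then obtain c where c: "c \<in> carrier F" "x = q c" by (auto simp: T)
      have "q (\<ominus>\<^bsub>F\<^esub> c) \<oplus>\<^bsub>T\<^esub> x = \<zero>\<^bsub>T\<^esub>" using c by (simp add: T lin F.l_neg)
      then show "\<exists>y\<in>carrier T. y \<oplus>\<^bsub>T\<^esub> x = \<zero>\<^bsub>T\<^esub>" using c by (auto simp: T)
    qed (auto simp: T lin F.a_ac)
  qed (auto simp: T lin F.smult_l_distr F.smult_r_distr F.smult_assoc1)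
qed

text \<open>
  Later proofs treat elements of a tensor product only through the module structure, the bilinearity of
  pure tensors, and the universal property (\<open>tensor_linear_ext\<close>, \<open>lift_bilinear_pure\<close>,
  \<open>lift_bilinear_linear\<close>), never through coset representatives.
\<close>

lemma tensor_quotient:
  assumes M: "module R M" and N: "module R N"
  shows "(\<lambda>c. tensor_kernel R M N +>\<^bsub>free_space R (carrier M \<times> carrier N)\<^esub> c)
      \<in> linear_maps R (free_space R (carrier M \<times> carrier N)) (tensor_space R M N)"
    and "carrier (tensor_space R M N) =
      (\<lambda>c. tensor_kernel R M N +>\<^bsub>free_space R (carrier M \<times> carrier N)\<^esub> c) `
        carrier (free_space R (carrier M \<times> carrier N))"
    and "module R (tensor_space R M N)"
proof -
  let ?F = "free_space R (carrier M \<times> carrier N)" and ?K = "tensor_kernel R M N"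
  interpret F: module R ?F by (rule free_space_module)
  interpret K: abelian_subgroup ?K ?F
    using submodule.axioms(1)[OF tensor_kernel_submodule[OF M N]] F.abelian_group_axioms
    by (intro abelian_subgroupI3 additive_subgroupI)
  show 1: "(\<lambda>c. ?K +>\<^bsub>?F\<^esub> c) \<in> linear_maps R ?F (tensor_space R M N)"
    by (rule quotient_linear[OF free_space_module tensor_kernel_submodule[OF M N]])
      (simp_all add: tensor_space_def Let_def)
  show 2: "carrier (tensor_space R M N) = (\<lambda>c. ?K +>\<^bsub>?F\<^esub> c) ` carrier ?F"
    by (auto simp: tensor_space_def Let_def A_RCOSETS_def')
  show "module R (tensor_space R M N)"
    by (rule linear_image_module[OF free_space_module 1 2])
      (simp add: tensor_space_def Let_def K.a_rcos_const)
qed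

lemmas tensor_module = tensor_quotient(3)

lemma coset_eqI:
  assumes F: "module R F" and K: "submodule K R F"
    and "c \<in> carrier F" "d \<in> carrier F" "c \<ominus>\<^bsub>F\<^esub> d \<in> K"
  shows "K +>\<^bsub>F\<^esub> c = K +>\<^bsub>F\<^esub> d"
proof -
  interpret F: module R F by fact
  interpret K: abelian_subgroup K F
    using submodule.axioms(1)[OF K] F.abelian_group_axioms
    by (intro abelian_subgroupI3 additive_subgroupI)
  show ?thesis
    using assms(3-5) K.a_rcos_module_rev[of d c] F.a_repr_independence[OF _ _ K.a_subgroup, of c d]
    by (simp add: a_minus_def)
qed

lemma pure_tensor_bilinear:
  assumes M: "module R M" and N: "module R N"
  shows "pure_tensor R M N \<in> bilinear_maps R M N (tensor_space R M N)"
proof -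
  let ?F = "free_space R (carrier M \<times> carrier N)" and ?K = "tensor_kernel R M N"
  let ?q = "\<lambda>c. ?K +>\<^bsub>?F\<^esub> c"
  interpret M: module R M by fact
  interpret N: module R N by fact
  interpret F: module R ?F by (rule free_space_module)
  note q = tensor_quotient(1)[OF M N]
  note g = free_gen_closed[where I = "carrier M \<times> carrier N"]
  have eq: "?q c = ?q d" if "c \<ominus>\<^bsub>?F\<^esub> d \<in> bilinear_relations R M N" "c \<in> carrier ?F" "d \<in> carrier ?F"
    for c d
    using coset_eqI[OF free_space_module tensor_kernel_submodule[OF M N] that(2,3)] that(1)
      tensor_kernel_relations by blast
  have add: "?q (c \<oplus>\<^bsub>?F\<^esub> d) = ?q c \<oplus>\<^bsub>tensor_space R M N\<^esub> ?q d"
    if "c \<in> carrier ?F" "d \<in> carrier ?F" for c d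
    using linear_add[OF q that] .
  have smult: "?q (r \<odot>\<^bsub>?F\<^esub> c) = r \<odot>\<^bsub>tensor_space R M N\<^esub> ?q c"
    if "r \<in> carrier R" "c \<in> carrier ?F" for r c
    using linear_smult[OF q that] .
  show ?thesis
    unfolding bilinear_maps_def pure_tensor_def
    apply (clarsimp, intro conjI ballI linear_mapsI)
    using linear_closed[OF q]
         apply (simp add: g)
        apply (subst add[symmetric], (simp add: g)+)
        apply (rule eq)
          apply (auto simp: bilinear_relations_def Let_def g intro!: F.a_closed)[3]
       apply (subst smult[symmetric], (simp add: g)+)
       apply (rule eq)
         apply (auto simp: bilinear_relations_def Let_def g intro!: F.smult_closed)[3]
    using linear_closed[OF q]
      apply (simp add: g)
     apply (subst add[symmetric], (simp add: g)+)
     apply (rule eq)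
       apply (auto simp: bilinear_relations_def Let_def g intro!: F.a_closed)[3]
    apply (subst smult[symmetric], (simp add: g)+)
    apply (rule eq)
      apply (auto simp: bilinear_relations_def Let_def g intro!: F.smult_closed)[3]
    done
qed

lemma tensor_linear_ext:
  assumes M: "module R M" and N: "module R N" and P: "module R P"
    and f: "f \<in> linear_maps R (tensor_space R M N) P"
    and g: "g \<in> linear_maps R (tensor_space R M N) P"
    and eq: "\<And>m n. m \<in> carrier M \<Longrightarrow> n \<in> carrier N
      \<Longrightarrow> f (pure_tensor R M N m n) = g (pure_tensor R M N m n)"
    and t: "t \<in> carrier (tensor_space R M N)"
  shows "f t = g t"
proof -
  let ?F = "free_space R (carrier M \<times> carrier N)" and ?K = "tensor_kernel R M N"
  obtain c where c: "c \<in> carrier ?F" "t = ?K +>\<^bsub>?F\<^esub> c"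
    using t tensor_quotient(2)[OF M N] by auto
  have "f (?K +>\<^bsub>?F\<^esub> c) = g (?K +>\<^bsub>?F\<^esub> c)"
    by (rule free_space_linear_ext[OF P linear_comp[OF f tensor_quotient(1)[OF M N]]
          linear_comp[OF g tensor_quotient(1)[OF M N]] _ c(1)])
      (use eq in \<open>auto simp: pure_tensor_def\<close>)
  then show ?thesis by (simp add: c)
qed

text \<open>
  The value does not depend on the representative chosen by \<open>SOME\<close>: the linear extension of \<open>f\<close> to
  the free space kills the bilinearity relations, hence the submodule they generate.
\<close>

lemma lift_bilinear_coset:
  assumes M: "module R M" and N: "module R N" and P: "module R P"
    and f: "f \<in> bilinear_maps R M N P"
    and c: "c \<in> carrier (free_space R (carrier M \<times> carrier N))"
  shows "lift_bilinear R P f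
      (tensor_kernel R M N +>\<^bsub>free_space R (carrier M \<times> carrier N)\<^esub> c) =
    free_lift R P (case_prod f) c"
proof -
  let ?F = "free_space R (carrier M \<times> carrier N)" and ?K = "tensor_kernel R M N"
  let ?L = "free_lift R P (case_prod f)"
  interpret M: module R M by fact
  interpret N: module R N by fact
  interpret P: module R P by fact
  interpret F: module R ?F by (rule free_space_module)
  interpret K: abelian_subgroup ?K ?F
    using submodule.axioms(1)[OF tensor_kernel_submodule[OF M N]] F.abelian_group_axioms
    by (intro abelian_subgroupI3 additive_subgroupI)
  have fc: "\<And>i. i \<in> carrier M \<times> carrier N \<Longrightarrow> case_prod f i \<in> carrier P"
    using bilinear_closed[OF f] by auto
  have L: "free_lift R P (case_prod f) \<in> linear_maps R ?F P"
    by (rule free_lift_linear[OF P fc])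
  have g: "?L (free_gen R (m, n)) = f m n" if "m \<in> carrier M" "n \<in> carrier N" for m n
    using free_lift_gen[where f = "case_prod f", OF P fc, of "carrier M \<times> carrier N" "(m, n)"] that by simp
  have diff: "x \<ominus>\<^bsub>?F\<^esub> y \<in> {x \<in> carrier ?F. ?L x = \<zero>\<^bsub>P\<^esub>}"
    if "?L x = ?L y" "x \<in> carrier ?F" "y \<in> carrier ?F" for x y
  proof -
    have "?L ((x \<ominus>\<^bsub>?F\<^esub> y) \<oplus>\<^bsub>?F\<^esub> y) = ?L (x \<ominus>\<^bsub>?F\<^esub> y) \<oplus>\<^bsub>P\<^esub> ?L y"
      using that by (intro linear_add[OF L]) auto
    moreover have "(x \<ominus>\<^bsub>?F\<^esub> y) \<oplus>\<^bsub>?F\<^esub> y = x"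
      using that by (simp add: a_minus_def F.a_assoc F.l_neg)
    ultimately have "?L (x \<ominus>\<^bsub>?F\<^esub> y) = \<zero>\<^bsub>P\<^esub>"
      using that linear_closed[OF L that(2)] linear_closed[OF L F.minus_closed[OF that(2,3)]]
      by (simp add: P.add.r_cancel_one')
    then show ?thesis using that by simp
  qed
  have "?K \<subseteq> {x \<in> carrier ?F. ?L x = \<zero>\<^bsub>P\<^esub>}"
  proof (rule tensor_kernel_least[OF linear_kernel_submodule[OF free_space_module P L]])
    note lin = linear_add[OF L] linear_smult[OF L] g free_gen_closed
      linear_add[OF bilinear_left[OF f]] linear_smult[OF bilinear_left[OF f]]
      linear_add[OF bilinear_right[OF f]] linear_smult[OF bilinear_right[OF f]]
    show "bilinear_relations R M N \<subseteq> {x \<in> carrier ?F. ?L x = \<zero>\<^bsub>P\<^esub>}"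
      unfolding bilinear_relations_def Let_def
      by (intro Un_least subsetI; elim CollectE exE conjE; hypsubst; rule diff; simp add: lin)
  qed
  moreover define c' where "c' = (SOME c'. c' \<in> ?K +>\<^bsub>?F\<^esub> c)"
  have "c' \<in> ?K +>\<^bsub>?F\<^esub> c"
    unfolding c'_def by (rule someI[where x = c]) (rule K.a_rcos_self[OF c])
  then obtain k where "k \<in> ?K" "c' = k \<oplus>\<^bsub>?F\<^esub> c" by (auto simp: a_r_coset_def')
  ultimately have "?L c' = ?L c"
    using c linear_closed[OF L c] linear_add[OF L _ c, of k] by auto
  moreover have "lift_bilinear R P f (?K +>\<^bsub>?F\<^esub> c) = ?L c'"
    unfolding lift_bilinear_def free_lift_def c'_def Let_def
    by (simp add: case_prod_unfold)
  ultimately show ?thesis by simp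
qed

lemma lift_bilinear_pure:
  assumes M: "module R M" and N: "module R N" and P: "module R P"
    and f: "f \<in> bilinear_maps R M N P"
    and m: "m \<in> carrier M" and n: "n \<in> carrier N"
  shows "lift_bilinear R P f (pure_tensor R M N m n) = f m n"
proof -
  have fc: "\<And>i. i \<in> carrier M \<times> carrier N \<Longrightarrow> case_prod f i \<in> carrier P"
    using bilinear_closed[OF f] by auto
  show ?thesis
    unfolding pure_tensor_def
    using lift_bilinear_coset[OF M N P f, of "free_gen R (m, n)"]
      free_lift_gen[where f = "case_prod f", OF P fc, of "carrier M \<times> carrier N" "(m, n)"] m n
    by (simp add: free_gen_closed)
qed

lemma lift_bilinear_linear:
  assumes M: "module R M" and N: "module R N" and P: "module R P"
    and f: "f \<in> bilinear_maps R M N P"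
  shows "lift_bilinear R P f \<in> linear_maps R (tensor_space R M N) P"
proof -
  let ?F = "free_space R (carrier M \<times> carrier N)" and ?K = "tensor_kernel R M N"
  have fc: "\<And>i. i \<in> carrier M \<times> carrier N \<Longrightarrow> case_prod f i \<in> carrier P"
    using bilinear_closed[OF f] by auto
  have L: "free_lift R P (case_prod f) \<in> linear_maps R ?F P"
    by (rule free_lift_linear[OF P fc])
  note q = tensor_quotient(1)[OF M N] and lc = lift_bilinear_coset[OF M N P f]
  interpret F: module R ?F by (rule free_space_module)
  show ?thesis
  proof (rule linear_mapsI)
    fix s assume "s \<in> carrier (tensor_space R M N)"
    then obtain c where c: "c \<in> carrier ?F" "s = ?K +>\<^bsub>?F\<^esub> c"
      by (auto simp: tensor_quotient(2)[OF M N])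
    show "lift_bilinear R P f s \<in> carrier P"
      using linear_closed[OF L c(1)] lc[OF c(1)] c(2) by simp
    {
      fix t assume "t \<in> carrier (tensor_space R M N)"
      then obtain d where d: "d \<in> carrier ?F" "t = ?K +>\<^bsub>?F\<^esub> d"
        by (auto simp: tensor_quotient(2)[OF M N])
      show "lift_bilinear R P f (s \<oplus>\<^bsub>tensor_space R M N\<^esub> t) =
          lift_bilinear R P f s \<oplus>\<^bsub>P\<^esub> lift_bilinear R P f t"
        using linear_add[OF L c(1) d(1)] lc[OF F.a_closed[OF c(1) d(1)]] lc[OF c(1)] lc[OF d(1)]
        unfolding c(2) d(2) linear_add[OF q c(1) d(1)] by simp
    next
      fix r assume r: "r \<in> carrier R"
      show "lift_bilinear R P f (r \<odot>\<^bsub>tensor_space R M N\<^esub> s) = r \<odot>\<^bsub>P\<^esub> lift_bilinear R P f s"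
        using linear_smult[OF L r c(1)] lc[OF F.smult_closed[OF r c(1)]] lc[OF c(1)]
        unfolding c(2) linear_smult[OF q r c(1)] by simp
    }
  qed
qed

end

section \<open>Multilinear maps out of tensor products\<close>

context cring
begin

lemma ground_module: "module R (ground_algebra R)"
  unfolding ground_algebra_def
  by (rule moduleI, rule cring_axioms, rule abelian_groupI)
    (auto simp: a_ac l_distr r_distr m_assoc intro: l_neg)

lemma ground_mult_bilinear:
  "mult R \<in> bilinear_maps R (ground_algebra R) (ground_algebra R) (ground_algebra R)"
  using smult_bilinear[OF ground_module] by (simp add: ground_algebra_def)

text \<open>
  In the rules for \<open>lift_bilinear\<close> the premise on the tensor comes first: the factors \<open>M\<close> and \<open>N\<close> do not
  occur in the conclusion, and resolution from left to right reads them off from that premise.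
\<close>

lemma linear_lift:
  assumes "g \<in> linear_maps R L (tensor_space R M N)" "f \<in> bilinear_maps R M N P"
    and "module R M" "module R N" "module R P"
  shows "(\<lambda>x. lift_bilinear R P f (g x)) \<in> linear_maps R L P"
  using linear_comp[OF lift_bilinear_linear assms(1)] assms by blast

lemma lift_closed:
  assumes "t \<in> carrier (tensor_space R M N)" "f \<in> bilinear_maps R M N P"
    and "module R M" "module R N" "module R P"
  shows "lift_bilinear R P f t \<in> carrier P"
  using linear_closed[OF lift_bilinear_linear] assms by blast

lemma linear_lift_commute:
  assumes M: "module R M" and N: "module R N" and P: "module R P" and Q: "module R Q"
    and g: "g \<in> linear_maps R P Q" and f: "f \<in> bilinear_maps R M N P"
    and t: "t \<in> carrier (tensor_space R M N)"
  shows "g (lift_bilinear R P f t) = lift_bilinear R Q (\<lambda>a b. g (f a b)) t"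
proof -
  have gf: "(\<lambda>a b. g (f a b)) \<in> bilinear_maps R M N Q"
    by (intro bilinearI linear_comp[OF g] bilinear_left[OF f] bilinear_right[OF f])
  show ?thesis
    by (rule tensor_linear_ext[OF M N Q _ _ _ t])
      (simp_all add: linear_comp[OF g] lift_bilinear_linear M N P Q f gf lift_bilinear_pure)
qed

lemma lift_bilinear_cong:
  assumes M: "module R M" and N: "module R N" and P: "module R P"
    and t: "t \<in> carrier (tensor_space R M N)"
    and f: "f \<in> bilinear_maps R M N P"
    and eq: "\<And>m n. m \<in> carrier M \<Longrightarrow> n \<in> carrier N \<Longrightarrow> f m n = g m n"
  shows "lift_bilinear R P f t = lift_bilinear R P g t"
proof -
  have g: "g \<in> bilinear_maps R M N P"
  proof -
    have "(\<lambda>m n. g m n) \<in> bilinear_maps R M N P"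
      by (rule bilinearI)
        (rule linear_cong[OF N bilinear_right[OF f]] linear_cong[OF M bilinear_left[OF f]],
          assumption, simp add: eq)+
    then show ?thesis by simp
  qed
  show ?thesis
    by (rule tensor_linear_ext[OF M N P _ _ _ t])
      (simp_all add: lift_bilinear_linear M N P f g lift_bilinear_pure eq)
qed

text \<open>
  Nested Sweedler expressions depend on further variables inside the bilinear map. Linearity in such a
  variable is inherited because both sides of each linearity equation are linear in \<open>t\<close> and agree on
  pure tensors.
\<close>

lemma linear_lift_maps:
  assumes t: "t \<in> carrier (tensor_space R M N)"
    and bil: "\<And>x. x \<in> carrier L \<Longrightarrow> (\<lambda>m n. f x m n) \<in> bilinear_maps R M N P"
    and lin: "\<And>m n. m \<in> carrier M \<Longrightarrow> n \<in> carrier N \<Longrightarrow> (\<lambda>x. f x m n) \<in> linear_maps R L P"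
    and M: "module R M" and N: "module R N" and P: "module R P" and L: "module R L"
  shows "(\<lambda>x. lift_bilinear R P (\<lambda>m n. f x m n) t) \<in> linear_maps R L P"
proof -
  interpret L: module R L by fact
  note ll = lift_bilinear_linear[OF M N P bil]
  show ?thesis
  proof (rule linear_mapsI)
    fix x assume x: "x \<in> carrier L"
    show "lift_bilinear R P (f x) t \<in> carrier P" using linear_closed[OF ll[OF x] t] .
    {
      fix y assume y: "y \<in> carrier L"
      show "lift_bilinear R P (f (x \<oplus>\<^bsub>L\<^esub> y)) t = lift_bilinear R P (f x) t \<oplus>\<^bsub>P\<^esub> lift_bilinear R P (f y) t"
        by (rule tensor_linear_ext[OF M N P _ _ _ t])
          (simp_all add: ll linear_sum[OF P] x y lift_bilinear_pure[OF M N P bil] linear_add[OF lin])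
    next
      fix r assume r: "r \<in> carrier R"
      show "lift_bilinear R P (f (r \<odot>\<^bsub>L\<^esub> x)) t = r \<odot>\<^bsub>P\<^esub> lift_bilinear R P (f x) t"
        by (rule tensor_linear_ext[OF M N P _ _ _ t])
          (simp_all add: ll linear_scale[OF P] x r lift_bilinear_pure[OF M N P bil] linear_smult[OF lin])
    }
  qed
qed

lemma tensor_bilinear_ext:
  assumes M: "module R M" and N: "module R N" and M': "module R M'" and N': "module R N'"
    and P: "module R P"
    and f: "(\<lambda>s t. f s t) \<in> bilinear_maps R (tensor_space R M N) (tensor_space R M' N') P"
    and g: "(\<lambda>s t. g s t) \<in> bilinear_maps R (tensor_space R M N) (tensor_space R M' N') P"
    and eq: "\<And>m n m' n'. m \<in> carrier M \<Longrightarrow> n \<in> carrier N \<Longrightarrow> m' \<in> carrier M' \<Longrightarrow> n' \<in> carrier N'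
      \<Longrightarrow> f (pure_tensor R M N m n) (pure_tensor R M' N' m' n') =
          g (pure_tensor R M N m n) (pure_tensor R M' N' m' n')"
    and s: "s \<in> carrier (tensor_space R M N)" and t: "t \<in> carrier (tensor_space R M' N')"
  shows "f s t = g s t"
proof (rule tensor_linear_ext[OF M N P bilinear_left[OF f t] bilinear_left[OF g t] _ s])
  fix m n assume mn: "m \<in> carrier M" "n \<in> carrier N"
  let ?p = "pure_tensor R M N m n"
  have p: "?p \<in> carrier (tensor_space R M N)"
    by (rule bilinear_closed[OF pure_tensor_bilinear[OF M N] mn])
  show "f ?p t = g ?p t"
    by (rule tensor_linear_ext[OF M' N' P bilinear_right[OF f p] bilinear_right[OF g p] _ t])
      (rule eq[OF mn])
qed

end


section \<open>Tensor products of underlying spaces\<close>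

text \<open>
  \<open>tensor_space\<close> sees only carrier, addition and scalar multiplication of its arguments. This lets
  \<open>tensor_algebra\<close> and \<open>heisenberg\<close> be traded for the plain tensor product wherever a product is not
  involved.
\<close>

lemma tensor_space_cong:
  assumes "carrier M = carrier M'" "add M = add M'" "smult M = smult M'"
    and "carrier N = carrier N'" "add N = add N'" "smult N = smult N'"
  shows "tensor_space R M N = tensor_space R M' N'"
    and "pure_tensor R M N = pure_tensor R M' N'"
  using assms
  by (simp_all add: fun_eq_iff tensor_space_def pure_tensor_def tensor_kernel_def
      bilinear_relations_def)

lemma linear_maps_cong:
  assumes "carrier M = carrier M'" "add M = add M'" "smult M = smult M'"
    and "carrier N = carrier N'" "add N = add N'" "smult N = smult N'"
  shows "linear_maps R M N = linear_maps R M' N'"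
  using assms by (simp add: linear_maps_def)

lemma lift_bilinear_target_cong:
  fixes P P' :: "('r, 'c, 'l) module_scheme"
  assumes "carrier P = carrier P'" "add P = add P'" "zero P = zero P'" "smult P = smult P'"
  shows "lift_bilinear R P = lift_bilinear R P'"
  using assms by (intro ext) (simp add: lift_bilinear_def finsum_def finprod_def)

lemma tensor_algebra_sel:
  "carrier (tensor_algebra R A B) = carrier (tensor_space R A B)"
  "add (tensor_algebra R A B) = add (tensor_space R A B)"
  "zero (tensor_algebra R A B) = zero (tensor_space R A B)"
  "smult (tensor_algebra R A B) = smult (tensor_space R A B)"
  "one (tensor_algebra R A B) = pure_tensor R A B \<one>\<^bsub>A\<^esub> \<one>\<^bsub>B\<^esub>"
  by (simp_all add: tensor_algebra_def Let_def)

lemma heisenberg_sel: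
  "carrier (heisenberg R H) = carrier (tensor_space R H (dual_hopf R H))"
  "add (heisenberg R H) = add (tensor_space R H (dual_hopf R H))"
  "zero (heisenberg R H) = zero (tensor_space R H (dual_hopf R H))"
  "smult (heisenberg R H) = smult (tensor_space R H (dual_hopf R H))"
  by (simp_all add: heisenberg_def Let_def)

lemma tensor_algebra_underlying:
  "tensor_space R (tensor_algebra R A B) C = tensor_space R (tensor_space R A B) C"
  "tensor_space R C (tensor_algebra R A B) = tensor_space R C (tensor_space R A B)"
  "pure_tensor R (tensor_algebra R A B) C = pure_tensor R (tensor_space R A B) C"
  "pure_tensor R C (tensor_algebra R A B) = pure_tensor R C (tensor_space R A B)"
  "lift_bilinear R (tensor_algebra R A B) = lift_bilinear R (tensor_space R A B)"
  "linear_maps R C (tensor_algebra R A B) = linear_maps R C (tensor_space R A B)"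
  "linear_maps R (tensor_algebra R A B) C = linear_maps R (tensor_space R A B) C"
  by (rule tensor_space_cong linear_maps_cong lift_bilinear_target_cong;
      simp add: tensor_algebra_sel)+

lemma heisenberg_underlying:
  "tensor_space R (heisenberg R H) C = tensor_space R (tensor_space R H (dual_hopf R H)) C"
  "pure_tensor R (heisenberg R H) C = pure_tensor R (tensor_space R H (dual_hopf R H)) C"
  "linear_maps R (heisenberg R H) C = linear_maps R (tensor_space R H (dual_hopf R H)) C"
  by (rule tensor_space_cong linear_maps_cong lift_bilinear_target_cong;
      simp add: heisenberg_sel)+

lemma dual_space_underlying:
  "tensor_space R (dual_space R H) (dual_space R H) = tensor_space R (dual_hopf R H) (dual_hopf R H)"
  by (rule tensor_space_cong; simp add: dual_hopf_def Let_def)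


section \<open>The dual of a finite-dimensional Hopf algebra\<close>

lemma unital_algebra_mult_bilinear:
  assumes "unital_algebra R A"
  shows "mult A \<in> bilinear_maps R A A A"
proof -
  interpret unital_algebra R A by fact
  have A: "ring A" ..
  show ?thesis
    by (auto simp: bilinear_maps_def intro!: linear_mapsI)
      (simp_all add: ringE(3,4)[OF A] smult_mult_left smult_mult_right)
qed

locale finite_hopf = cring R for R :: "('r, 'p) ring_scheme" (structure) +
  fixes H :: "('r, 'h, 'm) hopf_scheme"
  assumes hopf: "hopf_algebra R H"
    and fin_dim: "finite_dimensional R H"
begin

abbreviation "D \<equiv> dual_hopf R H"
abbreviation "k \<equiv> ground_algebra R"

lemma H_algebra: "unital_algebra R H"
  using hopf by (rule hopf_algebra.axioms)

lemma H_module: "module R H"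
  using H_algebra by (rule unital_algebra.axioms)

lemma H_ring: "ring H"
  using H_algebra by (rule unital_algebra.axioms)

lemmas H_mult_bilinear = unital_algebra_mult_bilinear[OF H_algebra]

lemma H_one: "\<one>\<^bsub>H\<^esub> \<in> carrier H"
  using H_ring by (simp add: ring.ring_simprules(6))

lemma H_l_one: "h \<in> carrier H \<Longrightarrow> \<one>\<^bsub>H\<^esub> \<otimes>\<^bsub>H\<^esub> h = h"
  and H_r_one: "h \<in> carrier H \<Longrightarrow> h \<otimes>\<^bsub>H\<^esub> \<one>\<^bsub>H\<^esub> = h"
  using H_ring by (auto simp: ring_def monoid.l_one monoid.r_one)

lemma comult_linear: "comult H \<in> linear_maps R H (tensor_space R H H)"
  and comult_one: "comult H \<one>\<^bsub>H\<^esub> = pure_tensor R H H \<one>\<^bsub>H\<^esub> \<one>\<^bsub>H\<^esub>"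
  using hopf_algebra.comult_hom[OF hopf]
  by (auto simp: algebra_homs_def tensor_algebra_underlying ring_hom_def tensor_algebra_sel)

lemma counit_linear: "counit H \<in> linear_maps R H k"
  and counit_one: "counit H \<one>\<^bsub>H\<^esub> = \<one>"
  and counit_mult: "h \<in> carrier H \<Longrightarrow> h' \<in> carrier H
    \<Longrightarrow> counit H (h \<otimes>\<^bsub>H\<^esub> h') = counit H h \<otimes> counit H h'"
  using hopf_algebra.counit_hom[OF hopf]
  by (auto simp: algebra_homs_def ring_hom_def ground_algebra_def)

lemma D_carrier: "carrier D = linear_maps R H k \<inter> extensional (carrier H)"
  by (simp add: dual_hopf_def dual_space_def Let_def)

lemma D_add: "h \<in> carrier H \<Longrightarrow> (\<theta> \<oplus>\<^bsub>D\<^esub> \<theta>') h = \<theta> h \<oplus> \<theta>' h"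
  and D_smult: "h \<in> carrier H \<Longrightarrow> (r \<odot>\<^bsub>D\<^esub> \<theta>) h = r \<otimes> \<theta> h"
  and D_zero: "h \<in> carrier H \<Longrightarrow> \<zero>\<^bsub>D\<^esub> h = \<zero>"
  and D_one: "h \<in> carrier H \<Longrightarrow> \<one>\<^bsub>D\<^esub> h = counit H h"
  by (simp_all add: dual_hopf_def dual_space_def Let_def)

lemma D_linear: "\<theta> \<in> carrier D \<Longrightarrow> \<theta> \<in> linear_maps R H k"
  by (simp add: D_carrier)

lemma D_value: "\<theta> \<in> carrier D \<Longrightarrow> h \<in> carrier H \<Longrightarrow> \<theta> h \<in> carrier R"
  using linear_closed[OF D_linear] by (fastforce simp: ground_algebra_def)

lemma D_eqI:
  assumes "\<theta> \<in> carrier D" "\<theta>' \<in> carrier D" "\<And>h. h \<in> carrier H \<Longrightarrow> \<theta> h = \<theta>' h"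
  shows "\<theta> = \<theta>'"
  using assms by (auto simp: D_carrier intro: extensionalityI)

lemma D_restrictI:
  assumes "f \<in> linear_maps R H k"
  shows "(\<lambda>h\<in>carrier H. f h) \<in> carrier D"
  using linear_cong[OF H_module assms, of "\<lambda>h\<in>carrier H. f h"] by (simp add: D_carrier)

lemma D_closed:
  "\<theta> \<in> carrier D \<Longrightarrow> \<theta>' \<in> carrier D \<Longrightarrow> \<theta> \<oplus>\<^bsub>D\<^esub> \<theta>' \<in> carrier D"
  "r \<in> carrier R \<Longrightarrow> \<theta> \<in> carrier D \<Longrightarrow> r \<odot>\<^bsub>D\<^esub> \<theta> \<in> carrier D"
  "\<zero>\<^bsub>D\<^esub> \<in> carrier D"
  "\<one>\<^bsub>D\<^esub> \<in> carrier D"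
proof -
  assume "\<theta> \<in> carrier D" "\<theta>' \<in> carrier D"
  then show "\<theta> \<oplus>\<^bsub>D\<^esub> \<theta>' \<in> carrier D"
    using D_restrictI[OF linear_sum[OF ground_module D_linear D_linear]]
    by (simp add: dual_hopf_def dual_space_def Let_def ground_algebra_def)
next
  assume "r \<in> carrier R" "\<theta> \<in> carrier D"
  then show "r \<odot>\<^bsub>D\<^esub> \<theta> \<in> carrier D"
    using D_restrictI[OF linear_scale[OF ground_module D_linear]]
    by (simp add: dual_hopf_def dual_space_def Let_def ground_algebra_def)
next
  have "(\<lambda>h. \<zero>) \<in> linear_maps R H k"
    by (rule linear_mapsI) (auto simp: ground_algebra_def)
  then show "\<zero>\<^bsub>D\<^esub> \<in> carrier D"
    using D_restrictI by (simp add: dual_hopf_def dual_space_def Let_def)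
  show "\<one>\<^bsub>D\<^esub> \<in> carrier D"
    using D_restrictI[OF counit_linear] by (simp add: dual_hopf_def Let_def)
qed

lemma D_module: "module R D"
proof (rule moduleI)
  show "cring R" by (rule cring_axioms)
  show "abelian_group D"
  proof (rule abelian_groupI)
    fix \<theta> assume \<theta>: "\<theta> \<in> carrier D"
    have "(\<ominus> \<one>) \<odot>\<^bsub>D\<^esub> \<theta> \<in> carrier D" using \<theta> by (intro D_closed) auto
    moreover have "(\<ominus> \<one>) \<odot>\<^bsub>D\<^esub> \<theta> \<oplus>\<^bsub>D\<^esub> \<theta> = \<zero>\<^bsub>D\<^esub>"
      using \<theta> by (intro D_eqI D_closed) (auto simp: D_add D_smult D_zero D_value l_minus l_neg)
    ultimately show "\<exists>\<theta>'\<in>carrier D. \<theta>' \<oplus>\<^bsub>D\<^esub> \<theta> = \<zero>\<^bsub>D\<^esub>" by blast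
  qed (auto intro!: D_closed D_eqI simp: D_add D_zero D_value a_ac)
qed (auto intro!: D_closed D_eqI simp: D_add D_smult D_value l_distr r_distr m_assoc)

lemma pairing_bilinear: "pairing \<in> bilinear_maps R H D k"
  using D_linear
  by (auto simp: bilinear_maps_def pairing_def D_add D_smult D_value
      intro!: linear_mapsI, auto simp: ground_algebra_def linear_maps_def D_value)

lemma counit_left: "h \<in> carrier H \<Longrightarrow> lift_bilinear R H (\<lambda>a b. counit H a \<odot>\<^bsub>H\<^esub> b) (comult H h) = h"
  and counit_right: "h \<in> carrier H \<Longrightarrow> lift_bilinear R H (\<lambda>a b. counit H b \<odot>\<^bsub>H\<^esub> a) (comult H h) = h"
  using hopf_algebra.counit_left[OF hopf] hopf_algebra.counit_right[OF hopf] by auto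

lemmas modules = H_module D_module ground_module tensor_module

text \<open>
  With these rules, \<open>(assumption | rule ...)+\<close> proves multilinearity by following the syntax of the
  map.
\<close>

lemmas hopf_lin_rules = linear_id
  linear_bilinear_left[OF pairing_bilinear] linear_bilinear_right[OF pairing_bilinear]
  linear_bilinear_left[OF ground_mult_bilinear] linear_bilinear_right[OF ground_mult_bilinear]
  linear_bilinear_left[OF H_mult_bilinear] linear_bilinear_right[OF H_mult_bilinear]
  linear_bilinear_left[OF smult_bilinear] linear_bilinear_right[OF smult_bilinear]
  linear_bilinear_left[OF pure_tensor_bilinear] linear_bilinear_right[OF pure_tensor_bilinear]
  linear_comp[OF comult_linear] linear_comp[OF counit_linear]
  bilinearI

lemmas hopf_closed_rules =
  bilinear_closed[OF pairing_bilinear] bilinear_closed[OF H_mult_bilinear]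
  bilinear_closed[OF ground_mult_bilinear]
  bilinear_closed[OF smult_bilinear] bilinear_closed[OF pure_tensor_bilinear]
  linear_closed[OF comult_linear] linear_closed[OF counit_linear] H_one D_closed(4)

lemma pairing_tensor_bilinear:
  assumes "\<theta> \<in> carrier D" "\<theta>' \<in> carrier D"
  shows "(\<lambda>a b. pairing a \<theta> \<otimes> pairing b \<theta>') \<in> bilinear_maps R H H k"
  using assms by - (assumption | rule modules hopf_lin_rules hopf_closed_rules)+


lemma pairing_dual_bilinear:
  assumes "h \<in> carrier H" "h' \<in> carrier H"
  shows "(\<lambda>\<phi> \<psi>. pairing h \<phi> \<otimes> pairing h' \<psi>) \<in> bilinear_maps R D D k"
  using assms by - (assumption | rule modules hopf_lin_rules hopf_closed_rules)+

text \<open>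
  Uniqueness of coordinates makes each coordinate a linear functional; these functionals expand
  vectors of \<open>H\<close> in the basis \<open>B\<close>, and functionals in the dual one.
\<close>

lemma dual_basis:
  obtains B e where "finite B" "B \<subseteq> carrier H" "\<And>b. b \<in> B \<Longrightarrow> e b \<in> carrier D"
    "\<And>h. h \<in> carrier H \<Longrightarrow> h = (\<Oplus>\<^bsub>H\<^esub>b\<in>B. pairing h (e b) \<odot>\<^bsub>H\<^esub> b)"
    "\<And>\<theta>. \<theta> \<in> carrier D \<Longrightarrow> \<theta> = (\<Oplus>\<^bsub>D\<^esub>b\<in>B. pairing b \<theta> \<odot>\<^bsub>D\<^esub> e b)"
proof -
  interpret H: module R H by (rule H_module)
  interpret D: module R D by (rule D_module)
  obtain B where "finite_basis R H B" using fin_dim by (auto simp: finite_dimensional_def)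
  then have B: "finite B" "B \<subseteq> carrier H" and ex1: "\<And>v. v \<in> carrier H \<Longrightarrow> \<exists>!c. lin_coeffs R H B v c"
    by (auto simp: finite_basis_def)
  define c where "c = (\<lambda>v. THE c. lin_coeffs R H B v c)"
  have c: "lin_coeffs R H B v (c v)" if "v \<in> carrier H" for v
    unfolding c_def using theI'[OF ex1[OF that]] .
  have uniq: "c v = d" if "v \<in> carrier H" "lin_coeffs R H B v d" for v d
    using ex1[OF that(1)] c[OF that(1)] that(2) by blast
  have cR: "c v b \<in> carrier R" if "v \<in> carrier H" "b \<in> B" for v b
    using c[OF that(1)] that(2) by (auto simp: lin_coeffs_def)
  have exp: "v = (\<Oplus>\<^bsub>H\<^esub>b\<in>B. c v b \<odot>\<^bsub>H\<^esub> b)" if "v \<in> carrier H" for v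
    using c[OF that] by (simp add: lin_coeffs_def)
  have cB: "c v b \<odot>\<^bsub>H\<^esub> b \<in> carrier H" if "v \<in> carrier H" "b \<in> B" for v b
    using cR[OF that] that B by auto
  have lin: "(\<lambda>v. c v b) \<in> linear_maps R H k" if b: "b \<in> B" for b
  proof (rule linear_mapsI)
    fix v assume v: "v \<in> carrier H"
    show "c v b \<in> carrier k" using cR[OF v b] by (simp add: ground_algebra_def)
    {
      fix w assume w: "w \<in> carrier H"
      have "(\<Oplus>\<^bsub>H\<^esub>b\<in>B. (c v b \<oplus> c w b) \<odot>\<^bsub>H\<^esub> b)
          = (\<Oplus>\<^bsub>H\<^esub>b\<in>B. c v b \<odot>\<^bsub>H\<^esub> b \<oplus>\<^bsub>H\<^esub> c w b \<odot>\<^bsub>H\<^esub> b)"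
        using v w B cR cB by (intro H.finsum_cong') (auto simp: H.smult_l_distr subset_iff)
      also have "\<dots> = (\<Oplus>\<^bsub>H\<^esub>b\<in>B. c v b \<odot>\<^bsub>H\<^esub> b) \<oplus>\<^bsub>H\<^esub> (\<Oplus>\<^bsub>H\<^esub>b\<in>B. c w b \<odot>\<^bsub>H\<^esub> b)"
        using v w cB by (intro H.finsum_addf) auto
      finally have "v \<oplus>\<^bsub>H\<^esub> w = (\<Oplus>\<^bsub>H\<^esub>b\<in>B. (c v b \<oplus> c w b) \<odot>\<^bsub>H\<^esub> b)"
        using exp[OF v] exp[OF w] by simp
      also have "\<dots> = (\<Oplus>\<^bsub>H\<^esub>b\<in>B. (\<lambda>b\<in>B. c v b \<oplus> c w b) b \<odot>\<^bsub>H\<^esub> b)"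
        using v w cR B by (intro H.finsum_cong') (auto intro!: H.smult_closed)
      finally have "c (v \<oplus>\<^bsub>H\<^esub> w) = (\<lambda>b\<in>B. c v b \<oplus> c w b)"
        using v w cR by (intro uniq[OF H.a_closed[OF v w]]) (simp add: lin_coeffs_def)
      then show "c (v \<oplus>\<^bsub>H\<^esub> w) b = c v b \<oplus>\<^bsub>k\<^esub> c w b" using b by (simp add: ground_algebra_def)
    next
      fix r assume r: "r \<in> carrier R"
      have "r \<odot>\<^bsub>H\<^esub> v = r \<odot>\<^bsub>H\<^esub> (\<Oplus>\<^bsub>H\<^esub>b\<in>B. c v b \<odot>\<^bsub>H\<^esub> b)"
        using exp[OF v] by simp
      also have "\<dots> = (\<Oplus>\<^bsub>H\<^esub>b\<in>B. r \<odot>\<^bsub>H\<^esub> (c v b \<odot>\<^bsub>H\<^esub> b))"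
        using B r v cB by (intro H.finsum_smult_ldistr) auto
      also have "\<dots> = (\<Oplus>\<^bsub>H\<^esub>b\<in>B. (\<lambda>b\<in>B. r \<otimes> c v b) b \<odot>\<^bsub>H\<^esub> b)"
        using v r cR B by (intro H.finsum_cong') (auto simp: H.smult_assoc1 subset_iff intro!: H.smult_closed)
      finally have "c (r \<odot>\<^bsub>H\<^esub> v) = (\<lambda>b\<in>B. r \<otimes> c v b)"
        using v r cR by (intro uniq[OF H.smult_closed[OF r v]]) (simp add: lin_coeffs_def)
      then show "c (r \<odot>\<^bsub>H\<^esub> v) b = r \<odot>\<^bsub>k\<^esub> c v b" using b by (simp add: ground_algebra_def)
    }
  qed
  define e where "e = (\<lambda>b. \<lambda>v\<in>carrier H. c v b)"
  have e: "e b \<in> carrier D" if "b \<in> B" for b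
    unfolding e_def by (rule D_restrictI[OF lin[OF that]])
  have expH: "h = (\<Oplus>\<^bsub>H\<^esub>b\<in>B. pairing h (e b) \<odot>\<^bsub>H\<^esub> b)" if "h \<in> carrier H" for h
    using exp[OF that] that by (simp add: pairing_def e_def)
  have expD: "\<theta> = (\<Oplus>\<^bsub>D\<^esub>b\<in>B. pairing b \<theta> \<odot>\<^bsub>D\<^esub> e b)" (is "\<theta> = ?s") if \<theta>: "\<theta> \<in> carrier D" for \<theta>
  proof (rule D_eqI[OF \<theta>])
    have s: "pairing b \<theta> \<odot>\<^bsub>D\<^esub> e b \<in> carrier D" if "b \<in> B" for b
      using that B \<theta> e by (auto intro!: D_closed simp: pairing_def D_value)
    show "?s \<in> carrier D" using s by (intro D.finsum_closed) auto
    fix h assume h: "h \<in> carrier H"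
    have "?s h = pairing h ?s" by (simp add: pairing_def)
    also have "\<dots> = (\<Oplus>\<^bsub>k\<^esub>b\<in>B. pairing h (pairing b \<theta> \<odot>\<^bsub>D\<^esub> e b))"
      by (rule linear_finsum[OF D_module ground_module bilinear_right[OF pairing_bilinear h] B(1) s])
    also have "\<dots> = (\<Oplus>\<^bsub>k\<^esub>b\<in>B. pairing (pairing h (e b) \<odot>\<^bsub>H\<^esub> b) \<theta>)"
    proof -
      interpret k: module R k by (rule ground_module)
      have "pairing h (pairing b \<theta> \<odot>\<^bsub>D\<^esub> e b) = pairing (pairing h (e b) \<odot>\<^bsub>H\<^esub> b) \<theta>"
        "pairing (pairing h (e b) \<odot>\<^bsub>H\<^esub> b) \<theta> \<in> carrier k" if "b \<in> B" for b
      proof -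
        have b: "b \<in> carrier H" using that B by auto
        show "pairing h (pairing b \<theta> \<odot>\<^bsub>D\<^esub> e b) = pairing (pairing h (e b) \<odot>\<^bsub>H\<^esub> b) \<theta>"
          using linear_smult[OF D_linear[OF \<theta>] D_value[OF e[OF that] h] b] h D_value[OF \<theta> b]
            D_value[OF e[OF that] h]
          by (simp add: pairing_def D_smult m_comm ground_algebra_def)
        show "pairing (pairing h (e b) \<odot>\<^bsub>H\<^esub> b) \<theta> \<in> carrier k"
          using D_value[OF e[OF that] h] b D_value[OF \<theta>]
          by (simp add: pairing_def ground_algebra_def)
      qed
      then show ?thesis by (intro k.finsum_cong') auto
    qed
    also have "\<dots> = pairing (\<Oplus>\<^bsub>H\<^esub>b\<in>B. pairing h (e b) \<odot>\<^bsub>H\<^esub> b) \<theta>"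
      using D_value[OF e h] B
      by (intro linear_finsum[OF H_module ground_module bilinear_left[OF pairing_bilinear \<theta>] B(1), symmetric])
        (auto simp: pairing_def)
    also have "\<dots> = \<theta> h" using expH[OF h] by (simp add: pairing_def)
    finally show "\<theta> h = ?s h" by simp
  qed
  show thesis by (rule that[OF B e expH expD])
qed

text \<open>
  The functional \<open>p(h, \<cdot>) \<otimes> p(h', \<cdot>)\<close>, in terms of which the coproduct of the dual is characterised.
\<close>

definition pairing2 :: "'h \<Rightarrow> 'h \<Rightarrow> (('h \<Rightarrow> 'r) \<times> ('h \<Rightarrow> 'r) \<Rightarrow> 'r) set \<Rightarrow> 'r" where
  "pairing2 h h' = lift_bilinear R k (\<lambda>\<phi> \<psi>. pairing h \<phi> \<otimes> pairing h' \<psi>)"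

lemma pairing2_linear:
  "h \<in> carrier H \<Longrightarrow> h' \<in> carrier H \<Longrightarrow> pairing2 h h' \<in> linear_maps R (tensor_space R D D) k"
  unfolding pairing2_def
  by (rule lift_bilinear_linear[OF D_module D_module ground_module pairing_dual_bilinear])

lemma pairing2_pure:
  "h \<in> carrier H \<Longrightarrow> h' \<in> carrier H \<Longrightarrow> \<phi> \<in> carrier D \<Longrightarrow> \<psi> \<in> carrier D
    \<Longrightarrow> pairing2 h h' (pure_tensor R D D \<phi> \<psi>) = pairing h \<phi> \<otimes> pairing h' \<psi>"
  unfolding pairing2_def
  by (rule lift_bilinear_pure[OF D_module D_module ground_module pairing_dual_bilinear])

text \<open>
  The tensor products \<open>e\<^sub>b \<otimes> e\<^sub>b\<^sub>'\<close> of dual basis vectors expand \<open>D \<otimes> D\<close> with coefficients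
  \<open>pairing2 b b'\<close>: both sides are linear in \<open>t\<close>, and on \<open>\<phi> \<otimes> \<psi>\<close> this is the expansion of \<open>\<phi>\<close> and \<open>\<psi>\<close>.
\<close>

lemma pairing2_dual_basis:
  obtains B e where "finite B" "B \<subseteq> carrier H" "\<And>b. b \<in> B \<Longrightarrow> e b \<in> carrier D"
    "\<And>h. h \<in> carrier H \<Longrightarrow> h = (\<Oplus>\<^bsub>H\<^esub>b\<in>B. pairing h (e b) \<odot>\<^bsub>H\<^esub> b)"
    "\<And>t. t \<in> carrier (tensor_space R D D) \<Longrightarrow>
      t = (\<Oplus>\<^bsub>tensor_space R D D\<^esub>b\<in>B. \<Oplus>\<^bsub>tensor_space R D D\<^esub>b'\<in>B.
        pairing2 b b' t \<odot>\<^bsub>tensor_space R D D\<^esub> pure_tensor R D D (e b) (e b'))"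
proof (rule dual_basis)
  fix B e
  assume B: "finite B" "B \<subseteq> carrier H" and e: "\<And>b. b \<in> B \<Longrightarrow> e b \<in> carrier D"
    and expH: "\<And>h. h \<in> carrier H \<Longrightarrow> h = (\<Oplus>\<^bsub>H\<^esub>b\<in>B. pairing h (e b) \<odot>\<^bsub>H\<^esub> b)"
    and expD: "\<And>\<theta>. \<theta> \<in> carrier D \<Longrightarrow> \<theta> = (\<Oplus>\<^bsub>D\<^esub>b\<in>B. pairing b \<theta> \<odot>\<^bsub>D\<^esub> e b)"
  let ?T = "tensor_space R D D" and ?p = "pure_tensor R D D"
  have T: "module R ?T" by (rule tensor_module[OF D_module D_module])
  interpret H: module R H by (rule H_module)
  interpret D: module R D by (rule D_module)
  interpret T: module R ?T by (rule T)
  note p = pure_tensor_bilinear[OF D_module D_module]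
  have expT: "t = (\<Oplus>\<^bsub>?T\<^esub>b\<in>B. \<Oplus>\<^bsub>?T\<^esub>b'\<in>B. pairing2 b b' t \<odot>\<^bsub>?T\<^esub> ?p (e b) (e b'))"
    if t: "t \<in> carrier ?T" for t
  proof (rule tensor_linear_ext[OF D_module D_module T linear_id _ _ t])
    show "(\<lambda>t. \<Oplus>\<^bsub>?T\<^esub>b\<in>B. \<Oplus>\<^bsub>?T\<^esub>b'\<in>B. pairing2 b b' t \<odot>\<^bsub>?T\<^esub> ?p (e b) (e b'))
        \<in> linear_maps R ?T ?T"
      using B e
      by (intro linear_finsum_maps T B linear_bilinear_left[OF smult_bilinear[OF T]]
          pairing2_linear bilinear_closed[OF p]) auto
    fix \<phi> \<psi> assume \<phi>: "\<phi> \<in> carrier D" and \<psi>: "\<psi> \<in> carrier D"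
    have s: "pairing b \<theta> \<odot>\<^bsub>D\<^esub> e b \<in> carrier D" if "b \<in> B" "\<theta> \<in> carrier D" for b \<theta>
      using that B e by (auto intro!: D_closed simp: pairing_def D_value)
    have "?p \<phi> \<psi> = ?p (\<Oplus>\<^bsub>D\<^esub>b\<in>B. pairing b \<phi> \<odot>\<^bsub>D\<^esub> e b) \<psi>"
      using expD[OF \<phi>] by simp
    also have "\<dots> = (\<Oplus>\<^bsub>?T\<^esub>b\<in>B. ?p (pairing b \<phi> \<odot>\<^bsub>D\<^esub> e b) \<psi>)"
      by (rule linear_finsum[OF D_module T bilinear_left[OF p \<psi>] B(1) s[OF _ \<phi>]])
    also have "\<dots> = (\<Oplus>\<^bsub>?T\<^esub>b\<in>B. \<Oplus>\<^bsub>?T\<^esub>b'\<in>B. pairing2 b b' (?p \<phi> \<psi>) \<odot>\<^bsub>?T\<^esub> ?p (e b) (e b'))"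
    proof (rule T.finsum_cong'[OF refl])
      have cl: "pairing2 b b' (?p \<phi> \<psi>) \<odot>\<^bsub>?T\<^esub> ?p (e b) (e b') \<in> carrier ?T"
        if "b \<in> B" "b' \<in> B" for b b'
        using that B \<phi> \<psi> e
        by (intro T.smult_closed bilinear_closed[OF p]) (auto simp: pairing2_pure subset_iff pairing_def D_value)
      then show "(\<lambda>b. \<Oplus>\<^bsub>?T\<^esub>b'\<in>B. pairing2 b b' (?p \<phi> \<psi>) \<odot>\<^bsub>?T\<^esub> ?p (e b) (e b')) \<in> B \<rightarrow> carrier ?T"
        by (auto intro!: T.finsum_closed)
      fix b assume b: "b \<in> B"
      have bH: "b \<in> carrier H" using b B by auto
      have "?p (pairing b \<phi> \<odot>\<^bsub>D\<^esub> e b) \<psi> =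
          ?p (pairing b \<phi> \<odot>\<^bsub>D\<^esub> e b) (\<Oplus>\<^bsub>D\<^esub>b'\<in>B. pairing b' \<psi> \<odot>\<^bsub>D\<^esub> e b')"
        using expD[OF \<psi>] by simp
      also have "\<dots> = (\<Oplus>\<^bsub>?T\<^esub>b'\<in>B. ?p (pairing b \<phi> \<odot>\<^bsub>D\<^esub> e b) (pairing b' \<psi> \<odot>\<^bsub>D\<^esub> e b'))"
        by (rule linear_finsum[OF D_module T bilinear_right[OF p s[OF b \<phi>]] B(1) s[OF _ \<psi>]])
      also have "\<dots> = (\<Oplus>\<^bsub>?T\<^esub>b'\<in>B. pairing2 b b' (?p \<phi> \<psi>) \<odot>\<^bsub>?T\<^esub> ?p (e b) (e b'))"
      proof (rule T.finsum_cong'[OF refl])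
        show "(\<lambda>b'. pairing2 b b' (?p \<phi> \<psi>) \<odot>\<^bsub>?T\<^esub> ?p (e b) (e b')) \<in> B \<rightarrow> carrier ?T"
          using cl b by auto
        fix b' assume b': "b' \<in> B"
        have b'H: "b' \<in> carrier H" using b' B by auto
        have v: "pairing b \<phi> \<in> carrier R" "pairing b' \<psi> \<in> carrier R"
          using bH b'H \<phi> \<psi> by (auto simp: pairing_def D_value)
        show "?p (pairing b \<phi> \<odot>\<^bsub>D\<^esub> e b) (pairing b' \<psi> \<odot>\<^bsub>D\<^esub> e b') =
            pairing2 b b' (?p \<phi> \<psi>) \<odot>\<^bsub>?T\<^esub> ?p (e b) (e b')"
          using b b' v bH b'H \<phi> \<psi> e bilinear_closed[OF p]
          by (simp add: linear_smult[OF bilinear_left[OF p]] linear_smult[OF bilinear_right[OF p]]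
              pairing2_pure m_comm flip: T.smult_assoc1)
      qed
      finally show "?p (pairing b \<phi> \<odot>\<^bsub>D\<^esub> e b) \<psi> =
          (\<Oplus>\<^bsub>?T\<^esub>b'\<in>B. pairing2 b b' (?p \<phi> \<psi>) \<odot>\<^bsub>?T\<^esub> ?p (e b) (e b'))" .
    qed
    finally show "?p \<phi> \<psi> = (\<Oplus>\<^bsub>?T\<^esub>b\<in>B. \<Oplus>\<^bsub>?T\<^esub>b'\<in>B.
        pairing2 b b' (?p \<phi> \<psi>) \<odot>\<^bsub>?T\<^esub> ?p (e b) (e b'))" .
  qed
  show thesis by (rule that[OF B e expH expT])
qed

lemma pairing2_separates:
  assumes "s \<in> carrier (tensor_space R D D)" "t \<in> carrier (tensor_space R D D)"
    and eq: "\<And>h h'. h \<in> carrier H \<Longrightarrow> h' \<in> carrier H \<Longrightarrow> pairing2 h h' s = pairing2 h h' t"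
  shows "s = t"
proof (rule pairing2_dual_basis)
  let ?T = "tensor_space R D D" and ?p = "pure_tensor R D D"
  interpret T: module R ?T by (rule tensor_module[OF D_module D_module])
  fix B e
  assume B: "finite B" "B \<subseteq> carrier H" and e: "\<And>b. b \<in> B \<Longrightarrow> e b \<in> carrier D"
    and exp: "\<And>t. t \<in> carrier ?T \<Longrightarrow>
      t = (\<Oplus>\<^bsub>?T\<^esub>b\<in>B. \<Oplus>\<^bsub>?T\<^esub>b'\<in>B. pairing2 b b' t \<odot>\<^bsub>?T\<^esub> ?p (e b) (e b'))"
  have cl: "pairing2 b b' t \<odot>\<^bsub>?T\<^esub> ?p (e b) (e b') \<in> carrier ?T" if "b \<in> B" "b' \<in> B" for b b'
    using that B e linear_closed[OF pairing2_linear, of b b' t] assms(2)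
    by (intro T.smult_closed bilinear_closed[OF pure_tensor_bilinear[OF D_module D_module]])
      (auto simp: ground_algebra_def subset_iff)
  have "(\<Oplus>\<^bsub>?T\<^esub>b\<in>B. \<Oplus>\<^bsub>?T\<^esub>b'\<in>B. pairing2 b b' s \<odot>\<^bsub>?T\<^esub> ?p (e b) (e b')) =
      (\<Oplus>\<^bsub>?T\<^esub>b\<in>B. \<Oplus>\<^bsub>?T\<^esub>b'\<in>B. pairing2 b b' t \<odot>\<^bsub>?T\<^esub> ?p (e b) (e b'))"
    using B cl by (intro T.finsum_cong' refl) (auto simp: eq subset_iff intro!: T.finsum_closed)
  then show ?thesis using exp[OF assms(1)] exp[OF assms(2)] by simp
qed

lemma dual_comult_eq:
  "comult D \<theta> = (THE t. t \<in> carrier (tensor_space R D D) \<and>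
    (\<forall>h\<in>carrier H. \<forall>h'\<in>carrier H. pairing2 h h' t = pairing (h \<otimes>\<^bsub>H\<^esub> h') \<theta>))"
  unfolding pairing2_def dual_space_underlying[symmetric] by (simp add: dual_hopf_def Let_def)

text \<open>
  The definite description of \<open>comult D \<theta>\<close> denotes: uniqueness is
  \<open>pairing2_separates\<close>, and existence is witnessed by \<open>\<Sum>\<^sub>b\<^sub>,\<^sub>b\<^sub>' p(b b', \<theta>) e\<^sub>b \<otimes> e\<^sub>b\<^sub>'\<close>, evaluated at \<open>(h, h')\<close> by expanding
  \<open>h\<close> and \<open>h'\<close> in the basis.
\<close>

lemma dual_comult_spec:
  assumes \<theta>: "\<theta> \<in> carrier D"
  shows "comult D \<theta> \<in> carrier (tensor_space R D D)"
    and "\<And>h h'. h \<in> carrier H \<Longrightarrow> h' \<in> carrier H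
      \<Longrightarrow> pairing2 h h' (comult D \<theta>) = pairing (h \<otimes>\<^bsub>H\<^esub> h') \<theta>"
proof -
  let ?T = "tensor_space R D D" and ?p = "pure_tensor R D D"
  let ?P = "\<lambda>t. t \<in> carrier ?T \<and>
    (\<forall>h\<in>carrier H. \<forall>h'\<in>carrier H. pairing2 h h' t = pairing (h \<otimes>\<^bsub>H\<^esub> h') \<theta>)"
  have T: "module R ?T" by (rule tensor_module[OF D_module D_module])
  interpret H: module R H by (rule H_module)
  interpret k: module R k by (rule ground_module)
  interpret T: module R ?T by (rule T)
  have "\<exists>t. ?P t"
  proof (rule pairing2_dual_basis)
    fix B e
    assume B: "finite B" "B \<subseteq> carrier H" and e: "\<And>b. b \<in> B \<Longrightarrow> e b \<in> carrier D"
      and expH: "\<And>h. h \<in> carrier H \<Longrightarrow> h = (\<Oplus>\<^bsub>H\<^esub>b\<in>B. pairing h (e b) \<odot>\<^bsub>H\<^esub> b)"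
    define t where "t = (\<Oplus>\<^bsub>?T\<^esub>b\<in>B. \<Oplus>\<^bsub>?T\<^esub>b'\<in>B.
      pairing (b \<otimes>\<^bsub>H\<^esub> b') \<theta> \<odot>\<^bsub>?T\<^esub> ?p (e b) (e b'))"
    have pR: "pairing h \<phi> \<in> carrier R" if "h \<in> carrier H" "\<phi> \<in> carrier D" for h \<phi>
      using that by (simp add: pairing_def D_value)
    have cl: "pairing (b \<otimes>\<^bsub>H\<^esub> b') \<theta> \<odot>\<^bsub>?T\<^esub> ?p (e b) (e b') \<in> carrier ?T" if "b \<in> B" "b' \<in> B" for b b'
      using that B e \<theta> bilinear_closed[OF H_mult_bilinear]
      by (intro T.smult_closed bilinear_closed[OF pure_tensor_bilinear[OF D_module D_module]])
        (auto simp: subset_iff intro!: pR)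
    have "pairing2 h h' t = pairing (h \<otimes>\<^bsub>H\<^esub> h') \<theta>" if h: "h \<in> carrier H" and h': "h' \<in> carrier H" for h h'
    proof -
      note \<mu> = H_mult_bilinear
      have hb: "pairing g (e b) \<odot>\<^bsub>H\<^esub> b \<in> carrier H" if "g \<in> carrier H" "b \<in> B" for g b
        using that B e pR by auto
      have "pairing (h \<otimes>\<^bsub>H\<^esub> h') \<theta> = pairing ((\<Oplus>\<^bsub>H\<^esub>b\<in>B. pairing h (e b) \<odot>\<^bsub>H\<^esub> b) \<otimes>\<^bsub>H\<^esub> h') \<theta>"
        using expH[OF h] by simp
      also have "\<dots> = (\<Oplus>\<^bsub>k\<^esub>b\<in>B. pairing ((pairing h (e b) \<odot>\<^bsub>H\<^esub> b) \<otimes>\<^bsub>H\<^esub> h') \<theta>)"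
        by (rule linear_finsum[OF H_module ground_module _ B(1) hb[OF h]])
          (rule linear_comp[OF bilinear_left[OF pairing_bilinear \<theta>] bilinear_left[OF \<mu> h']])
      also have "\<dots> = (\<Oplus>\<^bsub>k\<^esub>b\<in>B. pairing2 h h' (\<Oplus>\<^bsub>?T\<^esub>b'\<in>B.
          pairing (b \<otimes>\<^bsub>H\<^esub> b') \<theta> \<odot>\<^bsub>?T\<^esub> ?p (e b) (e b')))"
      proof (rule k.finsum_cong'[OF refl])
        show "(\<lambda>b. pairing2 h h' (\<Oplus>\<^bsub>?T\<^esub>b'\<in>B. pairing (b \<otimes>\<^bsub>H\<^esub> b') \<theta> \<odot>\<^bsub>?T\<^esub> ?p (e b) (e b')))
            \<in> B \<rightarrow> carrier k"
          using cl by (auto intro!: linear_closed[OF pairing2_linear[OF h h']] T.finsum_closed)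
        fix b assume b: "b \<in> B"
        have bH: "b \<in> carrier H" using b B by auto
        have "pairing ((pairing h (e b) \<odot>\<^bsub>H\<^esub> b) \<otimes>\<^bsub>H\<^esub> h') \<theta> =
            pairing ((pairing h (e b) \<odot>\<^bsub>H\<^esub> b) \<otimes>\<^bsub>H\<^esub> (\<Oplus>\<^bsub>H\<^esub>b'\<in>B. pairing h' (e b') \<odot>\<^bsub>H\<^esub> b')) \<theta>"
          using expH[OF h'] by simp
        also have "\<dots> = (\<Oplus>\<^bsub>k\<^esub>b'\<in>B.
            pairing ((pairing h (e b) \<odot>\<^bsub>H\<^esub> b) \<otimes>\<^bsub>H\<^esub> (pairing h' (e b') \<odot>\<^bsub>H\<^esub> b')) \<theta>)"
          by (rule linear_finsum[OF H_module ground_module _ B(1) hb[OF h']])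
            (rule linear_comp[OF bilinear_left[OF pairing_bilinear \<theta>] bilinear_right[OF \<mu> hb[OF h b]]])
        also have "\<dots> = (\<Oplus>\<^bsub>k\<^esub>b'\<in>B. pairing2 h h' (pairing (b \<otimes>\<^bsub>H\<^esub> b') \<theta> \<odot>\<^bsub>?T\<^esub> ?p (e b) (e b')))"
        proof (rule k.finsum_cong'[OF refl])
          show "(\<lambda>b'. pairing2 h h' (pairing (b \<otimes>\<^bsub>H\<^esub> b') \<theta> \<odot>\<^bsub>?T\<^esub> ?p (e b) (e b'))) \<in> B \<rightarrow> carrier k"
            using cl b by (auto intro!: linear_closed[OF pairing2_linear[OF h h']])
          fix b' assume b': "b' \<in> B"
          have b'H: "b' \<in> carrier H" using b' B by auto
          have bb: "b \<otimes>\<^bsub>H\<^esub> b' \<in> carrier H" using bilinear_closed[OF \<mu> bH b'H] .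
          have "pairing ((pairing h (e b) \<odot>\<^bsub>H\<^esub> b) \<otimes>\<^bsub>H\<^esub> (pairing h' (e b') \<odot>\<^bsub>H\<^esub> b')) \<theta> =
              pairing h (e b) \<otimes> (pairing h' (e b') \<otimes> pairing (b \<otimes>\<^bsub>H\<^esub> b') \<theta>)"
            using h h' b b' bH b'H e \<theta> pR bb
            by (simp add: linear_smult[OF bilinear_left[OF \<mu>]] linear_smult[OF bilinear_right[OF \<mu>]]
                linear_smult[OF bilinear_left[OF pairing_bilinear]])
              (simp add: ground_algebra_def m_lcomm)
          also have "\<dots> = pairing2 h h' (pairing (b \<otimes>\<^bsub>H\<^esub> b') \<theta> \<odot>\<^bsub>?T\<^esub> ?p (e b) (e b'))"
            using h h' b b' bH b'H e \<theta> pR bb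
              bilinear_closed[OF pure_tensor_bilinear[OF D_module D_module]]
            by (simp add: linear_smult[OF pairing2_linear] pairing2_pure)
              (simp add: ground_algebra_def m_ac)
          finally show "pairing ((pairing h (e b) \<odot>\<^bsub>H\<^esub> b) \<otimes>\<^bsub>H\<^esub> (pairing h' (e b') \<odot>\<^bsub>H\<^esub> b')) \<theta> =
            pairing2 h h' (pairing (b \<otimes>\<^bsub>H\<^esub> b') \<theta> \<odot>\<^bsub>?T\<^esub> ?p (e b) (e b'))" .
        qed
        also have "\<dots> = pairing2 h h' (\<Oplus>\<^bsub>?T\<^esub>b'\<in>B.
            pairing (b \<otimes>\<^bsub>H\<^esub> b') \<theta> \<odot>\<^bsub>?T\<^esub> ?p (e b) (e b'))"
          by (rule linear_finsum[OF T ground_module pairing2_linear[OF h h'] B(1) cl[OF b], symmetric])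
        finally show "pairing ((pairing h (e b) \<odot>\<^bsub>H\<^esub> b) \<otimes>\<^bsub>H\<^esub> h') \<theta> =
          pairing2 h h' (\<Oplus>\<^bsub>?T\<^esub>b'\<in>B. pairing (b \<otimes>\<^bsub>H\<^esub> b') \<theta> \<odot>\<^bsub>?T\<^esub> ?p (e b) (e b'))" .
      qed
      also have "\<dots> = pairing2 h h' t"
        unfolding t_def using cl
        by (intro linear_finsum[OF T ground_module pairing2_linear[OF h h'] B(1), symmetric]
            T.finsum_closed) auto
      finally show ?thesis by simp
    qed
    moreover have "t \<in> carrier ?T" unfolding t_def using cl by (auto intro!: T.finsum_closed)
    ultimately show ?thesis by blast
  qed
  then have "\<exists>!t. ?P t"
    by (rule ex_ex1I) (rule pairing2_separates; simp)
  from theI'[OF this] have "?P (comult D \<theta>)" unfolding dual_comult_eq .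
  then show "comult D \<theta> \<in> carrier (tensor_space R D D)"
    and "\<And>h h'. h \<in> carrier H \<Longrightarrow> h' \<in> carrier H
      \<Longrightarrow> pairing2 h h' (comult D \<theta>) = pairing (h \<otimes>\<^bsub>H\<^esub> h') \<theta>"
    by auto
qed

lemma dual_comult_unique:
  assumes "\<theta> \<in> carrier D" "t \<in> carrier (tensor_space R D D)"
    and "\<And>h h'. h \<in> carrier H \<Longrightarrow> h' \<in> carrier H \<Longrightarrow> pairing2 h h' t = pairing (h \<otimes>\<^bsub>H\<^esub> h') \<theta>"
  shows "comult D \<theta> = t"
  using assms by (intro pairing2_separates) (simp_all add: dual_comult_spec)

lemma dual_comult_linear: "comult D \<in> linear_maps R D (tensor_space R D D)"
proof (rule linear_mapsI)
  interpret T: module R "tensor_space R D D" by (rule tensor_module[OF D_module D_module])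
  interpret D: module R D by (rule D_module)
  note m = bilinear_closed[OF H_mult_bilinear] and c = dual_comult_spec
  fix \<theta> assume \<theta>: "\<theta> \<in> carrier D"
  show "comult D \<theta> \<in> carrier (tensor_space R D D)" by (rule c[OF \<theta>])
  {
    fix \<theta>' assume \<theta>': "\<theta>' \<in> carrier D"
    show "comult D (\<theta> \<oplus>\<^bsub>D\<^esub> \<theta>') = comult D \<theta> \<oplus>\<^bsub>tensor_space R D D\<^esub> comult D \<theta>'"
      using \<theta> \<theta>'
      by (intro dual_comult_unique)
        (simp_all add: c linear_add[OF pairing2_linear] linear_add[OF bilinear_right[OF pairing_bilinear]] m)
  next
    fix r assume r: "r \<in> carrier R"
    show "comult D (r \<odot>\<^bsub>D\<^esub> \<theta>) = r \<odot>\<^bsub>tensor_space R D D\<^esub> comult D \<theta>"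
      using \<theta> r
      by (intro dual_comult_unique)
        (simp_all add: c linear_smult[OF pairing2_linear] linear_smult[OF bilinear_right[OF pairing_bilinear]] m)
  }
qed

text \<open>
  The coproduct of the dual is dual to the product of \<open>H\<close>, so its unit \<open>\<epsilon>\<close> is group-like because \<open>\<epsilon>\<close> is
  multiplicative.
\<close>

lemma dual_comult_one: "comult D \<one>\<^bsub>D\<^esub> = pure_tensor R D D \<one>\<^bsub>D\<^esub> \<one>\<^bsub>D\<^esub>"
  using bilinear_closed[OF H_mult_bilinear]
  by (intro dual_comult_unique hopf_closed_rules modules)
    (simp_all add: pairing2_pure D_closed pairing_def D_one counit_mult)

lemma dual_mult:
  assumes "\<theta> \<in> carrier D" "\<theta>' \<in> carrier D"
  shows "\<theta> \<otimes>\<^bsub>D\<^esub> \<theta>' = (\<lambda>h\<in>carrier H. lift_bilinear R k (\<lambda>a b. pairing a \<theta> \<otimes> pairing b \<theta>') (comult H h))"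
  by (simp add: dual_hopf_def Let_def)

lemma dual_mult_closed:
  assumes "\<theta> \<in> carrier D" "\<theta>' \<in> carrier D"
  shows "\<theta> \<otimes>\<^bsub>D\<^esub> \<theta>' \<in> carrier D"
  unfolding dual_mult[OF assms]
  by (rule D_restrictI[OF linear_lift[OF comult_linear pairing_tensor_bilinear[OF assms]
          H_module H_module ground_module]])

lemma D_mult_bilinear: "mult D \<in> bilinear_maps R D D D"
proof -
  interpret D: module R D by (rule D_module)
  note lift_maps = linear_lift_maps[OF linear_closed[OF comult_linear]]
  have l: "(\<lambda>\<theta>. lift_bilinear R k (\<lambda>a b. pairing a \<theta> \<otimes> pairing b \<theta>') (comult H h)) \<in> linear_maps R D k"
    if "\<theta>' \<in> carrier D" "h \<in> carrier H" for \<theta>' h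
    using that by - (rule lift_maps; (assumption | rule modules hopf_lin_rules hopf_closed_rules)+)
  have r: "(\<lambda>\<theta>. lift_bilinear R k (\<lambda>a b. pairing a \<theta>' \<otimes> pairing b \<theta>) (comult H h)) \<in> linear_maps R D k"
    if "\<theta>' \<in> carrier D" "h \<in> carrier H" for \<theta>' h
    using that by - (rule lift_maps; (assumption | rule modules hopf_lin_rules hopf_closed_rules)+)
  note lin = linear_add[OF l] linear_add[OF r] linear_smult[OF l] linear_smult[OF r]
  have "(\<lambda>\<theta> \<theta>'. \<theta> \<otimes>\<^bsub>D\<^esub> \<theta>') \<in> bilinear_maps R D D D"
    by (rule bilinearI; rule linear_mapsI; (rule dual_mult_closed; assumption)?)
      (auto intro!: D_eqI dual_mult_closed D_closed simp: D_add D_smult,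
       auto simp: dual_mult lin D_closed, auto simp: ground_algebra_def)
  then show ?thesis by simp
qed

lemma counit_smult_bilinear:
  "(\<lambda>a b. counit H a \<odot>\<^bsub>H\<^esub> b) \<in> bilinear_maps R H H H"
  "(\<lambda>a b. counit H b \<odot>\<^bsub>H\<^esub> a) \<in> bilinear_maps R H H H"
  by (assumption | rule modules hopf_lin_rules hopf_closed_rules)+

lemma pairing_smult:
  "r \<in> carrier R \<Longrightarrow> h \<in> carrier H \<Longrightarrow> \<theta> \<in> carrier D
    \<Longrightarrow> pairing (r \<odot>\<^bsub>H\<^esub> h) \<theta> = r \<otimes> pairing h \<theta>"
  using linear_smult[OF bilinear_left[OF pairing_bilinear]] by (simp add: ground_algebra_def)

lemma counit_closed: "h \<in> carrier H \<Longrightarrow> counit H h \<in> carrier R"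
  using linear_closed[OF counit_linear] by (simp add: ground_algebra_def)

text \<open>
  The product of the dual is dual to the coproduct of \<open>H\<close>, so the unit laws are the counit laws of
  \<open>H\<close> under the pairing.
\<close>

lemma dual_l_one:
  assumes \<theta>: "\<theta> \<in> carrier D"
  shows "\<one>\<^bsub>D\<^esub> \<otimes>\<^bsub>D\<^esub> \<theta> = \<theta>"
proof (rule D_eqI[OF dual_mult_closed[OF D_closed(4) \<theta>] \<theta>])
  fix h assume h: "h \<in> carrier H"
  note \<Delta>h = linear_closed[OF comult_linear h]
  have "(\<one>\<^bsub>D\<^esub> \<otimes>\<^bsub>D\<^esub> \<theta>) h = lift_bilinear R k (\<lambda>a b. pairing a \<one>\<^bsub>D\<^esub> \<otimes> pairing b \<theta>) (comult H h)"
    using h \<theta> by (simp add: dual_mult D_closed)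
  also have "\<dots> = lift_bilinear R k (\<lambda>a b. pairing (counit H a \<odot>\<^bsub>H\<^esub> b) \<theta>) (comult H h)"
    using \<theta> by (intro lift_bilinear_cong[OF H_module H_module ground_module \<Delta>h]
        pairing_tensor_bilinear D_closed) (simp_all add: pairing_smult counit_closed, simp add: pairing_def D_one)
  also have "\<dots> = pairing (lift_bilinear R H (\<lambda>a b. counit H a \<odot>\<^bsub>H\<^esub> b) (comult H h)) \<theta>"
    by (rule linear_lift_commute[OF H_module H_module H_module ground_module
          bilinear_left[OF pairing_bilinear \<theta>] counit_smult_bilinear(1) \<Delta>h, symmetric])
  finally show "(\<one>\<^bsub>D\<^esub> \<otimes>\<^bsub>D\<^esub> \<theta>) h = \<theta> h" by (simp add: counit_left[OF h] pairing_def)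
qed

lemma dual_r_one:
  assumes \<theta>: "\<theta> \<in> carrier D"
  shows "\<theta> \<otimes>\<^bsub>D\<^esub> \<one>\<^bsub>D\<^esub> = \<theta>"
proof (rule D_eqI[OF dual_mult_closed[OF \<theta> D_closed(4)] \<theta>])
  fix h assume h: "h \<in> carrier H"
  note \<Delta>h = linear_closed[OF comult_linear h]
  have "(\<theta> \<otimes>\<^bsub>D\<^esub> \<one>\<^bsub>D\<^esub>) h = lift_bilinear R k (\<lambda>a b. pairing a \<theta> \<otimes> pairing b \<one>\<^bsub>D\<^esub>) (comult H h)"
    using h \<theta> by (simp add: dual_mult D_closed)
  also have "\<dots> = lift_bilinear R k (\<lambda>a b. pairing (counit H b \<odot>\<^bsub>H\<^esub> a) \<theta>) (comult H h)"
    using \<theta> by (intro lift_bilinear_cong[OF H_module H_module ground_module \<Delta>h]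
        pairing_tensor_bilinear D_closed)
      (simp_all add: pairing_smult counit_closed, simp add: pairing_def D_one D_value counit_closed m_comm)
  also have "\<dots> = pairing (lift_bilinear R H (\<lambda>a b. counit H b \<odot>\<^bsub>H\<^esub> a) (comult H h)) \<theta>"
    by (rule linear_lift_commute[OF H_module H_module H_module ground_module
          bilinear_left[OF pairing_bilinear \<theta>] counit_smult_bilinear(2) \<Delta>h, symmetric])
  finally show "(\<theta> \<otimes>\<^bsub>D\<^esub> \<one>\<^bsub>D\<^esub>) h = \<theta> h" by (simp add: counit_right[OF h] pairing_def)
qed

end

section \<open>Maps and products on tensor products\<close>

context cring
begin

lemma module_same_structure:
  assumes "module R M" "carrier N = carrier M" "add N = add M" "zero N = zero M" "smult N = smult M"
  shows "module R N"
proof (rule linear_image_module[OF assms(1)])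
  show "(\<lambda>x. x) \<in> linear_maps R M N" using assms(2-5) linear_id[of R M] by (simp add: linear_maps_def)
qed (use assms in auto)

lemma tensor_map_pure:
  assumes "module R A" "module R B" "module R C" "module R D"
    and f: "f \<in> linear_maps R A C" and g: "g \<in> linear_maps R B D"
    and "a \<in> carrier A" "b \<in> carrier B"
  shows "tensor_map R C D f g (pure_tensor R A B a b) = pure_tensor R C D (f a) (g b)"
proof -
  have "(\<lambda>a b. pure_tensor R C D (f a) (g b)) \<in> bilinear_maps R A B (tensor_space R C D)"
    using assms
    by - (assumption | rule bilinearI linear_bilinear_left[OF pure_tensor_bilinear]
        linear_bilinear_right[OF pure_tensor_bilinear] linear_closed[OF f] linear_closed[OF g])+
  then show ?thesis
    unfolding tensor_map_def using assms by (intro lift_bilinear_pure tensor_module)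
qed

lemma tensor_map_linear:
  assumes "module R A" "module R B" "module R C" "module R D"
    and f: "f \<in> linear_maps R A C" and g: "g \<in> linear_maps R B D"
  shows "tensor_map R C D f g \<in> linear_maps R (tensor_space R A B) (tensor_space R C D)"
proof -
  have "(\<lambda>a b. pure_tensor R C D (f a) (g b)) \<in> bilinear_maps R A B (tensor_space R C D)"
    using assms
    by - (assumption | rule bilinearI linear_bilinear_left[OF pure_tensor_bilinear]
        linear_bilinear_right[OF pure_tensor_bilinear] linear_closed[OF f] linear_closed[OF g])+
  then show ?thesis
    unfolding tensor_map_def using assms by (intro lift_bilinear_linear tensor_module)
qed

lemma tensor_flip_bilinear:
  assumes "module R A" "module R B"
  shows "(\<lambda>a b. pure_tensor R B A b a) \<in> bilinear_maps R A B (tensor_space R B A)"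
  using assms
  by - (assumption | rule bilinearI bilinear_right[OF pure_tensor_bilinear]
      bilinear_left[OF pure_tensor_bilinear])+

lemma tensor_flip_linear:
  assumes "module R A" "module R B"
  shows "tensor_flip R A B \<in> linear_maps R (tensor_space R A B) (tensor_space R B A)"
  unfolding tensor_flip_def using assms by (intro lift_bilinear_linear tensor_module tensor_flip_bilinear)

lemma tensor_flip_pure:
  assumes "module R A" "module R B" "a \<in> carrier A" "b \<in> carrier B"
  shows "tensor_flip R A B (pure_tensor R A B a b) = pure_tensor R B A b a"
  unfolding tensor_flip_def using assms by (intro lift_bilinear_pure tensor_module tensor_flip_bilinear)

lemma mult_map_tensor_map:
  assumes A: "module R A" and B: "module R B" and C: "module R C"
    and f: "f \<in> linear_maps R A C" and g: "g \<in> linear_maps R B C"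
    and \<mu>: "mult C \<in> bilinear_maps R C C C"
    and a: "a \<in> carrier A" and b: "b \<in> carrier B"
  shows "mult_map R C (tensor_map R C C f g (pure_tensor R A B a b)) = f a \<otimes>\<^bsub>C\<^esub> g b"
  unfolding tensor_map_pure[OF A B C C f g a b] mult_map_def
  by (rule lift_bilinear_pure[OF C C C \<mu> linear_closed[OF f a] linear_closed[OF g b]])

lemma tensor_assoc_linear:
  assumes A: "module R A" and B: "module R B" and C: "module R C"
  shows "tensor_assoc R A B C \<in>
      linear_maps R (tensor_space R (tensor_space R A B) C) (tensor_space R A (tensor_space R B C))"
    (is ?lin)
    and "s \<in> carrier (tensor_space R A B) \<Longrightarrow> c \<in> carrier C \<Longrightarrow>
      tensor_assoc R A B C (pure_tensor R (tensor_space R A B) C s c) =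
      lift_bilinear R (tensor_space R A (tensor_space R B C))
        (\<lambda>a b. pure_tensor R A (tensor_space R B C) a (pure_tensor R B C b c)) s"
    (is "_ \<Longrightarrow> _ \<Longrightarrow> ?pure")
proof -
  have bil: "(\<lambda>s c. lift_bilinear R (tensor_space R A (tensor_space R B C)) (\<lambda>a b.
      pure_tensor R A (tensor_space R B C) a (pure_tensor R B C b c)) s)
    \<in> bilinear_maps R (tensor_space R A B) C (tensor_space R A (tensor_space R B C))"
    using assms
    by - (assumption | rule tensor_module bilinearI linear_id linear_bilinear_left[OF pure_tensor_bilinear]
        linear_bilinear_right[OF pure_tensor_bilinear] bilinear_closed[OF pure_tensor_bilinear]
        linear_lift linear_lift_maps)+
  show ?lin
    unfolding tensor_assoc_def Let_def
    by (rule lift_bilinear_linear[OF _ _ _ bil]; intro tensor_module assms)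
  show ?pure if "s \<in> carrier (tensor_space R A B)" "c \<in> carrier C"
    unfolding tensor_assoc_def Let_def
    by (rule lift_bilinear_pure[OF _ _ _ bil that]; intro tensor_module assms)
qed

lemma tensor_mult_bilinear:
  assumes A: "module R A" and B: "module R B"
    and \<mu>: "mult A \<in> bilinear_maps R A A A" and \<nu>: "mult B \<in> bilinear_maps R B B B"
  shows "mult (tensor_algebra R A B) \<in>
      bilinear_maps R (tensor_space R A B) (tensor_space R A B) (tensor_space R A B)" (is ?bil)
    and "a \<in> carrier A \<Longrightarrow> b \<in> carrier B \<Longrightarrow> a' \<in> carrier A \<Longrightarrow> b' \<in> carrier B \<Longrightarrow>
      pure_tensor R A B a b \<otimes>\<^bsub>tensor_algebra R A B\<^esub> pure_tensor R A B a' b' =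
      pure_tensor R A B (a \<otimes>\<^bsub>A\<^esub> a') (b \<otimes>\<^bsub>B\<^esub> b')" (is "_ \<Longrightarrow> _ \<Longrightarrow> _ \<Longrightarrow> _ \<Longrightarrow> ?pure")
proof -
  let ?T = "tensor_space R A B" and ?p = "pure_tensor R A B"
  have T: "module R ?T" using A B by (rule tensor_module)
  note rules = tensor_module bilinearI linear_id linear_bilinear_left[OF pure_tensor_bilinear]
        linear_bilinear_right[OF pure_tensor_bilinear] bilinear_closed[OF pure_tensor_bilinear]
        linear_bilinear_left[OF \<mu>] linear_bilinear_right[OF \<mu>] bilinear_closed[OF \<mu>]
        linear_bilinear_left[OF \<nu>] linear_bilinear_right[OF \<nu>] bilinear_closed[OF \<nu>]
        linear_lift linear_lift_maps
  have inner: "(\<lambda>a' b'. ?p (a \<otimes>\<^bsub>A\<^esub> a') (b \<otimes>\<^bsub>B\<^esub> b')) \<in> bilinear_maps R A B ?T"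
    if "a \<in> carrier A" "b \<in> carrier B" for a b
    using that A B by - (assumption | rule rules)+
  have outer: "(\<lambda>a b. lift_bilinear R ?T (\<lambda>a' b'. ?p (a \<otimes>\<^bsub>A\<^esub> a') (b \<otimes>\<^bsub>B\<^esub> b')) t) \<in> bilinear_maps R A B ?T"
    if "t \<in> carrier ?T" for t
    using that A B by - (assumption | rule rules)+
  have "(\<lambda>s t. lift_bilinear R ?T (\<lambda>a b. lift_bilinear R ?T (\<lambda>a' b'. ?p (a \<otimes>\<^bsub>A\<^esub> a') (b \<otimes>\<^bsub>B\<^esub> b')) t) s)
      \<in> bilinear_maps R ?T ?T ?T"
    using A B by - (assumption | rule rules)+
  then show ?bil
    by (simp add: tensor_algebra_def Let_def)
  show ?pure if "a \<in> carrier A" "b \<in> carrier B" "a' \<in> carrier A" "b' \<in> carrier B"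
    using that bilinear_closed[OF pure_tensor_bilinear[OF A B]]
    by (simp add: tensor_algebra_def Let_def lift_bilinear_pure[OF A B T outer]
        lift_bilinear_pure[OF A B T inner])
qed

end

section \<open>The Heisenberg product\<close>

context finite_hopf
begin

abbreviation "HD \<equiv> tensor_space R H D"

lemma HD_module: "module R HD"
  by (intro modules)

lemmas lin_rules = hopf_lin_rules
  linear_bilinear_left[OF D_mult_bilinear] linear_bilinear_right[OF D_mult_bilinear]
  linear_comp[OF dual_comult_linear] linear_lift linear_lift_maps
  hopf_closed_rules bilinear_closed[OF D_mult_bilinear] linear_closed[OF dual_comult_linear]
  lift_closed modules

text \<open>
  The product \<open>(h # \<theta>) (h' # \<theta>') = h h'\<^sub>(\<^sub>1\<^sub>) p(h'\<^sub>(\<^sub>2\<^sub>), \<theta>\<^sub>(\<^sub>1\<^sub>)) # \<theta>\<^sub>(\<^sub>2\<^sub>) \<theta>'\<close> of generators.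
\<close>

definition heisenberg_product :: "'h \<Rightarrow> ('h \<Rightarrow> 'r) \<Rightarrow> 'h \<Rightarrow> ('h \<Rightarrow> 'r) \<Rightarrow> ('h \<times> ('h \<Rightarrow> 'r) \<Rightarrow> 'r) set" where
  "heisenberg_product h \<theta> h' \<theta>' =
    lift_bilinear R HD (\<lambda>a b. lift_bilinear R HD (\<lambda>\<phi> \<psi>.
      pairing b \<phi> \<odot>\<^bsub>HD\<^esub> pure_tensor R H D (h \<otimes>\<^bsub>H\<^esub> a) (\<psi> \<otimes>\<^bsub>D\<^esub> \<theta>')) (comult D \<theta>)) (comult H h')"

lemma heisenberg_product_bilinear:
  "h \<in> carrier H \<Longrightarrow> \<theta> \<in> carrier D \<Longrightarrow>
    (\<lambda>h' \<theta>'. heisenberg_product h \<theta> h' \<theta>') \<in> bilinear_maps R H D HD"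
  "h' \<in> carrier H \<Longrightarrow> \<theta>' \<in> carrier D \<Longrightarrow>
    (\<lambda>h \<theta>. heisenberg_product h \<theta> h' \<theta>') \<in> bilinear_maps R H D HD"
  unfolding heisenberg_product_def
  by (assumption | rule lin_rules)+

lemma heisenberg_mult:
  "s \<otimes>\<^bsub>heisenberg R H\<^esub> t = lift_bilinear R HD (\<lambda>h \<theta>.
    lift_bilinear R HD (\<lambda>h' \<theta>'. heisenberg_product h \<theta> h' \<theta>') t) s"
  by (simp add: heisenberg_def Let_def heisenberg_product_def)

text \<open>
  \<open>heisenberg_product\<close> is linear in each of its four arguments, so the product of the Heisenberg algebra
  is its bilinear extension.
\<close>

lemma heisenberg_mult_HD:
  "mult (heisenberg R H) \<in> bilinear_maps R HD HD HD"
  "h \<in> carrier H \<Longrightarrow> \<theta> \<in> carrier D \<Longrightarrow> h' \<in> carrier H \<Longrightarrow> \<theta>' \<in> carrier D \<Longrightarrow>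
    pure_tensor R H D h \<theta> \<otimes>\<^bsub>heisenberg R H\<^esub> pure_tensor R H D h' \<theta>' = heisenberg_product h \<theta> h' \<theta>'"
proof -
  note hp = heisenberg_product_bilinear
  note rules = modules bilinearI linear_id linear_lift linear_lift_maps hp
    linear_comp[OF bilinear_left[OF hp(1)]] linear_comp[OF bilinear_right[OF hp(1)]]
    linear_comp[OF bilinear_left[OF hp(2)]] linear_comp[OF bilinear_right[OF hp(2)]]
  have outer: "(\<lambda>h \<theta>. lift_bilinear R HD (\<lambda>h' \<theta>'. heisenberg_product h \<theta> h' \<theta>') t) \<in> bilinear_maps R H D HD"
    if "t \<in> carrier HD" for t
    using that by - (assumption | rule rules)+
  have "(\<lambda>s t. s \<otimes>\<^bsub>heisenberg R H\<^esub> t) \<in> bilinear_maps R HD HD HD"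
    unfolding heisenberg_mult by (assumption | rule rules)+
  then show "mult (heisenberg R H) \<in> bilinear_maps R HD HD HD" by simp
  show "pure_tensor R H D h \<theta> \<otimes>\<^bsub>heisenberg R H\<^esub> pure_tensor R H D h' \<theta>' = heisenberg_product h \<theta> h' \<theta>'"
    if "h \<in> carrier H" "\<theta> \<in> carrier D" "h' \<in> carrier H" "\<theta>' \<in> carrier D"
    using that bilinear_closed[OF pure_tensor_bilinear[OF H_module D_module]]
    by (simp add: heisenberg_mult lift_bilinear_pure[OF H_module D_module HD_module outer]
        lift_bilinear_pure[OF H_module D_module HD_module hp(1)])
qed

text \<open>
  In this order nothing has to be exchanged: \<open>1\<close> and \<open>\<epsilon>\<close> are group-like and \<open>p(1, \<epsilon>) = 1\<close>.
\<close>

lemma heisenberg_mult_H_D: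
  assumes h: "h \<in> carrier H" and \<theta>: "\<theta> \<in> carrier D"
  shows "pure_tensor R H D h \<one>\<^bsub>D\<^esub> \<otimes>\<^bsub>heisenberg R H\<^esub> pure_tensor R H D \<one>\<^bsub>H\<^esub> \<theta> = pure_tensor R H D h \<theta>"
proof -
  interpret HD: module R HD by (rule HD_module)
  have inner: "(\<lambda>\<phi> \<psi>. pairing b \<phi> \<odot>\<^bsub>HD\<^esub> pure_tensor R H D (h \<otimes>\<^bsub>H\<^esub> a) (\<psi> \<otimes>\<^bsub>D\<^esub> \<theta>)) \<in> bilinear_maps R D D HD"
    if "a \<in> carrier H" "b \<in> carrier H" for a b
    using that h \<theta> by - (assumption | rule lin_rules)+
  have outer: "(\<lambda>a b. lift_bilinear R HD (\<lambda>\<phi> \<psi>.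
      pairing b \<phi> \<odot>\<^bsub>HD\<^esub> pure_tensor R H D (h \<otimes>\<^bsub>H\<^esub> a) (\<psi> \<otimes>\<^bsub>D\<^esub> \<theta>)) t) \<in> bilinear_maps R H H HD"
    if "t \<in> carrier (tensor_space R D D)" for t
    using that h \<theta> by - (assumption | rule lin_rules)+
  have "pure_tensor R H D h \<one>\<^bsub>D\<^esub> \<otimes>\<^bsub>heisenberg R H\<^esub> pure_tensor R H D \<one>\<^bsub>H\<^esub> \<theta>
      = heisenberg_product h \<one>\<^bsub>D\<^esub> \<one>\<^bsub>H\<^esub> \<theta>"
    using h \<theta> by (simp add: heisenberg_mult_HD H_one D_closed)
  also have "\<dots> = pairing \<one>\<^bsub>H\<^esub> \<one>\<^bsub>D\<^esub> \<odot>\<^bsub>HD\<^esub> pure_tensor R H D (h \<otimes>\<^bsub>H\<^esub> \<one>\<^bsub>H\<^esub>) (\<one>\<^bsub>D\<^esub> \<otimes>\<^bsub>D\<^esub> \<theta>)"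
    unfolding heisenberg_product_def comult_one dual_comult_one
    using bilinear_closed[OF pure_tensor_bilinear[OF D_module D_module]]
    by (simp add: lift_bilinear_pure[OF H_module H_module HD_module outer]
        lift_bilinear_pure[OF D_module D_module HD_module inner] H_one D_closed)
  also have "\<dots> = pure_tensor R H D h \<theta>"
    using h \<theta> bilinear_closed[OF pure_tensor_bilinear[OF H_module D_module]]
    by (simp add: pairing_def D_one H_one counit_one H_r_one dual_l_one)
  finally show ?thesis .
qed

text \<open>\<open>(1 # \<theta>) (h # 1) = h\<^sub>(\<^sub>1\<^sub>) p(h\<^sub>(\<^sub>2\<^sub>), \<theta>\<^sub>(\<^sub>1\<^sub>)) # \<theta>\<^sub>(\<^sub>2\<^sub>)\<close>\<close>

definition exchange :: "('h \<Rightarrow> 'r) \<Rightarrow> 'h \<Rightarrow> ('h \<times> ('h \<Rightarrow> 'r) \<Rightarrow> 'r) set" where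
  "exchange \<theta> h = lift_bilinear R HD (\<lambda>a b. lift_bilinear R HD (\<lambda>\<phi> \<psi>.
      pairing b \<phi> \<odot>\<^bsub>HD\<^esub> pure_tensor R H D a \<psi>) (comult D \<theta>)) (comult H h)"

lemma exchange_bilinear: "(\<lambda>\<theta> h. exchange \<theta> h) \<in> bilinear_maps R D H HD"
  unfolding exchange_def by (assumption | rule lin_rules)+

lemma heisenberg_mult_D_H:
  assumes h: "h \<in> carrier H" and \<theta>: "\<theta> \<in> carrier D"
  shows "pure_tensor R H D \<one>\<^bsub>H\<^esub> \<theta> \<otimes>\<^bsub>heisenberg R H\<^esub> pure_tensor R H D h \<one>\<^bsub>D\<^esub> = exchange \<theta> h"
proof -
  have "heisenberg_product \<one>\<^bsub>H\<^esub> \<theta> h \<one>\<^bsub>D\<^esub> = exchange \<theta> h"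
    unfolding heisenberg_product_def exchange_def
  proof (rule lift_bilinear_cong[OF H_module H_module HD_module linear_closed[OF comult_linear h]])
    show "(\<lambda>a b. lift_bilinear R HD (\<lambda>\<phi> \<psi>. pairing b \<phi> \<odot>\<^bsub>HD\<^esub>
        pure_tensor R H D (\<one>\<^bsub>H\<^esub> \<otimes>\<^bsub>H\<^esub> a) (\<psi> \<otimes>\<^bsub>D\<^esub> \<one>\<^bsub>D\<^esub>)) (comult D \<theta>)) \<in> bilinear_maps R H H HD"
      using \<theta> by - (assumption | rule lin_rules)+
    fix a b assume ab: "a \<in> carrier H" "b \<in> carrier H"
    show "lift_bilinear R HD (\<lambda>\<phi> \<psi>. pairing b \<phi> \<odot>\<^bsub>HD\<^esub>
        pure_tensor R H D (\<one>\<^bsub>H\<^esub> \<otimes>\<^bsub>H\<^esub> a) (\<psi> \<otimes>\<^bsub>D\<^esub> \<one>\<^bsub>D\<^esub>)) (comult D \<theta>) =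
      lift_bilinear R HD (\<lambda>\<phi> \<psi>. pairing b \<phi> \<odot>\<^bsub>HD\<^esub> pure_tensor R H D a \<psi>) (comult D \<theta>)"
    proof (rule lift_bilinear_cong[OF D_module D_module HD_module linear_closed[OF dual_comult_linear \<theta>]])
      show "(\<lambda>\<phi> \<psi>. pairing b \<phi> \<odot>\<^bsub>HD\<^esub> pure_tensor R H D (\<one>\<^bsub>H\<^esub> \<otimes>\<^bsub>H\<^esub> a) (\<psi> \<otimes>\<^bsub>D\<^esub> \<one>\<^bsub>D\<^esub>))
          \<in> bilinear_maps R D D HD"
        using ab by - (assumption | rule lin_rules)+
    qed (simp add: ab H_l_one dual_r_one)
  qed
  then show ?thesis
    using h \<theta> by (simp add: heisenberg_mult_HD H_one D_closed)
qed

text \<open>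
  The map \<open>\<epsilon> \<otimes> p(1, \<cdot>)\<close>, whose second factor is the counit of the dual.
\<close>

definition counits :: "('h \<times> ('h \<Rightarrow> 'r) \<Rightarrow> 'r) set \<Rightarrow> 'r" where
  "counits = lift_bilinear R k (\<lambda>h \<theta>. counit H h \<otimes> pairing \<one>\<^bsub>H\<^esub> \<theta>)"

lemma counits_bilinear: "(\<lambda>h \<theta>. counit H h \<otimes> pairing \<one>\<^bsub>H\<^esub> \<theta>) \<in> bilinear_maps R H D k"
  by (assumption | rule lin_rules)+

lemma counits_linear: "counits \<in> linear_maps R HD k"
  unfolding counits_def by (rule lift_bilinear_linear[OF H_module D_module ground_module counits_bilinear])

lemma counits_pure: "h \<in> carrier H \<Longrightarrow> \<theta> \<in> carrier D
    \<Longrightarrow> counits (pure_tensor R H D h \<theta>) = counit H h \<otimes> pairing \<one>\<^bsub>H\<^esub> \<theta>"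
  unfolding counits_def by (rule lift_bilinear_pure[OF H_module D_module ground_module counits_bilinear])

lemma pairing_closed: "h \<in> carrier H \<Longrightarrow> \<theta> \<in> carrier D \<Longrightarrow> pairing h \<theta> \<in> carrier R"
  by (simp add: pairing_def D_value)

text \<open>
  In \<open>\<epsilon>(h\<^sub>(\<^sub>1\<^sub>)) p(h\<^sub>(\<^sub>2\<^sub>), \<theta>\<^sub>(\<^sub>1\<^sub>)) p(1, \<theta>\<^sub>(\<^sub>2\<^sub>))\<close> the two pairings combine to \<open>p(h\<^sub>(\<^sub>2\<^sub>) 1, \<theta>)\<close>, and the counit law of \<open>H\<close>
  removes the rest.
\<close>

lemma counits_exchange:
  assumes h: "h \<in> carrier H" and \<theta>: "\<theta> \<in> carrier D"
  shows "counits (exchange \<theta> h) = pairing h \<theta>"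
proof -
  note \<Delta>h = linear_closed[OF comult_linear h] and \<Delta>\<theta> = linear_closed[OF dual_comult_linear \<theta>]
  have bil: "(\<lambda>\<phi> \<psi>. pairing b \<phi> \<odot>\<^bsub>HD\<^esub> pure_tensor R H D a \<psi>) \<in> bilinear_maps R D D HD"
    if "a \<in> carrier H" "b \<in> carrier H" for a b
    using that by - (assumption | rule lin_rules)+
  have inner: "counits (lift_bilinear R HD (\<lambda>\<phi> \<psi>.
      pairing b \<phi> \<odot>\<^bsub>HD\<^esub> pure_tensor R H D a \<psi>) (comult D \<theta>)) = pairing (counit H a \<odot>\<^bsub>H\<^esub> b) \<theta>"
    if a: "a \<in> carrier H" and b: "b \<in> carrier H" for a b
  proof -
    have "counits (lift_bilinear R HD (\<lambda>\<phi> \<psi>. pairing b \<phi> \<odot>\<^bsub>HD\<^esub> pure_tensor R H D a \<psi>) (comult D \<theta>))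
        = lift_bilinear R k (\<lambda>\<phi> \<psi>. counits (pairing b \<phi> \<odot>\<^bsub>HD\<^esub> pure_tensor R H D a \<psi>)) (comult D \<theta>)"
      by (rule linear_lift_commute[OF D_module D_module HD_module ground_module counits_linear bil[OF a b] \<Delta>\<theta>])
    also have "\<dots> = lift_bilinear R k (\<lambda>\<phi> \<psi>. counit H a \<otimes> (pairing b \<phi> \<otimes> pairing \<one>\<^bsub>H\<^esub> \<psi>)) (comult D \<theta>)"
    proof (rule lift_bilinear_cong[OF D_module D_module ground_module \<Delta>\<theta>])
      show "(\<lambda>\<phi> \<psi>. counits (pairing b \<phi> \<odot>\<^bsub>HD\<^esub> pure_tensor R H D a \<psi>)) \<in> bilinear_maps R D D k"
        by (intro bilinearI linear_comp[OF counits_linear] bilinear_left[OF bil[OF a b]]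
            bilinear_right[OF bil[OF a b]])
      fix \<phi> \<psi> assume "\<phi> \<in> carrier D" "\<psi> \<in> carrier D"
      then show "counits (pairing b \<phi> \<odot>\<^bsub>HD\<^esub> pure_tensor R H D a \<psi>)
          = counit H a \<otimes> (pairing b \<phi> \<otimes> pairing \<one>\<^bsub>H\<^esub> \<psi>)"
        using a b linear_smult[OF counits_linear pairing_closed
            bilinear_closed[OF pure_tensor_bilinear[OF H_module D_module]]]
        by (simp add: counits_pure pairing_closed counit_closed H_one)
          (simp add: ground_algebra_def m_lcomm pairing_closed counit_closed H_one)
    qed
    also have "\<dots> = counit H a \<otimes> pairing2 b \<one>\<^bsub>H\<^esub> (comult D \<theta>)"
      unfolding pairing2_def
      by (rule linear_lift_commute[OF D_module D_module ground_module ground_module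
            bilinear_right[OF ground_mult_bilinear] pairing_dual_bilinear \<Delta>\<theta>, symmetric])
        (use a b in \<open>simp_all add: linear_closed[OF counit_linear] H_one\<close>)
    also have "\<dots> = pairing (counit H a \<odot>\<^bsub>H\<^esub> b) \<theta>"
      using a b \<theta> by (simp add: dual_comult_spec H_one H_r_one pairing_smult counit_closed)
    finally show ?thesis .
  qed
  have bil2: "(\<lambda>a b. lift_bilinear R HD (\<lambda>\<phi> \<psi>.
      pairing b \<phi> \<odot>\<^bsub>HD\<^esub> pure_tensor R H D a \<psi>) (comult D \<theta>)) \<in> bilinear_maps R H H HD"
    using \<theta> by - (assumption | rule lin_rules)+
  have "counits (exchange \<theta> h) = lift_bilinear R k (\<lambda>a b. counits (lift_bilinear R HD (\<lambda>\<phi> \<psi>.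
      pairing b \<phi> \<odot>\<^bsub>HD\<^esub> pure_tensor R H D a \<psi>) (comult D \<theta>))) (comult H h)"
    unfolding exchange_def
    by (rule linear_lift_commute[OF H_module H_module HD_module ground_module counits_linear bil2 \<Delta>h])
  also have "\<dots> = lift_bilinear R k (\<lambda>a b. pairing (counit H a \<odot>\<^bsub>H\<^esub> b) \<theta>) (comult H h)"
    by (rule lift_bilinear_cong[OF H_module H_module ground_module \<Delta>h])
      (auto intro!: inner bilinearI linear_comp[OF counits_linear] bilinear_left[OF bil2] bilinear_right[OF bil2])
  also have "\<dots> = pairing (lift_bilinear R H (\<lambda>a b. counit H a \<odot>\<^bsub>H\<^esub> b) (comult H h)) \<theta>"
    by (rule linear_lift_commute[OF H_module H_module H_module ground_module
          bilinear_left[OF pairing_bilinear \<theta>] counit_smult_bilinear(1) \<Delta>h, symmetric])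
  finally show ?thesis by (simp add: counit_left[OF h])
qed

end

section \<open>The two sides of the Heisenberg condition\<close>

locale coacted_algebra = finite_hopf R H
  for R :: "('r, 'p) ring_scheme" (structure) and H :: "('r, 'h, 'm) hopf_scheme" +
  fixes X :: "('r, 'x, 'n) module_scheme"
    and \<alpha> :: "'x \<Rightarrow> ('h \<times> 'x \<Rightarrow> 'r) set"
    and \<beta> :: "'x \<Rightarrow> ('x \<times> ('h \<Rightarrow> 'r) \<Rightarrow> 'r) set"
  assumes X_algebra: "unital_algebra R X"
    and left_coaction: "left_coaction R H X \<alpha>"
    and right_coaction: "right_coaction R (dual_hopf R H) X \<beta>"
begin

abbreviation "HX \<equiv> tensor_space R H X"
abbreviation "XD \<equiv> tensor_space R X D"
abbreviation "E \<equiv> tensor_space R HD X"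

lemma X_module: "module R X"
  using X_algebra by (rule unital_algebra.axioms)

lemmas X_mult_bilinear = unital_algebra_mult_bilinear[OF X_algebra]

lemma \<alpha>_linear: "\<alpha> \<in> linear_maps R X HX"
  using left_coaction by (auto simp: left_coaction_def algebra_homs_def tensor_algebra_underlying)

lemma \<beta>_linear: "\<beta> \<in> linear_maps R X XD"
  using right_coaction by (auto simp: right_coaction_def algebra_homs_def tensor_algebra_underlying)

lemma tensor_map_tensor_algebra:
  "tensor_map R (tensor_algebra R A B) C = tensor_map R (tensor_space R A B) C"
  "tensor_map R C (tensor_algebra R A B) = tensor_map R C (tensor_space R A B)"
  by (simp_all add: fun_eq_iff tensor_map_def tensor_algebra_underlying)

lemma \<alpha>_coassoc: "x \<in> carrier X \<Longrightarrow>
    tensor_map R H HX (\<lambda>y. y) \<alpha> (\<alpha> x) =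
    tensor_assoc R H H X (tensor_map R (tensor_space R H H) X (comult H) (\<lambda>y. y) (\<alpha> x))"
  using left_coaction by (simp add: left_coaction_def tensor_map_tensor_algebra)

lemma \<beta>_coassoc: "x \<in> carrier X \<Longrightarrow>
    tensor_assoc R X D D (tensor_map R XD D \<beta> (\<lambda>y. y) (\<beta> x)) =
    tensor_map R X (tensor_space R D D) (\<lambda>y. y) (comult D) (\<beta> x)"
  using right_coaction by (simp add: right_coaction_def tensor_map_tensor_algebra)

lemma \<alpha>_counit: "x \<in> carrier X \<Longrightarrow> lift_bilinear R X (\<lambda>h y. counit H h \<odot>\<^bsub>X\<^esub> y) (\<alpha> x) = x"
  using left_coaction by (simp add: left_coaction_def)

lemma \<beta>_counit:
  assumes "x \<in> carrier X"
  shows "lift_bilinear R X (\<lambda>y \<theta>. pairing \<one>\<^bsub>H\<^esub> \<theta> \<odot>\<^bsub>X\<^esub> y) (\<beta> x) = x"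
proof -
  have "counit D = pairing \<one>\<^bsub>H\<^esub>" by (simp add: fun_eq_iff dual_hopf_def Let_def)
  then show ?thesis using assms right_coaction by (simp add: right_coaction_def)
qed

lemma HX_module: "module R HX" and XD_module: "module R XD" and E_module: "module R E"
  by (intro modules X_module)+

lemmas X_rules = linear_bilinear_left[OF X_mult_bilinear] linear_bilinear_right[OF X_mult_bilinear]
  linear_bilinear_left[OF exchange_bilinear] linear_bilinear_right[OF exchange_bilinear]
  bilinear_closed[OF X_mult_bilinear] bilinear_closed[OF exchange_bilinear] X_module lin_rules

text \<open>
  The two sides of the Heisenberg condition as functions of \<open>\<alpha>(x)\<close> and \<open>\<beta>(y)\<close>:
  \<open>(h \<otimes> x, y \<otimes> \<theta>) \<mapsto> (h # \<theta>) \<otimes> x y\<close> and \<open>(h \<otimes> x, y \<otimes> \<theta>) \<mapsto> (1 # \<theta>) (h # 1) \<otimes> y x\<close>.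
\<close>

definition straight where
  "straight s t = lift_bilinear R E (\<lambda>h x. lift_bilinear R E (\<lambda>y \<theta>.
    pure_tensor R HD X (pure_tensor R H D h \<theta>) (x \<otimes>\<^bsub>X\<^esub> y)) t) s"

definition crossed where
  "crossed s t = lift_bilinear R E (\<lambda>h x. lift_bilinear R E (\<lambda>y \<theta>.
    pure_tensor R HD X (exchange \<theta> h) (y \<otimes>\<^bsub>X\<^esub> x)) t) s"

lemma straight_bilinear: "(\<lambda>s t. straight s t) \<in> bilinear_maps R HX XD E"
  unfolding straight_def by (assumption | rule X_rules)+

lemma crossed_bilinear: "(\<lambda>s t. crossed s t) \<in> bilinear_maps R HX XD E"
  unfolding crossed_def by (assumption | rule X_rules)+

lemma lift_lift_pure:
  assumes M: "module R M" and N: "module R N" and M': "module R M'" and N': "module R N'"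
    and P: "module R P"
    and "m \<in> carrier M" "n \<in> carrier N" "m' \<in> carrier M'" "n' \<in> carrier N'"
    and "\<And>t. t \<in> carrier (tensor_space R M' N') \<Longrightarrow>
      (\<lambda>m n. lift_bilinear R P (\<lambda>m' n'. f m n m' n') t) \<in> bilinear_maps R M N P"
    and "(\<lambda>m' n'. f m n m' n') \<in> bilinear_maps R M' N' P"
  shows "lift_bilinear R P (\<lambda>m n. lift_bilinear R P (\<lambda>m' n'. f m n m' n') (pure_tensor R M' N' m' n'))
    (pure_tensor R M N m n) = f m n m' n'"
proof -
  have "pure_tensor R M' N' m' n' \<in> carrier (tensor_space R M' N')"
    by (rule bilinear_closed[OF pure_tensor_bilinear[OF M' N'] assms(8,9)])
  then show ?thesis
    using assms(6-11) by (simp add: lift_bilinear_pure[OF M N P] lift_bilinear_pure[OF M' N' P])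
qed

lemma straight_pure:
  "h \<in> carrier H \<Longrightarrow> x \<in> carrier X \<Longrightarrow> y \<in> carrier X \<Longrightarrow> \<theta> \<in> carrier D \<Longrightarrow>
    straight (pure_tensor R H X h x) (pure_tensor R X D y \<theta>) =
    pure_tensor R HD X (pure_tensor R H D h \<theta>) (x \<otimes>\<^bsub>X\<^esub> y)"
  unfolding straight_def
  by (rule lift_lift_pure[OF H_module X_module X_module D_module E_module]; (assumption | rule X_rules)+)

lemma crossed_pure:
  "h \<in> carrier H \<Longrightarrow> x \<in> carrier X \<Longrightarrow> y \<in> carrier X \<Longrightarrow> \<theta> \<in> carrier D \<Longrightarrow>
    crossed (pure_tensor R H X h x) (pure_tensor R X D y \<theta>) =
    pure_tensor R HD X (exchange \<theta> h) (y \<otimes>\<^bsub>X\<^esub> x)"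
  unfolding crossed_def
  by (rule lift_lift_pure[OF H_module X_module X_module D_module E_module]; (assumption | rule X_rules)+)

abbreviation "\<iota>1 \<equiv> heisenberg_iota1 R H X"
abbreviation "\<iota>2 \<equiv> heisenberg_iota2 R H X"
abbreviation "HeisX \<equiv> tensor_algebra R (heisenberg R H) X"

lemma heisenberg_module: "module R (heisenberg R H)"
  by (rule module_same_structure[OF HD_module]) (simp_all add: heisenberg_sel)

lemma heisenberg_mult_bilinear:
  "mult (heisenberg R H) \<in> bilinear_maps R (heisenberg R H) (heisenberg R H) (heisenberg R H)"
  using heisenberg_mult_HD(1) by (simp add: bilinear_maps_def linear_maps_def heisenberg_sel)

lemma HeisX_sel: "carrier HeisX = carrier E" "add HeisX = add E" "zero HeisX = zero E" "smult HeisX = smult E"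
  by (simp_all add: tensor_algebra_sel heisenberg_underlying)

lemma HeisX_module: "module R HeisX"
  by (rule module_same_structure[OF E_module HeisX_sel])

lemma HeisX_underlying:
  "linear_maps R M HeisX = linear_maps R M E" "lift_bilinear R HeisX = lift_bilinear R E"
  by (simp_all add: tensor_algebra_underlying heisenberg_underlying)

lemma HeisX_mult_bilinear: "mult HeisX \<in> bilinear_maps R E E E"
  using tensor_mult_bilinear(1)[OF heisenberg_module X_module heisenberg_mult_bilinear X_mult_bilinear]
  by (simp add: heisenberg_underlying)

lemma HeisX_mult_pure:
  "u \<in> carrier HD \<Longrightarrow> x \<in> carrier X \<Longrightarrow> v \<in> carrier HD \<Longrightarrow> y \<in> carrier X \<Longrightarrow>
    pure_tensor R HD X u x \<otimes>\<^bsub>HeisX\<^esub> pure_tensor R HD X v y =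
    pure_tensor R HD X (u \<otimes>\<^bsub>heisenberg R H\<^esub> v) (x \<otimes>\<^bsub>X\<^esub> y)"
  using tensor_mult_bilinear(2)[OF heisenberg_module X_module heisenberg_mult_bilinear X_mult_bilinear]
  by (simp add: heisenberg_underlying heisenberg_sel)

lemma \<iota>_bilinear:
  "(\<lambda>h x. pure_tensor R HD X (pure_tensor R H D h \<one>\<^bsub>D\<^esub>) x) \<in> bilinear_maps R H X E"
  "(\<lambda>\<theta> x. pure_tensor R HD X (pure_tensor R H D \<one>\<^bsub>H\<^esub> \<theta>) x) \<in> bilinear_maps R D X E"
  by (assumption | rule X_rules)+

lemma \<iota>1_eq: "\<iota>1 = lift_bilinear R E (\<lambda>h x. pure_tensor R HD X (pure_tensor R H D h \<one>\<^bsub>D\<^esub>) x)"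
  and \<iota>2_eq: "\<iota>2 = lift_bilinear R E (\<lambda>\<theta> x. pure_tensor R HD X (pure_tensor R H D \<one>\<^bsub>H\<^esub> \<theta>) x)"
  by (simp_all add: heisenberg_iota1_def heisenberg_iota2_def Let_def HeisX_underlying heisenberg_underlying)

lemma \<iota>_linear: "\<iota>1 \<in> linear_maps R HX E" "\<iota>2 \<in> linear_maps R (tensor_space R D X) E"
  unfolding \<iota>1_eq \<iota>2_eq
  by (rule lift_bilinear_linear[OF H_module X_module E_module \<iota>_bilinear(1)]
      lift_bilinear_linear[OF D_module X_module E_module \<iota>_bilinear(2)])+

lemma \<iota>_pure:
  "h \<in> carrier H \<Longrightarrow> x \<in> carrier X \<Longrightarrow>
    \<iota>1 (pure_tensor R H X h x) = pure_tensor R HD X (pure_tensor R H D h \<one>\<^bsub>D\<^esub>) x"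
  "\<theta> \<in> carrier D \<Longrightarrow> x \<in> carrier X \<Longrightarrow>
    \<iota>2 (pure_tensor R D X \<theta> x) = pure_tensor R HD X (pure_tensor R H D \<one>\<^bsub>H\<^esub> \<theta>) x"
  unfolding \<iota>1_eq \<iota>2_eq
  by (rule lift_bilinear_pure[OF H_module X_module E_module \<iota>_bilinear(1)]
      lift_bilinear_pure[OF D_module X_module E_module \<iota>_bilinear(2)]; assumption)+

text \<open>
  On pure tensors these are the two products of generators in the Heisenberg algebra.
\<close>

lemma heisenberg_sides:
  assumes s: "s \<in> carrier HX" and t: "t \<in> carrier XD"
  shows "\<iota>1 s \<otimes>\<^bsub>HeisX\<^esub> \<iota>2 (tensor_flip R X D t) = straight s t"
    and "\<iota>2 (tensor_flip R X D t) \<otimes>\<^bsub>HeisX\<^esub> \<iota>1 s = crossed s t"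
proof -
  note flip = tensor_flip_linear[OF X_module D_module]
  note rules = bilinearI linear_bilinear_left[OF HeisX_mult_bilinear] linear_bilinear_right[OF HeisX_mult_bilinear]
    \<iota>_linear linear_comp[OF \<iota>_linear(2)] flip linear_closed[OF \<iota>_linear(1)] linear_closed[OF \<iota>_linear(2)]
    linear_closed[OF flip]
  note pure = bilinear_closed[OF pure_tensor_bilinear[OF H_module D_module]] H_one D_closed
  show "\<iota>1 s \<otimes>\<^bsub>HeisX\<^esub> \<iota>2 (tensor_flip R X D t) = straight s t"
    by (rule tensor_bilinear_ext[OF H_module X_module X_module D_module E_module _ straight_bilinear _ s t],
        (assumption | rule rules)+)
      (simp add: tensor_flip_pure X_module D_module \<iota>_pure straight_pure HeisX_mult_pure pure heisenberg_mult_H_D)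
  show "\<iota>2 (tensor_flip R X D t) \<otimes>\<^bsub>HeisX\<^esub> \<iota>1 s = crossed s t"
    by (rule tensor_bilinear_ext[OF H_module X_module X_module D_module E_module _ crossed_bilinear _ s t],
        (assumption | rule rules)+)
      (simp add: tensor_flip_pure X_module D_module \<iota>_pure crossed_pure HeisX_mult_pure pure heisenberg_mult_D_H)
qed

lemma braided_commutative_iff:
  "braided_commutative R H X \<alpha> \<beta> \<longleftrightarrow>
    (\<forall>x\<in>carrier X. \<forall>y\<in>carrier X. straight (\<alpha> x) (\<beta> y) = crossed (\<alpha> x) (\<beta> y))"
proof -
  have DX: "module R (tensor_space R D X)" by (intro modules X_module)
  have mult: "mult HeisX \<in> bilinear_maps R HeisX HeisX HeisX"
    using HeisX_mult_bilinear by (simp add: bilinear_maps_def linear_maps_def HeisX_sel)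
  have \<iota>: "\<iota>1 \<in> linear_maps R HX HeisX" "\<iota>2 \<in> linear_maps R (tensor_space R D X) HeisX"
    using \<iota>_linear by (simp_all add: HeisX_underlying)
  note prod = mult_map_tensor_map[OF HX_module DX HeisX_module \<iota>(1,2) mult]
    mult_map_tensor_map[OF DX HX_module HeisX_module \<iota>(2,1) mult]
  show ?thesis
    using linear_closed[OF \<alpha>_linear] linear_closed[OF \<beta>_linear]
      linear_closed[OF tensor_flip_linear[OF X_module D_module]]
    by (simp add: braided_commutative_def Let_def tensor_algebra_underlying prod heisenberg_sides)
qed

section \<open>From the Heisenberg condition to the action\<close>

text \<open>
  With \<open>act\<close> and \<open>braided_mult\<close>, \<open>h \<rhd> y\<close> becomes a function of \<open>\<beta>(y)\<close>, and \<open>(x\<^sub>[\<^sub>-\<^sub>1\<^sub>] \<rhd> y) x\<^sub>[\<^sub>0\<^sub>]\<close> a function of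
  \<open>\<alpha>(x)\<close> and \<open>\<beta>(y)\<close>. Both are then defined on all tensors, where arguments by pure tensors apply.
\<close>

definition act where
  "act h t = lift_bilinear R X (\<lambda>y \<theta>. pairing h \<theta> \<odot>\<^bsub>X\<^esub> y) t"

definition braided_mult where
  "braided_mult s t = lift_bilinear R X (\<lambda>h x. act h t \<otimes>\<^bsub>X\<^esub> x) s"

lemma act_bilinear: "(\<lambda>h t. act h t) \<in> bilinear_maps R H XD X"
  unfolding act_def by (assumption | rule X_rules)+

lemma act_pure: "h \<in> carrier H \<Longrightarrow> y \<in> carrier X \<Longrightarrow> \<theta> \<in> carrier D \<Longrightarrow>
    act h (pure_tensor R X D y \<theta>) = pairing h \<theta> \<odot>\<^bsub>X\<^esub> y"
  unfolding act_def
  by (rule lift_bilinear_pure[OF X_module D_module X_module]; (assumption | rule X_rules)+)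

lemmas act_rules = linear_bilinear_left[OF act_bilinear] linear_bilinear_right[OF act_bilinear]
  bilinear_closed[OF act_bilinear] X_rules

lemma braided_mult_bilinear: "(\<lambda>s t. braided_mult s t) \<in> bilinear_maps R HX XD X"
  unfolding braided_mult_def by (assumption | rule act_rules)+

lemma braided_mult_pure: "h \<in> carrier H \<Longrightarrow> x \<in> carrier X \<Longrightarrow> t \<in> carrier XD \<Longrightarrow>
    braided_mult (pure_tensor R H X h x) t = act h t \<otimes>\<^bsub>X\<^esub> x"
  unfolding braided_mult_def
  by (rule lift_bilinear_pure[OF H_module X_module X_module]; (assumption | rule act_rules)+)

lemma left_left_iff:
  "left_left_braided_commutative R X (induced_action R X \<beta>) \<alpha> \<longleftrightarrow>
    (\<forall>x\<in>carrier X. \<forall>y\<in>carrier X. x \<otimes>\<^bsub>X\<^esub> y = braided_mult (\<alpha> x) (\<beta> y))"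
  by (simp add: left_left_braided_commutative_def induced_action_def braided_mult_def act_def)

definition counits_X where
  "counits_X = lift_bilinear R X (\<lambda>u x. counits u \<odot>\<^bsub>X\<^esub> x)"

lemma counits_X_linear: "counits_X \<in> linear_maps R E X"
  and counits_X_pure: "u \<in> carrier HD \<Longrightarrow> x \<in> carrier X \<Longrightarrow>
    counits_X (pure_tensor R HD X u x) = counits u \<odot>\<^bsub>X\<^esub> x"
proof -
  have bil: "(\<lambda>u x. counits u \<odot>\<^bsub>X\<^esub> x) \<in> bilinear_maps R HD X X"
    by (assumption | rule X_rules counits_linear linear_closed[OF counits_linear])+
  show "counits_X \<in> linear_maps R E X"
    unfolding counits_X_def by (rule lift_bilinear_linear[OF HD_module X_module X_module bil])
  show "counits_X (pure_tensor R HD X u x) = counits u \<odot>\<^bsub>X\<^esub> x"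
    if "u \<in> carrier HD" "x \<in> carrier X"
    unfolding counits_X_def by (rule lift_bilinear_pure[OF HD_module X_module X_module bil that])
qed

text \<open>
  By \<open>counits_exchange\<close>, \<open>(h \<otimes> x, y \<otimes> \<theta>)\<close> is sent to \<open>p(h, \<theta>) y x\<close> on both sides.
\<close>

lemma counits_crossed:
  assumes s: "s \<in> carrier HX" and t: "t \<in> carrier XD"
  shows "counits_X (crossed s t) = braided_mult s t"
proof (rule tensor_bilinear_ext[OF H_module X_module X_module D_module X_module _ braided_mult_bilinear _ s t])
  show "(\<lambda>s t. counits_X (crossed s t)) \<in> bilinear_maps R HX XD X"
    by (intro bilinearI linear_comp[OF counits_X_linear] bilinear_left[OF crossed_bilinear]
        bilinear_right[OF crossed_bilinear])
  fix h x y \<theta> assume *: "h \<in> carrier H" "x \<in> carrier X" "y \<in> carrier X" "\<theta> \<in> carrier D"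
  then show "counits_X (crossed (pure_tensor R H X h x) (pure_tensor R X D y \<theta>)) =
      braided_mult (pure_tensor R H X h x) (pure_tensor R X D y \<theta>)"
    using bilinear_closed[OF exchange_bilinear] bilinear_closed[OF X_mult_bilinear]
      bilinear_closed[OF pure_tensor_bilinear[OF X_module D_module]]
    by (simp add: crossed_pure counits_X_pure counits_exchange braided_mult_pure act_pure
        linear_smult[OF bilinear_left[OF X_mult_bilinear]] pairing_closed)
qed

lemma counits_straight:
  assumes s: "s \<in> carrier HX" and t: "t \<in> carrier XD"
  shows "counits_X (straight s t) = lift_bilinear R X (\<lambda>h y. counit H h \<odot>\<^bsub>X\<^esub> y) s \<otimes>\<^bsub>X\<^esub> act \<one>\<^bsub>H\<^esub> t"
proof (rule tensor_bilinear_ext[OF H_module X_module X_module D_module X_module _ _ _ s t])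
  interpret X: module R X by (rule X_module)
  show "(\<lambda>s t. counits_X (straight s t)) \<in> bilinear_maps R HX XD X"
    by (intro bilinearI linear_comp[OF counits_X_linear] bilinear_left[OF straight_bilinear]
        bilinear_right[OF straight_bilinear])
  show "(\<lambda>s t. lift_bilinear R X (\<lambda>h y. counit H h \<odot>\<^bsub>X\<^esub> y) s \<otimes>\<^bsub>X\<^esub> act \<one>\<^bsub>H\<^esub> t)
      \<in> bilinear_maps R HX XD X"
    by (assumption | rule act_rules)+
  have \<epsilon>: "(\<lambda>h y. counit H h \<odot>\<^bsub>X\<^esub> y) \<in> bilinear_maps R H X X"
    by (assumption | rule act_rules)+
  fix h x y \<theta> assume *: "h \<in> carrier H" "x \<in> carrier X" "y \<in> carrier X" "\<theta> \<in> carrier D"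
  then show "counits_X (straight (pure_tensor R H X h x) (pure_tensor R X D y \<theta>)) =
      lift_bilinear R X (\<lambda>h y. counit H h \<odot>\<^bsub>X\<^esub> y) (pure_tensor R H X h x) \<otimes>\<^bsub>X\<^esub>
      act \<one>\<^bsub>H\<^esub> (pure_tensor R X D y \<theta>)"
    using bilinear_closed[OF X_mult_bilinear]
      bilinear_closed[OF pure_tensor_bilinear[OF H_module D_module]]
    by (simp add: straight_pure counits_X_pure counits_pure act_pure H_one
        lift_bilinear_pure[OF H_module X_module X_module \<epsilon>] linear_smult[OF bilinear_left[OF X_mult_bilinear]]
        linear_smult[OF bilinear_right[OF X_mult_bilinear]] pairing_closed counit_closed
        m_comm flip: X.smult_assoc1)
qed

text \<open>
  The counit axioms of the two coactions turn the right-hand side of \<open>counits_straight\<close> at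
  \<open>(\<alpha>(x), \<beta>(y))\<close> into \<open>x y\<close>.
\<close>

lemma heisenberg_imp_left_left:
  assumes "x \<in> carrier X" "y \<in> carrier X" "straight (\<alpha> x) (\<beta> y) = crossed (\<alpha> x) (\<beta> y)"
  shows "x \<otimes>\<^bsub>X\<^esub> y = braided_mult (\<alpha> x) (\<beta> y)"
proof -
  have \<alpha>: "\<alpha> x \<in> carrier HX" and \<beta>: "\<beta> y \<in> carrier XD"
    using assms linear_closed[OF \<alpha>_linear] linear_closed[OF \<beta>_linear] by auto
  have "braided_mult (\<alpha> x) (\<beta> y) = counits_X (straight (\<alpha> x) (\<beta> y))"
    by (simp only: assms(3) counits_crossed[OF \<alpha> \<beta>])
  also have "\<dots> = x \<otimes>\<^bsub>X\<^esub> y"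
    using assms(1,2) by (simp add: counits_straight \<alpha> \<beta> \<alpha>_counit act_def \<beta>_counit)
  finally show ?thesis by simp
qed

section \<open>From the action to the Heisenberg condition\<close>

text \<open>
  Both maps send \<open>(a \<otimes> w, (y \<otimes> \<phi>) \<otimes> \<psi>)\<close>, for \<open>w\<close> in \<open>H \<otimes> X\<close>, to \<open>(a # \<psi>)\<close> tensored with the braided product
  of \<open>w\<close> and \<open>y \<otimes> \<phi>\<close>; the outer legs \<open>a\<close> and \<open>\<psi>\<close> are left alone. The first takes its second argument in
  \<open>(X \<otimes> D) \<otimes> D\<close>, where \<open>(\<beta> \<otimes> id) \<beta>\<close> lives, and the second in \<open>X \<otimes> (D \<otimes> D)\<close>, where \<open>(id \<otimes> \<Delta>) \<beta>\<close> lives.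
\<close>

definition inner_mult where
  "inner_mult u v = lift_bilinear R E (\<lambda>a w. lift_bilinear R E (\<lambda>z \<psi>.
    pure_tensor R HD X (pure_tensor R H D a \<psi>) (braided_mult w z)) v) u"

definition inner_mult_assoc where
  "inner_mult_assoc u v = lift_bilinear R E (\<lambda>a w. lift_bilinear R E (\<lambda>y \<tau>. lift_bilinear R E (\<lambda>\<phi> \<psi>.
    pure_tensor R HD X (pure_tensor R H D a \<psi>) (braided_mult w (pure_tensor R X D y \<phi>))) \<tau>) v) u"

lemmas mult_rules = linear_bilinear_left[OF braided_mult_bilinear]
  linear_bilinear_right[OF braided_mult_bilinear] bilinear_closed[OF braided_mult_bilinear] act_rules

lemma inner_mult_bilinear:
  "(\<lambda>u v. inner_mult u v) \<in> bilinear_maps R (tensor_space R H HX) (tensor_space R XD D) E"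
  unfolding inner_mult_def by (assumption | rule mult_rules)+

lemma inner_mult_assoc_bilinear:
  "(\<lambda>u v. inner_mult_assoc u v) \<in> bilinear_maps R (tensor_space R H HX) (tensor_space R X (tensor_space R D D)) E"
  unfolding inner_mult_assoc_def by (assumption | rule mult_rules)+

lemma inner_mult_pure:
  "a \<in> carrier H \<Longrightarrow> w \<in> carrier HX \<Longrightarrow> z \<in> carrier XD \<Longrightarrow> \<psi> \<in> carrier D \<Longrightarrow>
    inner_mult (pure_tensor R H HX a w) (pure_tensor R XD D z \<psi>) =
    pure_tensor R HD X (pure_tensor R H D a \<psi>) (braided_mult w z)"
  unfolding inner_mult_def
  by (rule lift_lift_pure[OF H_module HX_module XD_module D_module E_module]; (assumption | rule mult_rules)+)

lemma DD_module: "module R (tensor_space R D D)"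
  by (intro modules)

lemma inner_mult_assoc_pure:
  "a \<in> carrier H \<Longrightarrow> w \<in> carrier HX \<Longrightarrow> y \<in> carrier X \<Longrightarrow> \<tau> \<in> carrier (tensor_space R D D) \<Longrightarrow>
    inner_mult_assoc (pure_tensor R H HX a w) (pure_tensor R X (tensor_space R D D) y \<tau>) =
    lift_bilinear R E (\<lambda>\<phi> \<psi>. pure_tensor R HD X (pure_tensor R H D a \<psi>)
      (braided_mult w (pure_tensor R X D y \<phi>))) \<tau>"
  unfolding inner_mult_assoc_def
  by (rule lift_lift_pure[OF H_module HX_module X_module DD_module E_module]; (assumption | rule mult_rules)+)

text \<open>
  Bilinear extension reduces \<open>v\<close> to \<open>z \<otimes> \<psi>\<close> with \<open>z\<close> an arbitrary element of \<open>X \<otimes> D\<close>. Reassociation is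
  explicit only when \<open>z\<close> is a pure tensor too, hence the second extension.
\<close>

lemma inner_mult_assoc_eq:
  assumes u: "u \<in> carrier (tensor_space R H HX)" and v: "v \<in> carrier (tensor_space R XD D)"
  shows "inner_mult_assoc u (tensor_assoc R X D D v) = inner_mult u v"
proof (rule tensor_bilinear_ext[OF H_module HX_module XD_module D_module E_module _ inner_mult_bilinear _ u v])
  note assoc = tensor_assoc_linear[OF X_module D_module D_module]
  show *: "(\<lambda>u v. inner_mult_assoc u (tensor_assoc R X D D v)) \<in> bilinear_maps R (tensor_space R H HX) (tensor_space R XD D) E"
    by (intro bilinearI linear_bilinear_left[OF inner_mult_assoc_bilinear] linear_bilinear_right[OF inner_mult_assoc_bilinear]
        linear_id linear_closed[OF assoc(1)] assoc(1))
  fix a w z \<psi> assume a: "a \<in> carrier H" and w: "w \<in> carrier HX" and z: "z \<in> carrier XD" and \<psi>: "\<psi> \<in> carrier D"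
  let ?p = "pure_tensor R H HX a w"
  have p: "?p \<in> carrier (tensor_space R H HX)"
    by (rule bilinear_closed[OF pure_tensor_bilinear[OF H_module HX_module] a w])
  show "inner_mult_assoc ?p (tensor_assoc R X D D (pure_tensor R XD D z \<psi>)) = inner_mult ?p (pure_tensor R XD D z \<psi>)"
  proof (rule tensor_linear_ext[OF X_module D_module E_module _ _ _ z])
    show "(\<lambda>z. inner_mult_assoc ?p (tensor_assoc R X D D (pure_tensor R XD D z \<psi>))) \<in> linear_maps R XD E"
      by (rule linear_comp[OF bilinear_right[OF * p] bilinear_left[OF pure_tensor_bilinear[OF XD_module D_module] \<psi>]])
    show "(\<lambda>z. inner_mult ?p (pure_tensor R XD D z \<psi>)) \<in> linear_maps R XD E"
      by (rule linear_comp[OF bilinear_right[OF inner_mult_bilinear p] bilinear_left[OF pure_tensor_bilinear[OF XD_module D_module] \<psi>]])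
    fix y \<phi> assume y: "y \<in> carrier X" and \<phi>: "\<phi> \<in> carrier D"
    have bil1: "(\<lambda>a b. pure_tensor R X (tensor_space R D D) a (pure_tensor R D D b \<psi>))
        \<in> bilinear_maps R X D (tensor_space R X (tensor_space R D D))"
      using \<psi> by - (assumption | rule mult_rules)+
    have bil2: "(\<lambda>\<phi> \<psi>. pure_tensor R HD X (pure_tensor R H D a \<psi>)
        (braided_mult w (pure_tensor R X D y \<phi>))) \<in> bilinear_maps R D D E"
      using a w y by - (assumption | rule mult_rules)+
    show "inner_mult_assoc ?p (tensor_assoc R X D D (pure_tensor R XD D (pure_tensor R X D y \<phi>) \<psi>)) =
        inner_mult ?p (pure_tensor R XD D (pure_tensor R X D y \<phi>) \<psi>)"
      using a w y \<phi> \<psi> bilinear_closed[OF pure_tensor_bilinear[OF X_module D_module]]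
        bilinear_closed[OF pure_tensor_bilinear[OF D_module D_module]]
      by (simp add: assoc(2) lift_bilinear_pure[OF X_module D_module _ bil1] tensor_module X_module D_module
          inner_mult_assoc_pure inner_mult_pure lift_bilinear_pure[OF D_module D_module E_module bil2])
  qed
qed

text \<open>
  After \<open>\<Delta>\<close> is applied to both legs, \<open>h\<^sub>(\<^sub>2\<^sub>)\<close> and \<open>\<theta>\<^sub>(\<^sub>1\<^sub>)\<close> are the inner ones and are paired by the braided product,
  which gives \<open>(h\<^sub>(\<^sub>1\<^sub>) # \<theta>\<^sub>(\<^sub>2\<^sub>)) \<otimes> p(h\<^sub>(\<^sub>2\<^sub>), \<theta>\<^sub>(\<^sub>1\<^sub>)) y x\<close>. The linear map \<open>u \<mapsto> u \<otimes> y x\<close> is pulled out of the two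
  Sweedler sums.
\<close>

lemma crossed_eq_inner_mult_assoc:
  assumes s: "s \<in> carrier HX" and t: "t \<in> carrier XD"
  shows "crossed s t = inner_mult_assoc
    (tensor_assoc R H H X (tensor_map R (tensor_space R H H) X (comult H) (\<lambda>y. y) s))
    (tensor_map R X (tensor_space R D D) (\<lambda>y. y) (comult D) t)"
proof (rule tensor_bilinear_ext[OF H_module X_module X_module D_module E_module crossed_bilinear _ _ s t])
  note assoc = tensor_assoc_linear[OF H_module H_module X_module]
  have HH: "module R (tensor_space R H H)" by (intro modules)
  note map1 = tensor_map_linear[OF H_module X_module HH X_module comult_linear linear_id]
    tensor_map_pure[OF H_module X_module HH X_module comult_linear linear_id]
  note map2 = tensor_map_linear[OF X_module D_module X_module DD_module linear_id dual_comult_linear]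
    tensor_map_pure[OF X_module D_module X_module DD_module linear_id dual_comult_linear]
  show "(\<lambda>s t. inner_mult_assoc
      (tensor_assoc R H H X (tensor_map R (tensor_space R H H) X (comult H) (\<lambda>y. y) s))
      (tensor_map R X (tensor_space R D D) (\<lambda>y. y) (comult D) t)) \<in> bilinear_maps R HX XD E"
    by (assumption | rule bilinearI linear_bilinear_left[OF inner_mult_assoc_bilinear]
        linear_bilinear_right[OF inner_mult_assoc_bilinear] linear_comp[OF assoc(1)] map1(1) map2(1)
        linear_closed[OF assoc(1)] linear_closed[OF map1(1)] linear_closed[OF map2(1)])+
  fix h x y \<theta> assume h: "h \<in> carrier H" and x: "x \<in> carrier X" and y: "y \<in> carrier X" and \<theta>: "\<theta> \<in> carrier D"
  interpret X: module R X by (rule X_module)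
  interpret HD: module R HD by (rule HD_module)
  interpret E: module R E by (rule E_module)
  note \<Delta>h = linear_closed[OF comult_linear h] and \<Delta>\<theta> = linear_closed[OF dual_comult_linear \<theta>]
  let ?v = "pure_tensor R X (tensor_space R D D) y (comult D \<theta>)"
  have v: "?v \<in> carrier (tensor_space R X (tensor_space R D D))"
    by (rule bilinear_closed[OF pure_tensor_bilinear[OF X_module DD_module] y \<Delta>\<theta>])
  have yx: "y \<otimes>\<^bsub>X\<^esub> x \<in> carrier X" by (rule bilinear_closed[OF X_mult_bilinear y x])
  note lin_yx = bilinear_left[OF pure_tensor_bilinear[OF HD_module X_module] yx]
  have bil0: "(\<lambda>\<phi> \<psi>. pairing b \<phi> \<odot>\<^bsub>HD\<^esub> pure_tensor R H D a \<psi>) \<in> bilinear_maps R D D HD"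
    if "a \<in> carrier H" "b \<in> carrier H" for a b
    using that by - (assumption | rule mult_rules)+
  have bil1: "(\<lambda>a b. lift_bilinear R HD (\<lambda>\<phi> \<psi>. pairing b \<phi> \<odot>\<^bsub>HD\<^esub> pure_tensor R H D a \<psi>) (comult D \<theta>))
      \<in> bilinear_maps R H H HD"
    using \<theta> by - (assumption | rule mult_rules)+
  have bil2: "(\<lambda>a b. pure_tensor R H HX a (pure_tensor R H X b x)) \<in> bilinear_maps R H H (tensor_space R H HX)"
    using x by - (assumption | rule mult_rules)+
  have "inner_mult_assoc
      (tensor_assoc R H H X (tensor_map R (tensor_space R H H) X (comult H) (\<lambda>y. y) (pure_tensor R H X h x)))
      (tensor_map R X (tensor_space R D D) (\<lambda>y. y) (comult D) (pure_tensor R X D y \<theta>)) =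
      inner_mult_assoc (lift_bilinear R (tensor_space R H HX) (\<lambda>a b. pure_tensor R H HX a (pure_tensor R H X b x)) (comult H h)) ?v"
    using h x y \<theta> \<Delta>h by (simp add: map1 map2 assoc(2))
  also have "\<dots> = lift_bilinear R E (\<lambda>a b. inner_mult_assoc (pure_tensor R H HX a (pure_tensor R H X b x)) ?v) (comult H h)"
    by (rule linear_lift_commute[OF H_module H_module _ E_module bilinear_left[OF inner_mult_assoc_bilinear v] bil2 \<Delta>h])
      (intro modules X_module)
  also have "\<dots> = lift_bilinear R E (\<lambda>a b. pure_tensor R HD X (lift_bilinear R HD (\<lambda>\<phi> \<psi>.
      pairing b \<phi> \<odot>\<^bsub>HD\<^esub> pure_tensor R H D a \<psi>) (comult D \<theta>)) (y \<otimes>\<^bsub>X\<^esub> x)) (comult H h)"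
  proof (rule lift_bilinear_cong[OF H_module H_module E_module \<Delta>h])
    show "(\<lambda>a b. inner_mult_assoc (pure_tensor R H HX a (pure_tensor R H X b x)) ?v) \<in> bilinear_maps R H H E"
      by (intro bilinearI linear_comp[OF bilinear_left[OF inner_mult_assoc_bilinear v]] bilinear_left[OF bil2]
          bilinear_right[OF bil2])
    fix a b assume a: "a \<in> carrier H" and b: "b \<in> carrier H"
    have bx: "pure_tensor R H X b x \<in> carrier HX"
      by (rule bilinear_closed[OF pure_tensor_bilinear[OF H_module X_module] b x])
    have bil3: "(\<lambda>\<phi> \<psi>. pure_tensor R HD X (pure_tensor R H D a \<psi>)
        (braided_mult (pure_tensor R H X b x) (pure_tensor R X D y \<phi>))) \<in> bilinear_maps R D D E"
      using a bx y by - (assumption | rule mult_rules)+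
    have "inner_mult_assoc (pure_tensor R H HX a (pure_tensor R H X b x)) ?v =
        lift_bilinear R E (\<lambda>\<phi> \<psi>. pure_tensor R HD X (pure_tensor R H D a \<psi>)
          (braided_mult (pure_tensor R H X b x) (pure_tensor R X D y \<phi>))) (comult D \<theta>)"
      by (rule inner_mult_assoc_pure[OF a bx y \<Delta>\<theta>])
    also have "\<dots> = lift_bilinear R E (\<lambda>\<phi> \<psi>. pure_tensor R HD X
        (pairing b \<phi> \<odot>\<^bsub>HD\<^esub> pure_tensor R H D a \<psi>) (y \<otimes>\<^bsub>X\<^esub> x)) (comult D \<theta>)"
    proof (rule lift_bilinear_cong[OF D_module D_module E_module \<Delta>\<theta> bil3])
      fix \<phi> \<psi> assume "\<phi> \<in> carrier D" "\<psi> \<in> carrier D"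
      then show "pure_tensor R HD X (pure_tensor R H D a \<psi>)
          (braided_mult (pure_tensor R H X b x) (pure_tensor R X D y \<phi>)) =
        pure_tensor R HD X (pairing b \<phi> \<odot>\<^bsub>HD\<^esub> pure_tensor R H D a \<psi>) (y \<otimes>\<^bsub>X\<^esub> x)"
        using a b x y yx bilinear_closed[OF pure_tensor_bilinear[OF X_module D_module]]
          bilinear_closed[OF pure_tensor_bilinear[OF H_module D_module]]
        by (simp add: braided_mult_pure act_pure pairing_closed
            linear_smult[OF bilinear_left[OF X_mult_bilinear]]
            linear_smult[OF bilinear_left[OF pure_tensor_bilinear[OF HD_module X_module]]]
            linear_smult[OF bilinear_right[OF pure_tensor_bilinear[OF HD_module X_module]]])
    qed
    also have "\<dots> = pure_tensor R HD X (lift_bilinear R HD (\<lambda>\<phi> \<psi>.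
        pairing b \<phi> \<odot>\<^bsub>HD\<^esub> pure_tensor R H D a \<psi>) (comult D \<theta>)) (y \<otimes>\<^bsub>X\<^esub> x)"
      by (rule linear_lift_commute[OF D_module D_module HD_module E_module lin_yx bil0[OF a b] \<Delta>\<theta>, symmetric])
    finally show "inner_mult_assoc (pure_tensor R H HX a (pure_tensor R H X b x)) ?v =
      pure_tensor R HD X (lift_bilinear R HD (\<lambda>\<phi> \<psi>.
        pairing b \<phi> \<odot>\<^bsub>HD\<^esub> pure_tensor R H D a \<psi>) (comult D \<theta>)) (y \<otimes>\<^bsub>X\<^esub> x)" .
  qed
  also have "\<dots> = pure_tensor R HD X (exchange \<theta> h) (y \<otimes>\<^bsub>X\<^esub> x)"
    unfolding exchange_def
    by (rule linear_lift_commute[OF H_module H_module HD_module E_module lin_yx bil1 \<Delta>h, symmetric])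
  finally show "crossed (pure_tensor R H X h x) (pure_tensor R X D y \<theta>) = inner_mult_assoc
      (tensor_assoc R H H X (tensor_map R (tensor_space R H H) X (comult H) (\<lambda>y. y) (pure_tensor R H X h x)))
      (tensor_map R X (tensor_space R D D) (\<lambda>y. y) (comult D) (pure_tensor R X D y \<theta>))"
    using h x y \<theta> by (simp add: crossed_pure)
qed

text \<open>
  On \<open>(h \<otimes> x, y \<otimes> \<theta>)\<close> the inner braided product is that of \<open>\<alpha>(x)\<close> and \<open>\<beta>(y)\<close>, which is \<open>x y\<close> by assumption.
\<close>

lemma inner_mult_coactions:
  assumes comm: "\<And>x y. x \<in> carrier X \<Longrightarrow> y \<in> carrier X \<Longrightarrow> x \<otimes>\<^bsub>X\<^esub> y = braided_mult (\<alpha> x) (\<beta> y)"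
    and s: "s \<in> carrier HX" and t: "t \<in> carrier XD"
  shows "inner_mult (tensor_map R H HX (\<lambda>y. y) \<alpha> s) (tensor_map R XD D \<beta> (\<lambda>y. y) t) = straight s t"
proof (rule tensor_bilinear_ext[OF H_module X_module X_module D_module E_module _ straight_bilinear _ s t])
  note map1 = tensor_map_linear[OF H_module X_module H_module HX_module linear_id \<alpha>_linear]
    tensor_map_pure[OF H_module X_module H_module HX_module linear_id \<alpha>_linear]
  note map2 = tensor_map_linear[OF X_module D_module XD_module D_module \<beta>_linear linear_id]
    tensor_map_pure[OF X_module D_module XD_module D_module \<beta>_linear linear_id]
  show "(\<lambda>s t. inner_mult (tensor_map R H HX (\<lambda>y. y) \<alpha> s) (tensor_map R XD D \<beta> (\<lambda>y. y) t))
      \<in> bilinear_maps R HX XD E"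
    by (assumption | rule bilinearI linear_bilinear_left[OF inner_mult_bilinear]
        linear_bilinear_right[OF inner_mult_bilinear] map1(1) map2(1)
        linear_closed[OF map1(1)] linear_closed[OF map2(1)])+
  fix h x y \<theta> assume *: "h \<in> carrier H" "x \<in> carrier X" "y \<in> carrier X" "\<theta> \<in> carrier D"
  then show "inner_mult (tensor_map R H HX (\<lambda>y. y) \<alpha> (pure_tensor R H X h x))
      (tensor_map R XD D \<beta> (\<lambda>y. y) (pure_tensor R X D y \<theta>)) =
    straight (pure_tensor R H X h x) (pure_tensor R X D y \<theta>)"
    using linear_closed[OF \<alpha>_linear] linear_closed[OF \<beta>_linear]
    by (simp add: map1 map2 inner_mult_pure straight_pure comm)
qed

lemma left_left_imp_heisenberg:
  assumes comm: "\<And>x y. x \<in> carrier X \<Longrightarrow> y \<in> carrier X \<Longrightarrow> x \<otimes>\<^bsub>X\<^esub> y = braided_mult (\<alpha> x) (\<beta> y)"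
    and x: "x \<in> carrier X" and y: "y \<in> carrier X"
  shows "straight (\<alpha> x) (\<beta> y) = crossed (\<alpha> x) (\<beta> y)"
proof -
  have \<alpha>: "\<alpha> x \<in> carrier HX" and \<beta>: "\<beta> y \<in> carrier XD"
    using x y linear_closed[OF \<alpha>_linear] linear_closed[OF \<beta>_linear] by auto
  have u: "tensor_map R H HX (\<lambda>y. y) \<alpha> (\<alpha> x) \<in> carrier (tensor_space R H HX)"
    by (rule linear_closed[OF tensor_map_linear[OF H_module X_module H_module HX_module linear_id \<alpha>_linear] \<alpha>])
  have v: "tensor_map R XD D \<beta> (\<lambda>y. y) (\<beta> y) \<in> carrier (tensor_space R XD D)"
    by (rule linear_closed[OF tensor_map_linear[OF X_module D_module XD_module D_module \<beta>_linear linear_id] \<beta>])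
  have "straight (\<alpha> x) (\<beta> y) =
      inner_mult (tensor_map R H HX (\<lambda>y. y) \<alpha> (\<alpha> x)) (tensor_map R XD D \<beta> (\<lambda>y. y) (\<beta> y))"
    by (rule inner_mult_coactions[OF comm \<alpha> \<beta>, symmetric])
  also have "\<dots> = inner_mult_assoc (tensor_map R H HX (\<lambda>y. y) \<alpha> (\<alpha> x))
      (tensor_assoc R X D D (tensor_map R XD D \<beta> (\<lambda>y. y) (\<beta> y)))"
    by (rule inner_mult_assoc_eq[OF u v, symmetric])
  also have "\<dots> = crossed (\<alpha> x) (\<beta> y)"
    unfolding \<alpha>_coassoc[OF x] \<beta>_coassoc[OF y] by (rule crossed_eq_inner_mult_assoc[OF \<alpha> \<beta>, symmetric])
  finally show ?thesis .
qed

end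

section \<open>The equivalence\<close>

theorem proposition4p8:
  fixes R :: "('r, 'p) ring_scheme"
    and H :: "('r, 'h, 'm) hopf_scheme"
    and X :: "('r, 'x, 'n) module_scheme"
    and \<alpha> :: "'x \<Rightarrow> ('h \<times> 'x \<Rightarrow> 'r) set"
    and \<beta> :: "'x \<Rightarrow> ('x \<times> ('h \<Rightarrow> 'r) \<Rightarrow> 'r) set"
  assumes "hopf_algebra R H"
    and "finite_dimensional R H"
    and "yetter_drinfeld_algebra R H X \<alpha> \<beta>"
  shows "braided_commutative R H X \<alpha> \<beta> \<longleftrightarrow>
    left_left_braided_commutative R X (induced_action R X \<beta>) \<alpha>"
proof -
  have "cring R"
    using hopf_algebra.axioms(1)[OF assms(1)] unital_algebra.axioms(2) module.axioms(1) by blast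
  then interpret coacted_algebra R H X \<alpha> \<beta>
    using assms
    by (auto simp: coacted_algebra_def coacted_algebra_axioms_def finite_hopf_def
        finite_hopf_axioms_def yetter_drinfeld_algebra_def Let_def)
  show ?thesis
    unfolding braided_commutative_iff left_left_iff
    using heisenberg_imp_left_left left_left_imp_heisenberg by blast
qed

end
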